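(* There are algorithms that find an optimal solution of any feasible instance of the RAP--NC (as defined in the context), with continuous variables or with integer variables, in $\mathcal{O}(n \log m)$ time in each of the following cases: (i) all functions $f_i$ are (convex) quadratic; (ii) all functions $f_i$ are linear. Here $n$ is the number of decision variables and $m$ is the number of nested constraints (including the global resource constraint).
   Context: The resource allocation problem with nested lower and upper constraints (RAP--NC) is $$\min \sum_{i=1}^n f_i(x_i) \quad \text{s.t.} \quad a_i \le \sum_{k=1}^{\sigma[i]} x_k \le b_i \ (i \in \{1,\dots,m-1\}), \quad \sum_{k=1}^n x_k = B, \quad c_i \le x_i \le d_i \ (i\in\{1,\dots,n\}),$$ where $(\sigma[1],\dots,\sigma[m])$ is a (strictly increasing) subsequence of $(1,\dots,n)$ with $\sigma[m]=n$. The coefficients $a_i,b_i,c_i,d_i$ and $B$ are integers, and $a_i \le b_i$ for all $i$. The variables range over $\mathbb{R}^n$ (continuous case) or $\mathbb{Z}^n$ (integer case). Time is the number of elementary operations (the bound is strongly polynomial: it does not depend on the magnitude of the data). As usual, the factor $\log m$ is understood to be at least $1$. *)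

theory Defs
  imports "HOL-Analysis.Analysis"
begin

section \<open>The problem\<close>

text \<open>As in the mathematical definition, all index ranges start at 1; the values of the
  functions outside of these ranges are irrelevant.  The number of nested constraints
  \<open>num_cons\<close> includes the resource constraint, and \<open>nest_lo\<close>, \<open>nest_up\<close> are used only at the
  indices \<open>1..num_cons - 1\<close>.\<close>

record rapnc =
  num_vars :: nat
  num_cons :: nat
  sigma :: "nat \<Rightarrow> nat"
  nest_lo :: "nat \<Rightarrow> int"
  nest_up :: "nat \<Rightarrow> int"
  resource :: int
  var_lo :: "nat \<Rightarrow> int"
  var_up :: "nat \<Rightarrow> int"

definition is_rapnc :: "rapnc \<Rightarrow> bool" where
  "is_rapnc I \<longleftrightarrow>
     1 \<le> num_cons I \<and>
     strict_mono_on {1..num_cons I} (sigma I) \<and>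
     sigma I ` {1..num_cons I} \<subseteq> {1..num_vars I} \<and>
     sigma I (num_cons I) = num_vars I \<and>
     (\<forall>i\<in>{1..num_cons I - 1}. nest_lo I i \<le> nest_up I i)"

datatype variables = Continuous | Integer

fun range_of :: "variables \<Rightarrow> real set" where
  "range_of Continuous = UNIV"
| "range_of Integer = \<int>"

definition feasible_point :: "variables \<Rightarrow> rapnc \<Rightarrow> (nat \<Rightarrow> real) \<Rightarrow> bool" where
  "feasible_point K I x \<longleftrightarrow>
     (\<forall>i\<in>{1..num_vars I}. x i \<in> range_of K) \<and>
     (\<forall>i\<in>{1..num_cons I - 1}.
        real_of_int (nest_lo I i) \<le> (\<Sum>k=1..sigma I i. x k) \<and>
        (\<Sum>k=1..sigma I i. x k) \<le> real_of_int (nest_up I i)) \<and>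
     (\<Sum>k=1..num_vars I. x k) = real_of_int (resource I) \<and>
     (\<forall>i\<in>{1..num_vars I}.
        real_of_int (var_lo I i) \<le> x i \<and> x i \<le> real_of_int (var_up I i))"

definition feasible :: "variables \<Rightarrow> rapnc \<Rightarrow> bool" where
  "feasible K I \<longleftrightarrow> (\<exists>x. feasible_point K I x)"

definition objective :: "rapnc \<Rightarrow> (nat \<Rightarrow> real \<Rightarrow> real) \<Rightarrow> (nat \<Rightarrow> real) \<Rightarrow> real" where
  "objective I f x = (\<Sum>i=1..num_vars I. f i (x i))"

definition optimal_solution ::
  "variables \<Rightarrow> rapnc \<Rightarrow> (nat \<Rightarrow> real \<Rightarrow> real) \<Rightarrow> (nat \<Rightarrow> real) \<Rightarrow> bool" where
  "optimal_solution K I f x \<longleftrightarrow>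
     feasible_point K I x \<and>
     (\<forall>y. feasible_point K I y \<longrightarrow> objective I f x \<le> objective I f y)"

definition quadratic_fun :: "real \<Rightarrow> real \<Rightarrow> real \<Rightarrow> real \<Rightarrow> real" where
  "quadratic_fun q p r x = q * x\<^sup>2 + p * x + r"

definition linear_fun :: "real \<Rightarrow> real \<Rightarrow> real \<Rightarrow> real" where
  "linear_fun p r x = p * x + r"


section \<open>The machine model\<close>

text \<open>Algorithms are finite first-order recursive programs over real numbers (exact, one per
  memory word) and immutable linked cells.  The constants of a program are integers, so no
  information can be hidden in them.  Every construct below is one elementary operation; since a
  program has a fixed number of variables and binding a variable copies a pointer, a real RAM
  executes each of them in constant time.  There is no random access to memory: a time bound
  for this model is therefore also one for the real RAM.\<close>

datatype val = Num real | Nil_cell | Cell val val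

datatype arith = Plus | Minus | Times | Divide

fun arith_op :: "arith \<Rightarrow> real \<Rightarrow> real \<Rightarrow> real" where
  "arith_op Plus x y = x + y"
| "arith_op Minus x y = x - y"
| "arith_op Times x y = x * y"
| "arith_op Divide x y = x / y"

text \<open>Variables are de Bruijn indices: \<open>EVar 0\<close> is the most recently bound variable.\<close>

datatype exp =
    EVar nat
  | EConst int
  | EArith arith exp exp
  | EFloor exp
  | EIfLe exp exp exp exp      \<comment> \<open>if \<open>e1 \<le> e2\<close> then \<open>e3\<close> else \<open>e4\<close>\<close>
  | ENil
  | ECell exp exp
  | ECase exp exp exp          \<comment> \<open>the third branch binds head (index 0) and tail (index 1)\<close>
  | ELet exp exp
  | ECall nat exp              \<comment> \<open>call of the function with the given number\<close>

type_synonym program = "exp list"    \<comment> \<open>the bodies of the functions, each of one argument\<close>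

text \<open>\<open>eval rnd P \<rho> e v t\<close>: in the environment \<open>\<rho>\<close> the expression \<open>e\<close> evaluates to \<open>v\<close> with
  exactly \<open>t\<close> elementary operations.  Type errors and divisions by zero have no result.  The flag
  \<open>rnd\<close> says whether rounding is an elementary operation.\<close>

inductive eval :: "bool \<Rightarrow> program \<Rightarrow> val list \<Rightarrow> exp \<Rightarrow> val \<Rightarrow> nat \<Rightarrow> bool"
  for rnd :: bool and P :: program where
  Var: "i < length \<rho> \<Longrightarrow> eval rnd P \<rho> (EVar i) (\<rho> ! i) 1"
| Const: "eval rnd P \<rho> (EConst k) (Num (real_of_int k)) 1"
| Arith: "\<lbrakk>eval rnd P \<rho> e1 (Num x) t1; eval rnd P \<rho> e2 (Num y) t2; f = Divide \<Longrightarrow> y \<noteq> 0\<rbrakk>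
    \<Longrightarrow> eval rnd P \<rho> (EArith f e1 e2) (Num (arith_op f x y)) (t1 + t2 + 1)"
| Floor: "\<lbrakk>rnd; eval rnd P \<rho> e (Num x) t\<rbrakk>
    \<Longrightarrow> eval rnd P \<rho> (EFloor e) (Num (real_of_int \<lfloor>x\<rfloor>)) (t + 1)"
| If_true: "\<lbrakk>eval rnd P \<rho> e1 (Num x) t1; eval rnd P \<rho> e2 (Num y) t2; x \<le> y; eval rnd P \<rho> e3 v t3\<rbrakk>
    \<Longrightarrow> eval rnd P \<rho> (EIfLe e1 e2 e3 e4) v (t1 + t2 + t3 + 1)"
| If_false: "\<lbrakk>eval rnd P \<rho> e1 (Num x) t1; eval rnd P \<rho> e2 (Num y) t2; \<not> x \<le> y; eval rnd P \<rho> e4 v t4\<rbrakk>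
    \<Longrightarrow> eval rnd P \<rho> (EIfLe e1 e2 e3 e4) v (t1 + t2 + t4 + 1)"
| Nil: "eval rnd P \<rho> ENil Nil_cell 1"
| Cell: "\<lbrakk>eval rnd P \<rho> e1 v t1; eval rnd P \<rho> e2 w t2\<rbrakk>
    \<Longrightarrow> eval rnd P \<rho> (ECell e1 e2) (Cell v w) (t1 + t2 + 1)"
| Case_nil: "\<lbrakk>eval rnd P \<rho> e Nil_cell t; eval rnd P \<rho> e1 v t1\<rbrakk>
    \<Longrightarrow> eval rnd P \<rho> (ECase e e1 e2) v (t + t1 + 1)"
| Case_cell: "\<lbrakk>eval rnd P \<rho> e (Cell u w) t; eval rnd P (u # w # \<rho>) e2 v t2\<rbrakk>
    \<Longrightarrow> eval rnd P \<rho> (ECase e e1 e2) v (t + t2 + 1)"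
| Let: "\<lbrakk>eval rnd P \<rho> e1 u t1; eval rnd P (u # \<rho>) e2 v t2\<rbrakk>
    \<Longrightarrow> eval rnd P \<rho> (ELet e1 e2) v (t1 + t2 + 1)"
| Call: "\<lbrakk>eval rnd P \<rho> e u t1; g < length P; eval rnd P [u] (P ! g) v t2\<rbrakk>
    \<Longrightarrow> eval rnd P \<rho> (ECall g e) v (t1 + t2 + 1)"

inductive_cases eval_VarE: "eval rnd P \<rho> (EVar i) v t"
inductive_cases eval_ConstE: "eval rnd P \<rho> (EConst k) v t"
inductive_cases eval_ArithE: "eval rnd P \<rho> (EArith f e1 e2) v t"
inductive_cases eval_FloorE: "eval rnd P \<rho> (EFloor e) v t"
inductive_cases eval_IfLeE: "eval rnd P \<rho> (EIfLe e1 e2 e3 e4) v t"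
inductive_cases eval_NilE: "eval rnd P \<rho> ENil v t"
inductive_cases eval_CellE: "eval rnd P \<rho> (ECell e1 e2) v t"
inductive_cases eval_CaseE: "eval rnd P \<rho> (ECase e e1 e2) v t"
inductive_cases eval_LetE: "eval rnd P \<rho> (ELet e1 e2) v t"
inductive_cases eval_CallE: "eval rnd P \<rho> (ECall g e) v t"

text \<open>An execution has at most one result and running time.\<close>

lemma eval_deterministic:
  assumes "eval rnd P \<rho> e v t" and "eval rnd P \<rho> e v' t'"
  shows "v' = v \<and> t' = t"
  using assms
proof (induction arbitrary: v' t' rule: eval.induct)
  case Var
  from Var.prems show ?case by (rule eval_VarE) simp
next
  case Const
  from Const.prems show ?case by (rule eval_ConstE) simp
next
  case Arith
  from Arith.prems show ?case by (rule eval_ArithE) (auto dest!: Arith.IH)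
next
  case (Floor \<rho> e x t)
  from Floor.prems obtain y s where "v' = Num (real_of_int \<lfloor>y\<rfloor>)" "t' = s + 1" "eval rnd P \<rho> e (Num y) s"
    by (elim eval_FloorE) simp
  with Floor.IH[of "Num y" s] show ?case by simp
next
  case If_true
  from If_true.prems If_true.hyps show ?case by (elim eval_IfLeE) (auto dest!: If_true.IH)
next
  case If_false
  from If_false.prems If_false.hyps show ?case by (elim eval_IfLeE) (auto dest!: If_false.IH)
next
  case Nil
  from Nil.prems show ?case by (rule eval_NilE) simp
next
  case Cell
  from Cell.prems show ?case by (rule eval_CellE) (auto dest!: Cell.IH)
next
  case Case_nil
  from Case_nil.prems show ?case by (rule eval_CaseE) (auto dest!: Case_nil.IH)
next
  case Case_cell
  from Case_cell.prems show ?case by (rule eval_CaseE) (auto dest!: Case_cell.IH)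
next
  case Let
  from Let.prems show ?case by (rule eval_LetE) (auto dest!: Let.IH)
next
  case Call
  from Call.prems show ?case by (rule eval_CallE) (auto dest!: Call.IH)
qed

text \<open>A program is started by calling its function 0 with the input.\<close>

definition runs :: "bool \<Rightarrow> program \<Rightarrow> val \<Rightarrow> val \<Rightarrow> nat \<Rightarrow> bool" where
  "runs rnd P input output t \<longleftrightarrow> P \<noteq> [] \<and> eval rnd P [input] (P ! 0) output t"

definition encode_list :: "val list \<Rightarrow> val" where
  "encode_list vs = foldr Cell vs Nil_cell"

definition encode_vector :: "nat \<Rightarrow> (nat \<Rightarrow> real) \<Rightarrow> val" where
  "encode_vector k x = encode_list (map (\<lambda>i. Num (x i)) [1..<k + 1])"

text \<open>The input lists all data of the instance, followed by the vectors \<open>cs\<close> of coefficients of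
  the objective.\<close>

definition encode_instance :: "rapnc \<Rightarrow> (nat \<Rightarrow> real) list \<Rightarrow> val" where
  "encode_instance I cs = encode_list
     ([Num (real (num_vars I)),
       Num (real (num_cons I)),
       encode_vector (num_cons I) (\<lambda>i. real (sigma I i)),
       encode_vector (num_cons I - 1) (\<lambda>i. real_of_int (nest_lo I i)),
       encode_vector (num_cons I - 1) (\<lambda>i. real_of_int (nest_up I i)),
       Num (real_of_int (resource I)),
       encode_vector (num_vars I) (\<lambda>i. real_of_int (var_lo I i)),
       encode_vector (num_vars I) (\<lambda>i. real_of_int (var_up I i))]
      @ map (encode_vector (num_vars I)) cs)"

text \<open>Rounding is an elementary operation only for integer variables.  There it cannot be
  dispensed with: with arithmetic operations and comparisons alone, integer quadratic resource
  allocation has no strongly polynomial algorithm (Hochbaum, 1994).\<close>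

definition solves_within ::
  "variables \<Rightarrow> program \<Rightarrow> rapnc \<Rightarrow> (nat \<Rightarrow> real \<Rightarrow> real) \<Rightarrow> (nat \<Rightarrow> real) list \<Rightarrow> real \<Rightarrow> bool" where
  "solves_within K P I f cs bound \<longleftrightarrow>
     (\<exists>x t. runs (K = Integer) P (encode_instance I cs) (encode_vector (num_vars I) x) t \<and>
            optimal_solution K I f x \<and> real t \<le> bound)"

definition n_log_m :: "rapnc \<Rightarrow> real" where
  "n_log_m I = real (num_vars I) * max 1 (log 2 (real (num_cons I)))"

end

theory Submission
  imports Defs
begin

text \<open>An allocation is called canonical if no exchange along the nested constraints improves it,
  where ties are broken by position.  A canonical solution exists, is optimal and unique, and depends
  monotonically on the cumulative amounts at the two ends of a block of variables.  If a block is
  cut at a nested constraint, the solutions of its two parts for the extreme amounts at the cut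
  are therefore bounds for the solution of the block, and within these bounds it solves a problem with
  a single constraint.  The multiplier of such a problem is found in linear time by a search
  with medians of medians; for integer variables, two continuous problems first enclose it such that only
  linearly many breakpoints remain.  Merging neighbouring blocks in pairs takes \<open>log m\<close> passes of linear
  time.\<close>

section \<open>Canonical solutions\<close>

text \<open>Optimal solutions need not be monotone in the end amounts: with linear costs or integer
  variables there can be several optima, and two unrelated ones need not be comparable. The
  tie-breaking restores uniqueness without perturbing the costs. That the constraints inside a block
  may be dropped has a second reason besides monotonicity. The solutions that provide the new bounds
  are themselves feasible, so a variable strictly inside such a bound forces the cumulative amount
  of the solution strictly away from the nested bound that could block an exchange. Only the two
  extreme amounts occur at each end of a block, so four solutions per block are enough to go on
  merging. All four must exist, which the bounds of the variables do not guarantee. Bounded slack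
  variables, priced above every marginal cost, repair this; by uniqueness they are zero in the
  solution of a feasible instance. Linear costs are the case \<open>q = 0\<close> throughout. The
  number of unit steps of an integer response depends on the magnitude of the data; this is the
  obstacle to a strongly polynomial bound for integer variables.\<close>

definition marg_dn :: "variables \<Rightarrow> real \<Rightarrow> real \<Rightarrow> real \<Rightarrow> real" where
  "marg_dn K q p x = q * (2 * x - (if K = Integer then 1 else 0)) + p"

text \<open>For \<open>f x = q * x\<^sup>2 + p * x\<close>, both marginals are the derivative of
  \<open>f\<close> in the continuous case. In the integer case they are the differences
  \<open>f x - f (x - 1)\<close> and \<open>f (x + 1) - f x\<close>: what giving up a unit saves and
  what receiving a unit costs.\<close>

definition marg_up :: "variables \<Rightarrow> real \<Rightarrow> real \<Rightarrow> real \<Rightarrow> real" where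
  "marg_up K q p x = q * (2 * x + (if K = Integer then 1 else 0)) + p"

text \<open>Equal marginals permit an exchange without change of cost only if both costs are locally
  affine on the amount exchanged: a whole unit in the integer case, any amount for a linear cost.
  With continuous variables and \<open>q > 0\<close> on one side, every positive amount already
  loses.\<close>

definition ties :: "variables \<Rightarrow> real \<Rightarrow> bool" where
  "ties K q \<longleftrightarrow> K = Integer \<or> q = 0"

lemma int_less_ge_one: "x \<in> \<int> \<Longrightarrow> y \<in> \<int> \<Longrightarrow> x < (y::real) \<Longrightarrow> x + 1 \<le> y"
  by (elim Ints_cases) auto

lemma marg_up_le_dn:
  assumes "0 \<le> q" "x < y" "x \<in> range_of K" "y \<in> range_of K"
  shows "marg_up K q p x \<le> marg_dn K q p y"
proof (cases K)
  case Continuous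
  then show ?thesis using assms by (auto simp: marg_up_def marg_dn_def intro!: mult_left_mono)
next
  case Integer
  then have "x + 1 \<le> y" using assms int_less_ge_one by auto
  then show ?thesis using assms Integer by (auto simp: marg_up_def marg_dn_def intro!: mult_left_mono)
qed

lemma marg_up_less_dn:
  assumes "0 \<le> q" "x < y" "\<not> ties K q"
  shows "marg_up K q p x < marg_dn K q p y"
  using assms by (auto simp: marg_up_def marg_dn_def ties_def)

locale quad_costs =
  fixes K :: variables and q p :: "nat \<Rightarrow> real"
  assumes q_nonneg: "0 \<le> q i"
begin

text \<open>Positions are counted from 0, and a block \<open>[l, r)\<close> of positions starts with the cumulative
  amount \<open>L\<close> and ends with \<open>R\<close>; the nested constraint at \<open>k \<in> E\<close> concerns the positions before
  \<open>k\<close>.\<close>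

definition block_point ::
  "nat set \<Rightarrow> (nat \<Rightarrow> real) \<Rightarrow> (nat \<Rightarrow> real) \<Rightarrow> (nat \<Rightarrow> real) \<Rightarrow> (nat \<Rightarrow> real) \<Rightarrow> nat \<Rightarrow> nat \<Rightarrow> real \<Rightarrow> real
    \<Rightarrow> (nat \<Rightarrow> real) \<Rightarrow> bool" where
  "block_point E a b c d l r L R x \<longleftrightarrow>
     (\<forall>i\<in>{l..<r}. x i \<in> range_of K \<and> c i \<le> x i \<and> x i \<le> d i) \<and>
     (\<forall>k\<in>E \<inter> {l<..<r}. a k \<le> L + sum x {l..<k} \<and> L + sum x {l..<k} \<le> b k) \<and>
     L + sum x {l..<r} = R"

text \<open>The variable \<open>i\<close> gives and \<open>j\<close> receives. Cumulative amounts
  between them fall if \<open>i < j\<close> and rise otherwise, so only one of the two nested bounds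
  has to leave room.\<close>

definition movable ::
  "nat set \<Rightarrow> (nat \<Rightarrow> real) \<Rightarrow> (nat \<Rightarrow> real) \<Rightarrow> nat \<Rightarrow> real \<Rightarrow> (nat \<Rightarrow> real) \<Rightarrow> nat \<Rightarrow> nat \<Rightarrow> bool" where
  "movable E a b l L x i j \<longleftrightarrow>
     (\<forall>k\<in>E. (i < k \<and> k \<le> j \<longrightarrow> a k < L + sum x {l..<k}) \<and>
             (j < k \<and> k \<le> i \<longrightarrow> L + sum x {l..<k} < b k))"

definition no_gain :: "(nat \<Rightarrow> real) \<Rightarrow> nat \<Rightarrow> nat \<Rightarrow> bool" where
  "no_gain x i j \<longleftrightarrow>
     marg_dn K (q i) (p i) (x i) \<le> marg_up K (q j) (p j) (x j) \<and>
     (marg_dn K (q i) (p i) (x i) = marg_up K (q j) (p j) (x j) \<longrightarrow>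
        ties K (q i) \<longrightarrow> ties K (q j) \<longrightarrow> i < j)"

text \<open>Optimality under shifting an amount from one variable to another one, where ties are broken
  in favour of smaller positions; this makes the solution unique.\<close>

definition canonical ::
  "nat set \<Rightarrow> (nat \<Rightarrow> real) \<Rightarrow> (nat \<Rightarrow> real) \<Rightarrow> (nat \<Rightarrow> real) \<Rightarrow> (nat \<Rightarrow> real) \<Rightarrow> nat \<Rightarrow> nat \<Rightarrow> real \<Rightarrow> real
    \<Rightarrow> (nat \<Rightarrow> real) \<Rightarrow> bool" where
  "canonical E a b c d l r L R x \<longleftrightarrow>
     block_point E a b c d l r L R x \<and>
     (\<forall>i\<in>{l..<r}. \<forall>j\<in>{l..<r}. i \<noteq> j \<longrightarrow> j < r \<longrightarrow> c i < x i \<longrightarrow> x j < d j \<longrightarrow>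
        movable E a b l L x i j \<longrightarrow> no_gain x i j)"

text \<open>Convexity closes the chain dn(x,i) \<le> up(x,j) \<le> dn(y,j) \<le> up(y,i) \<le>
  dn(x,i) of marginals, so all of them are equal. Equality in the convexity steps forces
  \<open>ties\<close> at both positions, and the tie rule then demands both \<open>i < j\<close> and
  \<open>j < i\<close>.\<close>

lemma no_gain_cycle:
  assumes "no_gain x i j" "no_gain y j i" "y i < x i" "x j < y j" "i \<noteq> j"
    and "x i \<in> range_of K" "x j \<in> range_of K" "y i \<in> range_of K" "y j \<in> range_of K"
  shows False
proof -
  have j: "marg_up K (q j) (p j) (x j) \<le> marg_dn K (q j) (p j) (y j)"
    "\<not> ties K (q j) \<Longrightarrow> marg_up K (q j) (p j) (x j) < marg_dn K (q j) (p j) (y j)"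
    using assms q_nonneg by (auto intro: marg_up_le_dn marg_up_less_dn)
  have i: "marg_up K (q i) (p i) (y i) \<le> marg_dn K (q i) (p i) (x i)"
    "\<not> ties K (q i) \<Longrightarrow> marg_up K (q i) (p i) (y i) < marg_dn K (q i) (p i) (x i)"
    using assms q_nonneg by (auto intro: marg_up_le_dn marg_up_less_dn)
  show False
    using i j assms(1,2,5) unfolding no_gain_def by (smt (verit) order_less_asym)
qed

section \<open>Dependence on the end amounts: monotonicity and uniqueness\<close>

lemma sum_upto_Suc: "l \<le> k \<Longrightarrow> sum (x :: nat \<Rightarrow> real) {l..<Suc k} = sum x {l..<k} + x k"
  by simp

text \<open>If \<open>x i > y i\<close>, the difference \<open>D\<close> of the cumulative amounts
  rises across \<open>i\<close>. It starts nonnegative and ends nonpositive, so it falls somewhere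
  else, at a position \<open>j\<close> with \<open>x j < y j\<close>. For a suitable such
  \<open>j\<close> the sign of \<open>D\<close> between \<open>i\<close> and \<open>j\<close> makes
  the opposite exchanges in \<open>x\<close> and in \<open>y\<close> both possible, which closes a
  cycle.\<close>

theorem canonical_mono:
  assumes x: "canonical E a b c d l r L R x" and y: "canonical E a b c d l r L' R' y"
    and L: "L' \<le> L" and R: "R \<le> R'" and i: "i \<in> {l..<r}"
  shows "x i \<le> y i"
proof (rule ccontr)
  assume "\<not> x i \<le> y i"
  then have xi: "y i < x i" by simp
  define D where "D k = (L + sum x {l..<k}) - (L' + sum y {l..<k})" for k
  have DSuc: "D (Suc k) = D k + x k - y k" if "l \<le> k" for k
    using that by (simp add: D_def sum_upto_Suc)
  have Dl: "0 \<le> D l" using L by (simp add: D_def)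
  have Dr: "D r \<le> 0" using x y R by (simp add: D_def canonical_def block_point_def)
  have xb: "x k \<in> range_of K" "c k \<le> x k" "x k \<le> d k" "y k \<in> range_of K" "c k \<le> y k" "y k \<le> d k"
    if "k \<in> {l..<r}" for k using x y that by (auto simp: canonical_def block_point_def)
  have nx: "no_gain x i j" if "i \<noteq> j" "c i < x i" "x j < d j" "movable E a b l L x i j"
    "i \<in> {l..<r}" "j \<in> {l..<r}" for i j
    using x that unfolding canonical_def by auto
  have ny: "no_gain y i j" if "i \<noteq> j" "c i < y i" "y j < d j" "movable E a b l L' y i j"
    "i \<in> {l..<r}" "j \<in> {l..<r}" for i j
    using y that unfolding canonical_def by auto
  have xk: "a k \<le> L + sum x {l..<k}" "L + sum x {l..<k} \<le> b k"
    "a k \<le> L' + sum y {l..<k}" "L' + sum y {l..<k} \<le> b k"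
    if "k \<in> E" "l < k" "k < r" for k
    using x y that by (auto simp: canonical_def block_point_def)
  have fin: False if j: "j \<in> {l..<r}" "i \<noteq> j" "x j < y j"
    and m: "movable E a b l L x i j" "movable E a b l L' y j i" for j
  proof -
    have "no_gain x i j" using nx[of i j] m i j xb[of i] xb[of j] xi by auto
    moreover have "no_gain y j i" using ny[of j i] m i j xb[of i] xb[of j] xi by auto
    ultimately show False using no_gain_cycle[of x i j y] xi j xb[of i] xb[of j] i by auto
  qed
  show False
  proof (cases "0 < D (Suc i)")
    case True
    \<comment> \<open>The first fall after \<open>i\<close>: up to there \<open>D\<close> stays
      positive.\<close>
    define j where "j = (LEAST j. i < j \<and> D (Suc j) < D j)"
    have ex: "\<exists>j. i < j \<and> j < r \<and> D (Suc j) < D j"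
    proof (rule ccontr)
      assume n: "\<not> ?thesis"
      have "D (Suc i) \<le> D k" if "Suc i \<le> k" "k \<le> r" for k
        using that
      proof (induction k rule: dec_induct)
        case (step k)
        moreover have "\<not> D (Suc k) < D k" using n step by auto
        ultimately show ?case by simp
      qed simp
      from this[of r] i Dr True show False by simp
    qed
    have j: "i < j" "D (Suc j) < D j" and jr: "j < r"
    proof -
      from ex obtain j0 where j0: "i < j0" "j0 < r" "D (Suc j0) < D j0" by blast
      then have "i < j \<and> D (Suc j) < D j" unfolding j_def using LeastI[of "\<lambda>j. i < j \<and> D (Suc j) < D j"] by blast
      moreover have "j \<le> j0" unfolding j_def using j0 by (intro Least_le) auto
      ultimately show "i < j" "D (Suc j) < D j" "j < r" using j0 by auto
    qed
    have pos: "0 < D k" if "Suc i \<le> k" "k \<le> j" for k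
      using that
    proof (induction k rule: dec_induct)
      case (step k)
      then have "\<not> D (Suc k) < D k" using not_less_Least[of k "\<lambda>j. i < j \<and> D (Suc j) < D j"] by (auto simp: j_def)
      then show ?case using step by simp
    qed (use True in simp)
    have xj: "x j < y j" using DSuc[of j] j i by auto
    show False
    proof (rule fin)
      show "j \<in> {l..<r}" "i \<noteq> j" "x j < y j" using j jr i xj by auto
      \<comment> \<open>Where \<open>x\<close> is strictly ahead of \<open>y\<close>, it is strictly
        above the lower bound that \<open>y\<close> respects, and \<open>y\<close> is strictly below
        the upper bound that \<open>x\<close> respects.\<close>
      have *: "a k < L + sum x {l..<k} \<and> L' + sum y {l..<k} < b k" if "k \<in> E" "i < k" "k \<le> j" for k
        using pos[of k] xk[of k] that i jr by (auto simp: D_def)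
      show "movable E a b l L x i j" "movable E a b l L' y j i" using * j by (auto simp: movable_def)
    qed
  next
    case False
    then have neg: "D i < 0" using DSuc[of i] i xi by auto
    have il: "l < i" using neg Dl i by (cases "i = l") auto
    \<comment> \<open>The mirror image: \<open>D\<close> is negative at \<open>i\<close> but
      nonnegative at \<open>l\<close>. After the last fall before \<open>i\<close> it stays
      negative.\<close>
    define j where "j = (GREATEST j. j < i \<and> D (Suc j) < D j)"
    have ex: "\<exists>j. l \<le> j \<and> j < i \<and> D (Suc j) < D j"
    proof (rule ccontr)
      assume n: "\<not> ?thesis"
      have "D l \<le> D k" if "l \<le> k" "k \<le> i" for k
        using that
      proof (induction k rule: dec_induct)
        case (step k)
        moreover have "\<not> D (Suc k) < D k" using n step by auto
        ultimately show ?case by simp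
      qed simp
      from this[of i] i Dl neg show False by simp
    qed
    have bd: "\<And>y. y < i \<and> D (Suc y) < D y \<Longrightarrow> y \<le> i" by auto
    have j: "j < i" "D (Suc j) < D j" and jl: "l \<le> j"
    proof -
      from ex obtain j0 where j0: "l \<le> j0" "j0 < i" "D (Suc j0) < D j0" by blast
      then have "j < i \<and> D (Suc j) < D j" unfolding j_def
        using GreatestI_nat[of "\<lambda>j. j < i \<and> D (Suc j) < D j" j0 i] bd by blast
      moreover have "j0 \<le> j" unfolding j_def
        using j0 bd by (intro Greatest_le_nat[of "\<lambda>j. j < i \<and> D (Suc j) < D j" j0 i]) auto
      ultimately show "j < i" "D (Suc j) < D j" "l \<le> j" using j0 by auto
    qed
    have Dneg: "D k < 0" if "k \<le> i" "Suc j \<le> k" for k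
      using that
    proof (induction k rule: inc_induct)
      case (step k)
      then have "\<not> D (Suc k) < D k"
        using Greatest_le_nat[of "\<lambda>j. j < i \<and> D (Suc j) < D j" k i] bd unfolding j_def[symmetric] by fastforce
      then show ?case using step by simp
    qed (use neg in simp)
    have xj: "x j < y j" using DSuc[of j] j jl by auto
    show False
    proof (rule fin)
      show "j \<in> {l..<r}" "i \<noteq> j" "x j < y j" using j jl i xj by auto
      have *: "a k < L' + sum y {l..<k} \<and> L + sum x {l..<k} < b k" if "k \<in> E" "j < k" "k \<le> i" for k
        using Dneg[of k] xk[of k] that i j jl by (auto simp: D_def)
      show "movable E a b l L x i j" "movable E a b l L' y j i" using * j by (auto simp: movable_def)
    qed
  qed
qed

corollary canonical_unique:
  assumes "canonical E a b c d l r L R x" "canonical E a b c d l r L R y" "i \<in> {l..<r}"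
  shows "x i = y i"
  using canonical_mono[OF assms(1,2)] canonical_mono[OF assms(2,1)] assms(3) by force

section \<open>Restriction to parts of a block and merging at a cut\<close>

lemma block_point_cong:
  assumes "\<And>i. i \<in> {l..<r} \<Longrightarrow> x i = y i"
  shows "block_point E a b c d l r L R x = block_point E a b c d l r L R y"
proof -
  have "sum x {l..<k} = sum y {l..<k}" if "k \<le> r" for k using assms that by (intro sum.cong) auto
  then show ?thesis using assms by (auto simp: block_point_def)
qed

lemma canonical_cong:
  assumes xy: "\<And>i. i \<in> {l..<r} \<Longrightarrow> x i = y i" and x: "canonical E a b c d l r L R x"
  shows "canonical E a b c d l r L R y"
proof -
  have s: "sum x {l..<k} = sum y {l..<k}" if "k \<le> r" for k using assms that by (intro sum.cong) auto
  have m: "movable E a b l L x i j = movable E a b l L y i j" if "i < r" "j < r" for i j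
    unfolding movable_def using s that by (intro ball_cong refl) auto
  show ?thesis
    using x xy m block_point_cong[of l r x y E a b c d L R] unfolding canonical_def no_gain_def by simp
qed

lemma canonical_left:
  assumes x: "canonical E a b c d l r L R x" and "u \<le> r"
  shows "canonical E a b c d l u L (L + sum x {l..<u}) x"
  using assms unfolding canonical_def block_point_def by auto

lemma canonical_right:
  assumes x: "canonical E a b c d l r L R x" and u: "l \<le> u" "u \<le> r"
  shows "canonical E a b c d u r (L + sum x {l..<u}) R x"
proof -
  have s: "L + sum x {l..<u} + sum x {u..<k} = L + sum x {l..<k}" if "u \<le> k" for k
    using that u sum.atLeastLessThan_concat[of l u k x] by simp
  have m: "movable E a b l L x i j" if "i \<in> {u..<r}" "j \<in> {u..<r}"
      "movable E a b u (L + sum x {l..<u}) x i j" for i j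
    using that s u unfolding movable_def by auto
  show ?thesis
    using x m s u unfolding canonical_def block_point_def by (auto simp: add.assoc)
qed

text \<open>The amount at the cut lies between \<open>a u\<close> and \<open>b u\<close>, so
  monotonicity encloses \<open>x\<close> on either side. On the right the roles are exchanged: a
  larger amount at the left end leaves less to distribute, hence \<open>zb\<close> is the lower and
  \<open>za\<close> the upper bound. It remains to see that exchanges within the new bounds are
  never blocked by a nested constraint; then the exchange condition of the original problem gives
  the one of the box problem.\<close>

theorem canonical_merge:
  assumes lur: "l \<le> u" "u \<le> r" and u: "u \<in> E" and ab: "a u \<le> b u"
    and xa: "canonical E a b c d l u L (a u) xa" and xb: "canonical E a b c d l u L (b u) xb"
    and za: "canonical E a b c d u r (a u) R za" and zb: "canonical E a b c d u r (b u) R zb"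
    and x: "canonical E a b c d l r L R x" and bd: "l = u \<Longrightarrow> a u \<le> L \<and> L \<le> b u" "r = u \<Longrightarrow> a u \<le> R \<and> R \<le> b u"
    and lo: "\<And>i. lo i = (if i < u then xa i else zb i)" and up: "\<And>i. up i = (if i < u then xb i else za i)"
  shows "canonical {} a b lo up l r L R x"
proof -
  define Y where "Y k = L + sum x {l..<k}" for k
  \<comment> \<open>A cut at an end of the block is not among the interior constraints of
    \<open>x\<close>; \<open>bd\<close> supplies the bounds there.\<close>
  have Yu: "a u \<le> Y u" "Y u \<le> b u"
    using x u lur bd unfolding canonical_def block_point_def Y_def
    by (cases "l = u"; cases "r = u"; auto)+
  note le = canonical_left[OF x lur(2), folded Y_def] and ri = canonical_right[OF x lur, folded Y_def]
  have l1: "xa i \<le> x i" "x i \<le> xb i" if "i \<in> {l..<u}" for i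
    using canonical_mono[OF xa le] canonical_mono[OF le xb] Yu that by auto
  have r1: "zb i \<le> x i" "x i \<le> za i" if "i \<in> {u..<r}" for i
    using canonical_mono[OF zb ri] canonical_mono[OF ri za] Yu that by auto
  have YR: "Y k + sum x {k..<r} = R" if "l \<le> k" "k \<le> r" for k
    using x that sum.atLeastLessThan_concat[of l k r x] unfolding canonical_def block_point_def Y_def by simp
  have pt: "block_point {} a b lo up l r L R x"
    using x l1 r1 unfolding canonical_def block_point_def by (auto simp: lo up)
  have cd: "c i \<le> lo i" "up i \<le> d i" if "i \<in> {l..<r}" for i
    using that xa xb za zb unfolding canonical_def block_point_def by (auto simp: lo up)
  have zR: "B + sum z {k..<r} + (sum z {u..<k}) = B + (sum z {u..<r})" if "u \<le> k" "k \<le> r" for k B and z :: "nat \<Rightarrow> real"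
    using that sum.atLeastLessThan_concat[of u k r z] by simp
  have mov: "movable E a b l L x i j"
    if ij: "i \<in> {l..<r}" "j \<in> {l..<r}" and mi: "lo i < x i" and mj: "x j < up j" for i j
    unfolding movable_def Y_def[symmetric]
  proof (intro ballI conjI impI)
    fix k assume k: "k \<in> E"
    \<comment> \<open>Left of the cut, prefix sums are compared with \<open>xa\<close>, which is
      below \<open>x\<close> and strictly so at \<open>i\<close>. Right of it, suffix sums are
      compared with \<open>za\<close>, which is above \<open>x\<close> and strictly so at
      \<open>j\<close>. Both comparison points respect the bound at \<open>k\<close>.\<close>
    { assume ik: "i < k \<and> k \<le> j"
      show "a k < Y k"
      proof (cases "k \<le> u")
        case True
        have "sum xa {l..<k} < sum x {l..<k}"
          using ij ik True mi l1 by (intro sum_strict_mono_ex1) (auto simp: lo intro!: bexI[of _ i])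
        moreover have "a k \<le> L + sum xa {l..<k}"
          using xa k ik ij True unfolding canonical_def block_point_def by (cases "k = u") auto
        ultimately show ?thesis by (simp add: Y_def)
      next
        case False
        have "sum x {k..<r} < sum za {k..<r}"
          using ij ik False mj r1 by (intro sum_strict_mono_ex1) (auto simp: up intro!: bexI[of _ j])
        moreover have "a k \<le> a u + sum za {u..<k}"
          using za k ik ij False unfolding canonical_def block_point_def by auto
        moreover have "a u + sum za {u..<r} = R" using za by (simp add: canonical_def block_point_def)
        ultimately show ?thesis using YR[of k] zR[of k "a u" za] ik ij False by auto
      qed }
    { assume ik: "j < k \<and> k \<le> i"
      show "Y k < b k"
      proof (cases "k \<le> u")
        case True
        have "sum x {l..<k} < sum xb {l..<k}"
          using ij ik True mj l1 by (intro sum_strict_mono_ex1) (auto simp: up intro!: bexI[of _ j])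
        moreover have "L + sum xb {l..<k} \<le> b k"
          using xb k ik ij True unfolding canonical_def block_point_def by (cases "k = u") auto
        ultimately show ?thesis by (simp add: Y_def)
      next
        case False
        have "sum zb {k..<r} < sum x {k..<r}"
          using ij ik False mi r1 by (intro sum_strict_mono_ex1) (auto simp: lo intro!: bexI[of _ i])
        moreover have "b u + sum zb {u..<k} \<le> b k"
          using zb k ik ij False unfolding canonical_def block_point_def by auto
        moreover have "b u + sum zb {u..<r} = R" using zb by (simp add: canonical_def block_point_def)
        ultimately show ?thesis using YR[of k] zR[of k "b u" zb] ik ij False by auto
      qed }
  qed
  have "no_gain x i j" if "i \<in> {l..<r}" "j \<in> {l..<r}" "i \<noteq> j" "lo i < x i" "x j < up j" for i j
    using x mov[of i j] cd[of i] cd[of j] that unfolding canonical_def by auto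
  then show ?thesis using pt unfolding canonical_def by auto
qed

section \<open>Existence of optimal canonical solutions\<close>

definition block_cost :: "nat \<Rightarrow> nat \<Rightarrow> (nat \<Rightarrow> real) \<Rightarrow> real" where
  "block_cost l r x = (\<Sum>i=l..<r. q i * (x i)\<^sup>2 + p i * x i)"

definition shift :: "(nat \<Rightarrow> real) \<Rightarrow> nat \<Rightarrow> nat \<Rightarrow> real \<Rightarrow> nat \<Rightarrow> real" where
  "shift x i j e = x(i := x i - e, j := x j + e)"

lemma sum_shift:
  assumes "finite A" "i \<noteq> j"
  shows "(\<Sum>k\<in>A. g k (shift x i j e k)) = (\<Sum>k\<in>A. g k (x k))
     + (if i \<in> A then g i (x i - e) - g i (x i) else 0) + (if j \<in> A then g j (x j + e) - g j (x j) else (0::real))"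
proof -
  have "(\<Sum>k\<in>A. g k (shift x i j e k)) - (\<Sum>k\<in>A. g k (x k))
      = (\<Sum>k\<in>A. (if k = i then g i (x i - e) - g i (x i) else 0) + (if k = j then g j (x j + e) - g j (x j) else 0))"
    unfolding sum_subtractf[symmetric] using assms(2) by (intro sum.cong) (auto simp: shift_def)
  then show ?thesis using assms(1) by (simp add: sum.distrib)
qed

lemma finite_pos_lower_bound:
  assumes "finite A" "\<And>k. k \<in> A \<Longrightarrow> 0 < (g k :: real)"
  shows "\<exists>e>0. \<forall>k\<in>A. e \<le> g k"
  using assms
proof (induction A rule: finite_induct)
  case (insert k A)
  then obtain e where "e > 0" "\<forall>k\<in>A. e \<le> g k" by auto
  then show ?case using insert by (intro exI[of _ "min e (g k)"]) auto
qed (auto intro: exI[of _ 1])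

text \<open>The coordinates outside the block are pinned to 0, so that the points lie in a product
  of compact sets over all positions and Tychonoff's theorem applies. The sum constraints involve
  finitely many coordinates and are closed.\<close>

lemma compact_block_points:
  "compact {x. (\<forall>i. i \<notin> {l..<r} \<longrightarrow> x i = 0) \<and> block_point E a b c d l r L R x}"
proof -
  define S where "S i = (if i \<in> {l..<r} then range_of K \<inter> {c i..d i} else {0::real})" for i
  have "closed (range_of K)" by (cases K) auto
  then have "compact (S i)" for i unfolding S_def by (auto intro: closed_Int_compact)
  then have "compactin (product_topology (\<lambda>i::nat. euclidean :: real topology) UNIV) (PiE UNIV S)"
    by (auto simp: compactin_PiE)
  then have 1: "compact (PiE UNIV S)" by (simp add: euclidean_product_topology)
  have cont: "continuous_on UNIV (\<lambda>x::nat\<Rightarrow>real. L + sum x {l..<k})" for k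
    by (intro continuous_intros continuous_on_product_coordinates)
  have 2: "closed (\<Inter>k\<in>E \<inter> {l<..<r}. {x. a k \<le> L + sum x {l..<k}} \<inter> {x. L + sum x {l..<k} \<le> b k})"
    by (intro closed_INT ballI closed_Int closed_Collect_le cont continuous_intros)
  have 3: "closed {x::nat\<Rightarrow>real. L + sum x {l..<r} = R}"
    by (intro closed_Collect_eq cont continuous_intros)
  have "{x. (\<forall>i. i \<notin> {l..<r} \<longrightarrow> x i = 0) \<and> block_point E a b c d l r L R x}
     = PiE UNIV S \<inter> ((\<Inter>k\<in>E \<inter> {l<..<r}. {x. a k \<le> L + sum x {l..<k}} \<inter> {x. L + sum x {l..<k} \<le> b k})
        \<inter> {x. L + sum x {l..<r} = R})"
    (is "?A = ?B")
  proof (rule set_eqI)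
    fix x
    have "x \<in> PiE UNIV S \<longleftrightarrow> (\<forall>i. i \<notin> {l..<r} \<longrightarrow> x i = 0) \<and> (\<forall>i\<in>{l..<r}. x i \<in> range_of K \<and> c i \<le> x i \<and> x i \<le> d i)"
      unfolding S_def PiE_iff by auto
    then show "x \<in> ?A \<longleftrightarrow> x \<in> ?B" unfolding block_point_def by blast
  qed
  then show ?thesis using 1 2 3 by (auto intro!: compact_Int_closed)
qed

lemma shift_change:
  "q i * (x - e)\<^sup>2 + p i * (x - e) - (q i * x\<^sup>2 + p i * x) = e * (q i * e - (2 * q i * x + p i))"
  "q i * (x + e)\<^sup>2 + p i * (x + e) - (q i * x\<^sup>2 + p i * x) = e * (q i * e + (2 * q i * x + p i))"
  by (auto simp: power2_eq_square algebra_simps)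

text \<open>A lexicographic minimum is canonical: the cost decides, and among the cheapest points
  the sum of amounts weighted by positions. A profitable exchange would reduce the cost, and a
  neutral one towards a smaller position the weighted sum.\<close>

theorem canonical_exists:
  assumes x0: "block_point E a b c d l r L R x0"
    and int: "\<And>i. c i \<in> range_of K" "\<And>i. d i \<in> range_of K"
      "\<And>k. k \<in> E \<Longrightarrow> a k \<in> range_of K \<and> b k \<in> range_of K" "L \<in> range_of K"
  shows "\<exists>x. canonical E a b c d l r L R x \<and>
    (\<forall>y. block_point E a b c d l r L R y \<longrightarrow> block_cost l r x \<le> block_cost l r y)"
proof -
  define X where "X = {x. (\<forall>i. i \<notin> {l..<r} \<longrightarrow> x i = 0) \<and> block_point E a b c d l r L R x}"
  have Xc: "compact X" unfolding X_def by (rule compact_block_points)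
  have restr: "(\<lambda>i. if i \<in> {l..<r} then y i else 0) \<in> X" if "block_point E a b c d l r L R y" for y
    using that block_point_cong[of l r y "\<lambda>i. if i \<in> {l..<r} then y i else 0"] by (auto simp: X_def)
  have Xne: "X \<noteq> {}" using restr[OF x0] by auto
  have cont: "continuous_on A (block_cost l r)" for A
    unfolding block_cost_def
    by (intro continuous_intros continuous_on_subset[OF continuous_on_product_coordinates]) auto
  obtain x1 where x1: "x1 \<in> X" "\<And>y. y \<in> X \<Longrightarrow> block_cost l r x1 \<le> block_cost l r y"
    using continuous_attains_inf[OF Xc Xne cont] by auto
  \<comment> \<open>The secondary objective that implements the tie-breaking: shifting
    \<open>e\<close> from \<open>i\<close> to \<open>j\<close> changes it by
    \<open>e * (j - i)\<close>.\<close>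
  define T where "T x = (\<Sum>i=l..<r. real i * x i)" for x
  have "compact (X \<inter> {x. block_cost l r x \<le> block_cost l r x1})"
    by (intro compact_Int_closed Xc closed_Collect_le cont continuous_intros)
  moreover have "X \<inter> {x. block_cost l r x \<le> block_cost l r x1} \<noteq> {}" using x1 by auto
  moreover have "continuous_on A T" for A
    unfolding T_def by (intro continuous_intros continuous_on_subset[OF continuous_on_product_coordinates]) auto
  ultimately obtain x where x: "x \<in> X" "block_cost l r x \<le> block_cost l r x1"
    and xT: "\<And>y. y \<in> X \<Longrightarrow> block_cost l r y \<le> block_cost l r x1 \<Longrightarrow> T x \<le> T y"
    using continuous_attains_inf[of "X \<inter> {x. block_cost l r x \<le> block_cost l r x1}" T] by auto
  have opt: "block_cost l r x \<le> block_cost l r y" if "y \<in> X" for y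
    using x(2) x1(2)[OF that] by linarith
  have pt: "block_point E a b c d l r L R x" and out: "\<And>i. i \<notin> {l..<r} \<Longrightarrow> x i = 0" using x by (auto simp: X_def)
  have yint: "sum x {l..<k} \<in> range_of K" if "k \<le> r" for k
  proof (cases K)
    case Integer
    have "x i \<in> range_of K" if "i \<in> {l..<k}" for i using pt that \<open>k \<le> r\<close> by (auto simp: block_point_def)
    then show ?thesis unfolding Integer by (auto intro: Ints_sum)
  qed auto
  have main: "no_gain x i j" if ij: "i \<in> {l..<r}" "j \<in> {l..<r}" "i \<noteq> j" "c i < x i" "x j < d j"
    and mov: "movable E a b l L x i j" for i j
  proof -
    \<comment> \<open>All room that the shift consumes: at the bounds of the two variables and at
      the nested constraints between them. Any admissible amount not exceeding these finitely many
      positive numbers can be shifted.\<close>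
    define A where "A = insert (x i - c i) (insert (d j - x j)
       ((\<lambda>k. (L + sum x {l..<k}) - a k) ` {k \<in> E. i < k \<and> k \<le> j}
         \<union> (\<lambda>k. b k - (L + sum x {l..<k})) ` {k \<in> E. j < k \<and> k \<le> i}))"
    have finA: "finite A"
    proof -
      have "{k \<in> E. i < k \<and> k \<le> j} \<subseteq> {..j}" "{k \<in> E. j < k \<and> k \<le> i} \<subseteq> {..i}" by auto
      then show ?thesis unfolding A_def by (meson finite_Un finite_atMost finite_imageI finite_insert finite_subset)
    qed
    have posA: "0 < s" if "s \<in> A" for s
      using that ij(4,5) mov unfolding A_def movable_def by (elim insertE UnE imageE) auto
    have feas: "shift x i j e \<in> X" if e: "0 < e" "\<And>s. s \<in> A \<Longrightarrow> e \<le> s" "e \<in> range_of K" for e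
    proof -
      have ei: "e \<le> x i - c i" "e \<le> d j - x j" using e by (auto simp: A_def)
      have eN: "e \<le> (L + sum x {l..<k}) - a k" if "k \<in> E" "i < k" "k \<le> j" for k
        using that e(2)[of "(L + sum x {l..<k}) - a k"] unfolding A_def by blast
      have eN': "e \<le> b k - (L + sum x {l..<k})" if "k \<in> E" "j < k" "k \<le> i" for k
        using that e(2)[of "b k - (L + sum x {l..<k})"] unfolding A_def by blast
      have s: "sum (shift x i j e) {l..<k} = sum x {l..<k} + (if i < k then - e else 0) + (if j < k then e else 0)" for k
        using sum_shift[of "{l..<k}" i j "\<lambda>_ x. x" x e] ij by auto
      have r: "shift x i j e k \<in> range_of K" if "k \<in> {l..<r}" for k
      proof -
        have "x k \<in> range_of K" using pt that unfolding block_point_def by auto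
        then show ?thesis using e(3) by (cases K) (auto simp: shift_def)
      qed
      have "block_point E a b c d l r L R (shift x i j e)"
        unfolding block_point_def s
      proof (intro conjI ballI)
        fix k assume k: "k \<in> {l..<r}"
        show "shift x i j e k \<in> range_of K" using r k by simp
        have "c k \<le> x k" "x k \<le> d k" using pt k unfolding block_point_def by auto
        then show "c k \<le> shift x i j e k" "shift x i j e k \<le> d k"
          using ei e(1) ij(3) unfolding shift_def by (cases "k = i"; cases "k = j"; simp)+
      next
        fix k assume k: "k \<in> E \<inter> {l<..<r}"
        have "a k \<le> L + sum x {l..<k}" "L + sum x {l..<k} \<le> b k" using pt k unfolding block_point_def by auto
        then show "a k \<le> L + (sum x {l..<k} + (if i < k then - e else 0) + (if j < k then e else 0))"
          "L + (sum x {l..<k} + (if i < k then - e else 0) + (if j < k then e else 0)) \<le> b k"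
          using eN[of k] eN'[of k] k e(1) by auto
      next
        show "L + (sum x {l..<r} + (if i < r then - e else 0) + (if j < r then e else 0)) = R"
          using pt ij(1,2) unfolding block_point_def by simp
      qed
      moreover have "shift x i j e k = 0" if "k \<notin> {l..<r}" for k
        using out[OF that] that ij(1,2) unfolding shift_def by (cases "k = i"; cases "k = j"; simp)
      ultimately show ?thesis unfolding X_def by blast
    qed
    have cost: "block_cost l r (shift x i j e) = block_cost l r x
        + e * ((q i + q j) * e + (2 * q j * x j + p j) - (2 * q i * x i + p i))" for e
    proof -
      have "block_cost l r (shift x i j e) = block_cost l r x
          + (q i * (x i - e)\<^sup>2 + p i * (x i - e) - (q i * (x i)\<^sup>2 + p i * x i))
          + (q j * (x j + e)\<^sup>2 + p j * (x j + e) - (q j * (x j)\<^sup>2 + p j * x j))"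
        unfolding block_cost_def
        using sum_shift[OF finite_atLeastLessThan ij(3), of "\<lambda>i x. q i * x\<^sup>2 + p i * x" x e l r]
        by (simp only: ij(1,2) if_True)
      also have "\<dots> = block_cost l r x + (e * (q i * e - (2 * q i * x i + p i)) + e * (q j * e + (2 * q j * x j + p j)))"
        unfolding shift_change by simp
      also have "e * (q i * e - (2 * q i * x i + p i)) + e * (q j * e + (2 * q j * x j + p j))
          = e * ((q i + q j) * e + (2 * q j * x j + p j) - (2 * q i * x i + p i))"
        by algebra
      finally show ?thesis .
    qed
    have Tshift: "T (shift x i j e) = T x + e * (real j - real i)" for e
    proof -
      have "T (shift x i j e) = T x + (real i * (x i - e) - real i * x i) + (real j * (x j + e) - real j * x j)"
        unfolding T_def using sum_shift[OF finite_atLeastLessThan ij(3), of "\<lambda>i x. real i * x" x e l r]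
        by (simp only: ij(1,2) if_True)
      then show ?thesis by (simp add: algebra_simps)
    qed
    define dl where "dl = marg_dn K (q i) (p i) (x i) - marg_up K (q j) (p j) (x j)"
    have step: "\<exists>e>0. shift x i j e \<in> X \<and>
        (0 < dl \<longrightarrow> block_cost l r (shift x i j e) < block_cost l r x) \<and>
        (dl = 0 \<longrightarrow> ties K (q i) \<longrightarrow> ties K (q j) \<longrightarrow> block_cost l r (shift x i j e) = block_cost l r x)"
    proof (cases K)
      case Integer
      \<comment> \<open>With integral data every positive slack is at least 1, so a whole unit can
        be moved; its cost change is exactly \<open>- dl\<close>.\<close>
      have "1 \<le> s" if "s \<in> A" for s
      proof -
        have xI: "x k \<in> \<int>" if "k \<in> {l..<r}" for k using pt that Integer unfolding block_point_def by auto
        have "L \<in> \<int>" "\<And>k. c k \<in> \<int>" "\<And>k. d k \<in> \<int>" "\<And>k. k \<in> E \<Longrightarrow> a k \<in> \<int>" "\<And>k. k \<in> E \<Longrightarrow> b k \<in> \<int>"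
          "\<And>k. k \<le> r \<Longrightarrow> sum x {l..<k} \<in> \<int>"
          using int yint unfolding Integer by auto
        then have "s \<in> \<int>" using that xI[OF ij(1)] xI[OF ij(2)] ij(1,2) unfolding A_def
          by (elim insertE UnE imageE) auto
        then show ?thesis using posA[OF that] int_less_ge_one[of 0 s] by auto
      qed
      then have "shift x i j 1 \<in> X" using Integer by (intro feas) auto
      moreover have "block_cost l r (shift x i j 1) = block_cost l r x - dl"
      proof -
        have "dl = (q i * (2 * x i - 1) + p i) - (q j * (2 * x j + 1) + p j)"
          unfolding dl_def marg_dn_def marg_up_def Integer by simp
        then show ?thesis unfolding cost by (simp add: left_diff_distrib right_diff_distrib distrib_left)
      qed
      ultimately have "0 < (1::real) \<and> shift x i j 1 \<in> X \<and>
        (0 < dl \<longrightarrow> block_cost l r (shift x i j 1) < block_cost l r x) \<and>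
        (dl = 0 \<longrightarrow> ties K (q i) \<longrightarrow> ties K (q j) \<longrightarrow> block_cost l r (shift x i j 1) = block_cost l r x)"
        by simp
      then show ?thesis by blast
    next
      case Continuous
      obtain e0 where e0: "0 < e0" "\<forall>s\<in>A. e0 \<le> s" using finite_pos_lower_bound[of A id] finA posA by auto
      \<comment> \<open>The shift changes the cost by \<open>e * ((q i + q j) * e - dl)\<close>,
        which is negative for this \<open>e\<close>. The summand 1 keeps the denominator positive
        for linear costs.\<close>
      define e where "e = (if 0 < dl then min e0 (dl / (2 * (q i + q j + 1))) else e0)"
      have dl: "dl = (2 * q i * x i + p i) - (2 * q j * x j + p j)"
        unfolding dl_def marg_dn_def marg_up_def Continuous by simp
      have qq: "0 < q i + q j + 1" using q_nonneg[of i] q_nonneg[of j] by simp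
      have e: "0 < e" using e0 qq by (simp add: e_def)
      have "e \<le> e0" by (simp add: e_def)
      then have "e \<le> s" if "s \<in> A" for s using e0(2) that by fastforce
      then have "shift x i j e \<in> X" using e Continuous by (intro feas) simp_all
      moreover have "block_cost l r (shift x i j e) < block_cost l r x" if "0 < dl"
      proof -
        have "e \<le> dl / (2 * (q i + q j + 1))" using that by (simp add: e_def)
        then have "e * (2 * (q i + q j + 1)) \<le> dl" using qq by (simp add: pos_le_divide_eq)
        moreover have "e * (2 * (q i + q j + 1)) = 2 * ((q i + q j) * e) + 2 * e" by algebra
        ultimately have "2 * ((q i + q j) * e) + 2 * e \<le> dl" by linarith
        moreover have "0 \<le> (q i + q j) * e" using q_nonneg e by simp
        ultimately have "(q i + q j) * e < dl" using e that by linarith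
        then have "(q i + q j) * e + (2 * q j * x j + p j) - (2 * q i * x i + p i) < 0"
          unfolding dl by linarith
        then show ?thesis unfolding cost using e by (simp add: mult_pos_neg)
      qed
      moreover have "block_cost l r (shift x i j e) = block_cost l r x"
        if "dl = 0" "ties K (q i)" "ties K (q j)"
      proof -
        have "q i = 0" "q j = 0" using that(2,3) Continuous unfolding ties_def by simp_all
        then show ?thesis unfolding cost using that(1) dl by simp
      qed
      ultimately show ?thesis using e by blast
    qed
    then obtain e where e: "0 < e" "shift x i j e \<in> X"
      "0 < dl \<Longrightarrow> block_cost l r (shift x i j e) < block_cost l r x"
      "dl = 0 \<Longrightarrow> ties K (q i) \<Longrightarrow> ties K (q j) \<Longrightarrow> block_cost l r (shift x i j e) = block_cost l r x" by blast
    have "dl \<le> 0" using e opt[OF e(2)] by force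
    moreover have "i < j" if "dl = 0" "ties K (q i)" "ties K (q j)"
    proof -
      have "T x \<le> T (shift x i j e)" using e that x by (intro xT) auto
      then have "0 \<le> real j - real i" using e(1) by (simp add: Tshift zero_le_mult_iff)
      then show ?thesis using ij by auto
    qed
    ultimately show ?thesis unfolding no_gain_def dl_def by auto
  qed
  have "block_cost l r x \<le> block_cost l r y" if y: "block_point E a b c d l r L R y" for y
  proof -
    have "block_cost l r (\<lambda>i. if i \<in> {l..<r} then y i else 0) = block_cost l r y"
      unfolding block_cost_def by (intro sum.cong) auto
    then show ?thesis using opt[OF restr[OF y]] by simp
  qed
  then show ?thesis using pt main unfolding canonical_def by blast
qed

text \<open>The converse direction, which the algorithm needs: the box problem is feasible and its
  canonical solution solves the nested problem. The nested problem has a canonical solution, this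
  one is canonical for the box problem, and uniqueness identifies it with the computed one.\<close>

corollary canonical_merge_boxes:
  assumes lur: "l < u" "u < r" and u: "u \<in> E" and ab: "\<And>k. k \<in> E \<Longrightarrow> a k \<le> b k"
    and xa: "canonical E a b c d l u L (a u) xa" and xb: "canonical E a b c d l u L (b u) xb"
    and za: "canonical E a b c d u r (a u) R za" and zb: "canonical E a b c d u r (b u) R zb"
    and int: "\<And>i. c i \<in> range_of K" "\<And>i. d i \<in> range_of K"
      "\<And>k. k \<in> E \<Longrightarrow> a k \<in> range_of K \<and> b k \<in> range_of K" "L \<in> range_of K"
    and lo: "\<And>i. lo i = (if i < u then xa i else zb i)" and up: "\<And>i. up i = (if i < u then xb i else za i)"
  shows "sum lo {l..<r} \<le> R - L" "R - L \<le> sum up {l..<r}" "\<And>i. i \<in> {l..<r} \<Longrightarrow> lo i \<le> up i"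
    and "canonical {} a b lo up l r L R x \<Longrightarrow> canonical E a b c d l r L R x"
proof -
  \<comment> \<open>The two parts fit together at the cumulative amount \<open>a u\<close>, which
    shows that the nested problem is feasible.\<close>
  define x0 where "x0 i = (if i < u then xa i else za i)" for i
  have sp: "sum f {l..<k} = sum f {l..<u} + sum f {u..<k}" if "u \<le> k" for f :: "nat \<Rightarrow> real" and k
    using that lur by (simp add: sum.atLeastLessThan_concat)
  have s1: "sum x0 {l..<k} = sum xa {l..<k}" if "k \<le> u" for k using that unfolding x0_def by (intro sum.cong) auto
  have s2: "sum x0 {u..<k} = sum za {u..<k}" for k unfolding x0_def by (intro sum.cong) auto
  have au: "L + sum xa {l..<u} = a u" and zR: "a u + sum za {u..<r} = R"
    using xa za by (auto simp: canonical_def block_point_def)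
  have "block_point E a b c d l r L R x0"
    unfolding block_point_def
  proof (intro conjI ballI)
    fix k assume k: "k \<in> E \<inter> {l<..<r}"
    have "a k \<le> L + sum x0 {l..<k} \<and> L + sum x0 {l..<k} \<le> b k"
    proof (cases "k \<le> u")
      case True
      then show ?thesis using k xa s1[OF True] ab[of u] u au unfolding canonical_def block_point_def
        by (cases "k = u") auto
    next
      case False
      then have "L + sum x0 {l..<k} = a u + sum za {u..<k}" using sp[of k x0] s1[of u] s2 au by simp
      then show ?thesis using k za False unfolding canonical_def block_point_def by auto
    qed
    then show "a k \<le> L + sum x0 {l..<k}" "L + sum x0 {l..<k} \<le> b k" by auto
  next
    fix i assume i: "i \<in> {l..<r}"
    have "x0 i \<in> range_of K \<and> c i \<le> x0 i \<and> x0 i \<le> d i"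
    proof (cases "i < u")
      case True
      then show ?thesis using xa i unfolding canonical_def block_point_def x0_def by simp
    next
      case False
      then show ?thesis using za i unfolding canonical_def block_point_def x0_def by simp
    qed
    then show "x0 i \<in> range_of K" "c i \<le> x0 i" "x0 i \<le> d i" by auto
  next
    show "L + sum x0 {l..<r} = R" using sp[of r x0] s1[of u] s2[of r] au zR lur by simp
  qed
  then obtain y where y: "canonical E a b c d l r L R y" using canonical_exists int by blast
  have y': "canonical {} a b lo up l r L R y"
    using canonical_merge[OF _ _ u ab[OF u] xa xb za zb y _ _ lo up] lur by auto
  have "sum lo {l..<r} \<le> sum y {l..<r}" "sum y {l..<r} \<le> sum up {l..<r}"
    using y' unfolding canonical_def block_point_def by (auto intro!: sum_mono)
  moreover have "L + sum y {l..<r} = R" using y by (simp add: canonical_def block_point_def)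
  ultimately show "sum lo {l..<r} \<le> R - L" "R - L \<le> sum up {l..<r}" by auto
  show "lo i \<le> up i" if "i \<in> {l..<r}" for i
    using y' that order_trans[of "lo i" "y i" "up i"] unfolding canonical_def block_point_def by blast
  show "canonical E a b c d l r L R x" if "canonical {} a b lo up l r L R x"
    using canonical_cong[OF canonical_unique[OF y' that] y] by blast
qed

end

section \<open>Allocation with a single constraint\<close>

subsection \<open>Responses to a multiplier\<close>

definition clip :: "real \<Rightarrow> real \<Rightarrow> real \<Rightarrow> real" where
  "clip lo up y = max lo (min up y)"

text \<open>The smallest and the largest minimizer of \<open>q x\<^sup>2 + p x - lam x\<close> on the admissible values.\<close>

definition resp_lo :: "variables \<Rightarrow> real \<Rightarrow> real \<Rightarrow> real \<Rightarrow> real \<Rightarrow> real \<Rightarrow> real" where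
  "resp_lo K lam q p lo up =
     (if q \<le> 0 then (if lam \<le> p then lo else up)
      else clip lo up (if K = Integer then 0 - of_int \<lfloor>1/2 - (lam - p) / (2 * q)\<rfloor> else (lam - p) / (2 * q)))"

definition resp_hi :: "variables \<Rightarrow> real \<Rightarrow> real \<Rightarrow> real \<Rightarrow> real \<Rightarrow> real \<Rightarrow> real" where
  "resp_hi K lam q p lo up =
     (if q \<le> 0 then (if p \<le> lam then up else lo)
      else clip lo up (if K = Integer then of_int \<lfloor>1/2 + (lam - p) / (2 * q)\<rfloor> else (lam - p) / (2 * q)))"

lemma clip_bounds: "lo \<le> up \<Longrightarrow> lo \<le> clip lo up y" "lo \<le> up \<Longrightarrow> clip lo up y \<le> up"
  by (auto simp: clip_def)

lemma clip_mono: "y \<le> z \<Longrightarrow> clip lo up y \<le> clip lo up z"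
  by (auto simp: clip_def)

lemma clip_in_range: "lo \<in> range_of K \<Longrightarrow> up \<in> range_of K \<Longrightarrow> y \<in> range_of K \<Longrightarrow> clip lo up y \<in> range_of K"
  by (auto simp: clip_def max_def min_def)

lemma clip_lessD: "lo \<le> up \<Longrightarrow> x \<le> clip lo up y \<Longrightarrow> lo < x \<Longrightarrow> x \<le> y"
  "lo \<le> up \<Longrightarrow> clip lo up y \<le> x \<Longrightarrow> x < up \<Longrightarrow> y \<le> x"
  by (auto simp: clip_def)

text \<open>The term is the ceiling of \<open>t - 1/2\<close>, that is, \<open>t\<close> rounded to
  a nearest integer with halves going down; it is written with a floor because this is the rounding
  operation of the machine. The floor of \<open>1/2 + t\<close> in the next lemma rounds halves
  up.\<close>

lemma neg_floor_bounds: "0 - of_int \<lfloor>1/2 - t\<rfloor> < t + (1/2 :: real)" "t - 1/2 \<le> 0 - of_int \<lfloor>1/2 - t :: real\<rfloor>"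
  by linarith+

lemma floor_half_bounds: "of_int \<lfloor>1/2 + t\<rfloor> \<le> t + (1/2 :: real)" "t - 1/2 < of_int \<lfloor>1/2 + t :: real\<rfloor>"
  by linarith+

lemma neg_floor_le_floor: "0 - of_int \<lfloor>1/2 - t\<rfloor> \<le> (of_int \<lfloor>1/2 + t :: real\<rfloor> :: real)"
proof -
  have "- \<lfloor>1/2 - t\<rfloor> < \<lfloor>1/2 + t\<rfloor> + 1" by linarith
  then show ?thesis by linarith
qed

lemma rounded_bounds:
  fixes t :: real
  shows "x \<le> (if c then of_int \<lfloor>1/2 + t\<rfloor> else t) \<Longrightarrow> x \<le> t + (if c then 1 else 0) / 2"
    "(if c then 0 - of_int \<lfloor>1/2 - t\<rfloor> else t) \<le> x \<Longrightarrow> t - (if c then 1 else 0) / 2 \<le> x"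
  using floor_half_bounds(1)[of t] neg_floor_bounds(2)[of t] by (cases c; simp)+

lemma resp_in_range:
  assumes "lo \<in> range_of K" "up \<in> range_of K"
  shows "resp_lo K lam q p lo up \<in> range_of K" "resp_hi K lam q p lo up \<in> range_of K"
proof -
  have "(if K = Integer then 0 - of_int z else y) \<in> range_of K" "(if K = Integer then of_int z else y) \<in> range_of K"
    for z and y :: real
    by (cases K; simp)+
  then show "resp_lo K lam q p lo up \<in> range_of K" "resp_hi K lam q p lo up \<in> range_of K"
    unfolding resp_lo_def resp_hi_def using assms clip_in_range by presburger+
qed

lemma resp_bounds:
  assumes "lo \<le> up"
  shows "lo \<le> resp_lo K lam q p lo up" "resp_lo K lam q p lo up \<le> resp_hi K lam q p lo up"
    "resp_hi K lam q p lo up \<le> up"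
proof -
  have "(if K = Integer then 0 - of_int \<lfloor>1/2 - t\<rfloor> else t) \<le> (if K = Integer then of_int \<lfloor>1/2 + t\<rfloor> else t)" for t :: real
    using neg_floor_le_floor[of t] by (cases "K = Integer"; simp)
  from clip_mono[OF this] show "resp_lo K lam q p lo up \<le> resp_hi K lam q p lo up"
    unfolding resp_lo_def resp_hi_def using assms by (cases "q \<le> 0") (simp_all only: if_True if_False, simp)
  show "lo \<le> resp_lo K lam q p lo up" "resp_hi K lam q p lo up \<le> up"
    unfolding resp_lo_def resp_hi_def using assms clip_bounds[OF assms]
    by (simp_all only: order_refl if_True if_False split: if_split) simp_all
qed

text \<open>Comparing a marginal with the multiplier amounts to comparing \<open>x\<close> with the
  stationary point \<open>(lam - p) / (2 * q)\<close>, up to half a step. With \<open>h\<close>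
  equal to 0 or 1 this covers both kinds of variables.\<close>

lemma marg_le_iff:
  assumes "0 < q"
  shows "q * (2 * x - h) + p \<le> lam \<longleftrightarrow> x \<le> (lam - p) / (2 * q) + h / 2"
    "q * (2 * x - h) + p < lam \<longleftrightarrow> x < (lam - p) / (2 * q) + h / 2"
    "lam \<le> q * (2 * x + h) + p \<longleftrightarrow> (lam - p) / (2 * q) - h / 2 \<le> x"
    "lam < q * (2 * x + h) + p \<longleftrightarrow> (lam - p) / (2 * q) - h / 2 < (x::real)"
proof -
  define t where "t = (lam - p) / (2 * q)"
  have lam: "lam = q * (2 * t) + p" using assms by (simp add: t_def field_simps)
  have "q * u + p \<le> q * v + p \<longleftrightarrow> u \<le> v" "q * u + p < q * v + p \<longleftrightarrow> u < v" for u v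
    using assms by simp_all
  note * = this
  show "q * (2 * x - h) + p \<le> lam \<longleftrightarrow> x \<le> (lam - p) / (2 * q) + h / 2"
    "q * (2 * x - h) + p < lam \<longleftrightarrow> x < (lam - p) / (2 * q) + h / 2"
    "lam \<le> q * (2 * x + h) + p \<longleftrightarrow> (lam - p) / (2 * q) - h / 2 \<le> x"
    "lam < q * (2 * x + h) + p \<longleftrightarrow> (lam - p) / (2 * q) - h / 2 < x"
    unfolding t_def[symmetric] unfolding lam * by (auto simp: field_simps)
qed

text \<open>First-order conditions with the multiplier \<open>lam\<close>: at every value between
  the two extreme minimizers, giving saves at most \<open>lam\<close> per step and receiving costs
  at least \<open>lam\<close>.\<close>

lemma resp_marg:
  assumes "0 \<le> q" "lo \<le> up" "resp_lo K lam q p lo up \<le> x" "x \<le> resp_hi K lam q p lo up"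
  shows "lo < x \<Longrightarrow> marg_dn K q p x \<le> lam" "x < up \<Longrightarrow> lam \<le> marg_up K q p x"
proof -
  show "marg_dn K q p x \<le> lam" if x: "lo < x"
  proof (cases "q = 0")
    case True
    then have "resp_hi K lam q p lo up = (if p \<le> lam then up else lo)" by (simp add: resp_hi_def)
    then show ?thesis using assms(4) x True by (cases "p \<le> lam"; simp add: marg_dn_def)
  next
    case False
    then have q: "0 < q" using assms by simp
    have "x \<le> (if K = Integer then of_int \<lfloor>1/2 + (lam - p) / (2 * q)\<rfloor> else (lam - p) / (2 * q))"
    proof -
      have "\<not> q \<le> 0" using q by simp
      then show ?thesis using clip_lessD(1)[OF assms(2) _ x] assms(4) by (simp only: resp_hi_def if_False)
    qed
    then have "x \<le> (lam - p) / (2 * q) + (if K = Integer then 1 else 0) / 2"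
      by (rule rounded_bounds)
    then show ?thesis unfolding marg_dn_def marg_le_iff[OF q] .
  qed
  show "lam \<le> marg_up K q p x" if x: "x < up"
  proof (cases "q = 0")
    case True
    then have "resp_lo K lam q p lo up = (if lam \<le> p then lo else up)" by (simp add: resp_lo_def)
    then show ?thesis using assms(3) x True by (cases "lam \<le> p"; simp add: marg_up_def)
  next
    case False
    then have q: "0 < q" using assms by simp
    have "(if K = Integer then 0 - of_int \<lfloor>1/2 - (lam - p) / (2 * q)\<rfloor> else (lam - p) / (2 * q)) \<le> x"
    proof -
      have "\<not> q \<le> 0" using q by simp
      then show ?thesis using clip_lessD(2)[OF assms(2) _ x] assms(3) by (simp only: resp_lo_def if_False)
    qed
    then have "(lam - p) / (2 * q) - (if K = Integer then 1 else 0) / 2 \<le> x"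
      by (rule rounded_bounds)
    then show ?thesis unfolding marg_up_def marg_le_iff[OF q] .
  qed
qed

text \<open>Below the smallest minimizer and above the largest one a step loses strictly. This
  excludes equal marginals in the wrong order of positions.\<close>

lemma resp_marg_strict:
  assumes "0 \<le> q" "lo \<le> up" "ties K q"
  shows "lo < resp_lo K lam q p lo up \<Longrightarrow> marg_dn K q p (resp_lo K lam q p lo up) < lam"
    "resp_hi K lam q p lo up < up \<Longrightarrow> lam < marg_up K q p (resp_hi K lam q p lo up)"
proof -
  show "marg_dn K q p (resp_lo K lam q p lo up) < lam" if x: "lo < resp_lo K lam q p lo up"
  proof (cases "q = 0")
    case True
    then have "resp_lo K lam q p lo up = (if lam \<le> p then lo else up)" by (simp add: resp_lo_def)
    then show ?thesis using x True by (cases "lam \<le> p"; simp add: marg_dn_def)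
  next
    case False
    then have q: "0 < q" and K: "K = Integer" using assms by (auto simp: ties_def)
    have "resp_lo K lam q p lo up \<le> 0 - of_int \<lfloor>1/2 - (lam - p) / (2 * q)\<rfloor>"
      using clip_lessD(1)[OF assms(2) _ x] q K by (simp add: resp_lo_def)
    then have "resp_lo K lam q p lo up < (lam - p) / (2 * q) + (if K = Integer then 1 else 0) / 2"
      using neg_floor_bounds(1)[of "(lam - p) / (2 * q)"] K by (simp only: refl if_True)
    then show ?thesis unfolding marg_dn_def marg_le_iff[OF q] .
  qed
  show "lam < marg_up K q p (resp_hi K lam q p lo up)" if x: "resp_hi K lam q p lo up < up"
  proof (cases "q = 0")
    case True
    then have "resp_hi K lam q p lo up = (if p \<le> lam then up else lo)" by (simp add: resp_hi_def)
    then show ?thesis using x True by (cases "p \<le> lam"; simp add: marg_up_def)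
  next
    case False
    then have q: "0 < q" and K: "K = Integer" using assms by (auto simp: ties_def)
    have "of_int \<lfloor>1/2 + (lam - p) / (2 * q)\<rfloor> \<le> resp_hi K lam q p lo up"
      using clip_lessD(2)[OF assms(2) _ x] q K by (simp add: resp_hi_def)
    then have "(lam - p) / (2 * q) - (if K = Integer then 1 else 0) / 2 < resp_hi K lam q p lo up"
      using floor_half_bounds(2)[of "(lam - p) / (2 * q)"] K by (simp only: refl if_True)
    then show ?thesis unfolding marg_up_def marg_le_iff[OF q] .
  qed
qed

section \<open>Distributing a given amount at a fixed multiplier\<close>

type_synonym item = "real \<times> real \<times> real \<times> real"

fun item_lo :: "variables \<Rightarrow> real \<Rightarrow> item \<Rightarrow> real" where
  "item_lo K lam (q, p, lo, up) = resp_lo K lam q p lo up"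

fun item_hi :: "variables \<Rightarrow> real \<Rightarrow> item \<Rightarrow> real" where
  "item_hi K lam (q, p, lo, up) = resp_hi K lam q p lo up"

fun low :: "item \<Rightarrow> real" where "low (q, p, lo, up) = lo"
fun upp :: "item \<Rightarrow> real" where "upp (q, p, lo, up) = up"

fun fill :: "variables \<Rightarrow> real \<Rightarrow> item list \<Rightarrow> real \<Rightarrow> real list" where
  "fill K lam [] s = []"
| "fill K lam (it # its) s =
     (let g = min (item_hi K lam it - item_lo K lam it) s
      in (item_lo K lam it + g) # fill K lam its (s - g))"

fun item_ok :: "variables \<Rightarrow> item \<Rightarrow> bool" where
  "item_ok K (q, p, lo, up) \<longleftrightarrow> 0 \<le> q \<and> lo \<le> up \<and> lo \<in> range_of K \<and> up \<in> range_of K"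

lemma item_bounds:
  "item_ok K' it \<Longrightarrow> low it \<le> item_lo K lam it" "item_ok K' it \<Longrightarrow> item_lo K lam it \<le> item_hi K lam it"
  "item_ok K' it \<Longrightarrow> item_hi K lam it \<le> upp it"
  by (cases it; auto intro: resp_bounds)+

lemma item_in_range:
  "item_ok K it \<Longrightarrow> item_lo K lam it \<in> range_of K \<and> item_hi K lam it \<in> range_of K"
  by (cases it) (auto intro: resp_in_range)

lemma length_fill [simp]: "length (fill K lam its s) = length its"
  by (induction K lam its s rule: fill.induct) (auto simp: Let_def)

lemma fill_0: "\<forall>it\<in>set its. item_ok K' it \<Longrightarrow> fill K lam its 0 = map (item_lo K lam) its"
proof (induction its)
  case (Cons it its)
  then have "item_lo K lam it \<le> item_hi K lam it" by (intro item_bounds(2)[of K']) simp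
  then show ?case using Cons by (simp add: Let_def)
qed simp

lemma range_of_closed:
  "x \<in> range_of K \<Longrightarrow> y \<in> range_of K \<Longrightarrow> x + y \<in> range_of K"
  "x \<in> range_of K \<Longrightarrow> y \<in> range_of K \<Longrightarrow> x - y \<in> range_of K"
  "x \<in> range_of K \<Longrightarrow> y \<in> range_of K \<Longrightarrow> min x y \<in> range_of K"
  "of_int z \<in> range_of K" "of_nat n \<in> range_of K"
  by (cases K; auto simp: min_def)+

lemma sum_list_in_range:
  "(\<And>x. x \<in> set xs \<Longrightarrow> f x \<in> range_of K) \<Longrightarrow> (\<Sum>x\<leftarrow>xs. f x) \<in> range_of K"
  using range_of_closed(5)[of 0 K] by (induction xs) (auto intro: range_of_closed)

text \<open>The surplus over the smallest responses is spent greedily from the left. Hence of any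
  two positions the earlier one is full or the later one has received nothing, which is the form in
  which the tie-breaking is used.\<close>

lemma fill_props:
  assumes "\<forall>it\<in>set its. item_ok K it" "0 \<le> s" "s \<le> (\<Sum>it\<leftarrow>its. item_hi K lam it - item_lo K lam it)" "s \<in> range_of K"
  shows "sum_list (fill K lam its s) = (\<Sum>it\<leftarrow>its. item_lo K lam it) + s \<and>
    (\<forall>i<length its. item_lo K lam (its ! i) \<le> fill K lam its s ! i \<and> fill K lam its s ! i \<le> item_hi K lam (its ! i)
        \<and> fill K lam its s ! i \<in> range_of K) \<and>
    (\<forall>j<length its. \<forall>i<j. fill K lam its s ! i = item_hi K lam (its ! i) \<or> fill K lam its s ! j = item_lo K lam (its ! j))"
  using assms
proof (induction its arbitrary: s)
  case (Cons it its)
  define g where "g = min (item_hi K lam it - item_lo K lam it) s"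
  have ok: "\<forall>it\<in>set its. item_ok K it" "item_ok K it" using Cons.prems by auto
  have w: "0 \<le> (\<Sum>it\<leftarrow>its. item_hi K lam it - item_lo K lam it)"
  proof (rule sum_list_nonneg)
    fix x assume "x \<in> set (map (\<lambda>it. item_hi K lam it - item_lo K lam it) its)"
    then obtain it where "it \<in> set its" "x = item_hi K lam it - item_lo K lam it" by auto
    then show "0 \<le> x" using item_bounds(2)[of K it K lam] ok by simp
  qed
  have g: "0 \<le> g" "g \<le> s" "g \<le> item_hi K lam it - item_lo K lam it" "g \<in> range_of K"
    using Cons.prems item_bounds(2)[OF ok(2), of K lam] item_in_range[OF ok(2), of lam]
    by (auto simp: g_def intro!: range_of_closed)
  have s': "s - g \<le> (\<Sum>it\<leftarrow>its. item_hi K lam it - item_lo K lam it)"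
    using Cons.prems(3) w by (auto simp: g_def min_def)
  have IH: "sum_list (fill K lam its (s - g)) = (\<Sum>it\<leftarrow>its. item_lo K lam it) + (s - g) \<and>
    (\<forall>i<length its. item_lo K lam (its ! i) \<le> fill K lam its (s - g) ! i \<and> fill K lam its (s - g) ! i \<le> item_hi K lam (its ! i)
        \<and> fill K lam its (s - g) ! i \<in> range_of K) \<and>
    (\<forall>j<length its. \<forall>i<j. fill K lam its (s - g) ! i = item_hi K lam (its ! i) \<or> fill K lam its (s - g) ! j = item_lo K lam (its ! j))"
    using Cons.IH[OF ok(1) _ s'] g Cons.prems(4) by (auto intro: range_of_closed)
  have fl: "fill K lam (it # its) s = (item_lo K lam it + g) # fill K lam its (s - g)" by (simp add: g_def Let_def)
  have hd: "item_lo K lam it + g = item_hi K lam it \<or> fill K lam its (s - g) ! j = item_lo K lam (its ! j)"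
    if "j < length its" for j
  proof (cases "g = s")
    case True
    then show ?thesis using fill_0[OF ok(1)] that by simp
  next
    case False
    then show ?thesis by (auto simp: g_def min_def split: if_splits)
  qed
  show ?case
    unfolding fl
  proof (intro conjI allI impI)
    show "sum_list ((item_lo K lam it + g) # fill K lam its (s - g)) = sum_list (map (item_lo K lam) (it # its)) + s"
      using IH by simp
  next
    fix i assume "i < length (it # its)"
    then show "item_lo K lam ((it # its) ! i) \<le> ((item_lo K lam it + g) # fill K lam its (s - g)) ! i"
      "((item_lo K lam it + g) # fill K lam its (s - g)) ! i \<le> item_hi K lam ((it # its) ! i)"
      "((item_lo K lam it + g) # fill K lam its (s - g)) ! i \<in> range_of K"
      using IH g item_in_range[OF ok(2), of lam] by (cases i; auto intro: range_of_closed)+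
  next
    fix j i assume "j < length (it # its)" "i < j"
    then show "((item_lo K lam it + g) # fill K lam its (s - g)) ! i = item_hi K lam ((it # its) ! i)
       \<or> ((item_lo K lam it + g) # fill K lam its (s - g)) ! j = item_lo K lam ((it # its) ! j)"
      using IH hd by (cases i; cases j) auto
  qed
qed auto

context quad_costs
begin

definition items :: "(nat \<Rightarrow> real) \<Rightarrow> (nat \<Rightarrow> real) \<Rightarrow> nat \<Rightarrow> nat \<Rightarrow> item list" where
  "items lo up l r = map (\<lambda>i. (q i, p i, lo i, up i)) [l..<r]"

lemma sum_list_interval: "(\<Sum>i\<leftarrow>[l..<r]. f i) = (sum f {l..<r} :: real)"
  by (simp add: interv_sum_list_conv_sum_set_nat)

text \<open>A multiplier whose extreme responses enclose \<open>Z\<close> separates the marginals of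
  all givers from those of all receivers, so no exchange gains. Ties are settled by the greedy order
  of \<open>fill\<close>.\<close>

theorem fill_canonical:
  assumes bd: "\<And>i. i \<in> {l..<r} \<Longrightarrow> lo i \<le> up i \<and> lo i \<in> range_of K \<and> up i \<in> range_of K"
    and Z: "(\<Sum>it\<leftarrow>items lo up l r. item_lo K lam it) \<le> Z" "Z \<le> (\<Sum>it\<leftarrow>items lo up l r. item_hi K lam it)"
    and ZK: "Z \<in> range_of K" and lr: "l \<le> r"
  defines "xs \<equiv> fill K lam (items lo up l r) (Z - (\<Sum>it\<leftarrow>items lo up l r. item_lo K lam it))"
  shows "canonical {} a b lo up l r L (L + Z) (\<lambda>i. xs ! (i - l))" "xs = map (\<lambda>i. xs ! (i - l)) [l..<r]"
proof -
  have ok: "\<forall>it\<in>set (items lo up l r). item_ok K it" using bd q_nonneg by (auto simp: items_def)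
  have len: "length (items lo up l r) = r - l" by (simp add: items_def)
  have nth: "items lo up l r ! (i - l) = (q i, p i, lo i, up i)" if "i \<in> {l..<r}" for i
  proof -
    have "i - l < length [l..<r]" "l + (i - l) = i" "l + (i - l) < r" using that by auto
    then show ?thesis unfolding items_def by (subst nth_map) simp_all
  qed
  define s where "s = Z - (\<Sum>it\<leftarrow>items lo up l r. item_lo K lam it)"
  have xs: "xs = fill K lam (items lo up l r) s" by (simp add: xs_def s_def)
  have "s \<in> range_of K" unfolding s_def
    using ZK ok item_in_range by (intro range_of_closed sum_list_in_range) auto
  moreover have "s \<le> (\<Sum>it\<leftarrow>items lo up l r. item_hi K lam it - item_lo K lam it)"
    using Z by (simp add: s_def sum_list_subtractf)
  ultimately have P: "sum_list xs = Z"
    "\<And>i. i < r - l \<Longrightarrow> item_lo K lam (items lo up l r ! i) \<le> xs ! i \<and> xs ! i \<le> item_hi K lam (items lo up l r ! i)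
        \<and> xs ! i \<in> range_of K"
    "\<And>i j. j < r - l \<Longrightarrow> i < j \<Longrightarrow> xs ! i = item_hi K lam (items lo up l r ! i) \<or> xs ! j = item_lo K lam (items lo up l r ! j)"
    using fill_props[OF ok, of s lam] Z(1) unfolding len xs[symmetric] by (auto simp: s_def)
  have B: "resp_lo K lam (q i) (p i) (lo i) (up i) \<le> xs ! (i - l)" "xs ! (i - l) \<le> resp_hi K lam (q i) (p i) (lo i) (up i)"
    "xs ! (i - l) \<in> range_of K" if "i \<in> {l..<r}" for i
    using P(2)[of "i - l"] nth[OF that] that by auto
  have C: "xs ! (i - l) = resp_hi K lam (q i) (p i) (lo i) (up i) \<or> xs ! (j - l) = resp_lo K lam (q j) (p j) (lo j) (up j)"
    if "i \<in> {l..<r}" "j \<in> {l..<r}" "i < j" for i j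
    using P(3)[of "j - l" "i - l"] nth[OF that(1)] nth[OF that(2)] that by auto
  have lenxs: "length xs = r - l" by (simp add: xs_def len)
  show xsm: "xs = map (\<lambda>i. xs ! (i - l)) [l..<r]"
    using lenxs by (intro nth_equalityI) auto
  have "sum_list xs = (\<Sum>i=l..<r. xs ! (i - l))" by (subst xsm) (rule sum_list_interval)
  then have pt: "block_point {} a b lo up l r L (L + Z) (\<lambda>i. xs ! (i - l))"
    unfolding block_point_def
  proof (intro conjI ballI)
    fix i assume i: "i \<in> {l..<r}"
    note rb = resp_bounds[of "lo i" "up i" K lam "q i" "p i"]
    show "xs ! (i - l) \<in> range_of K" using B(3)[OF i] .
    show "lo i \<le> xs ! (i - l)" "xs ! (i - l) \<le> up i" using B(1,2)[OF i] rb bd[OF i] by linarith+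
  qed (use P(1) in auto)
  have ng: "no_gain (\<lambda>i. xs ! (i - l)) i j"
    if ij: "i \<in> {l..<r}" "j \<in> {l..<r}" "i \<noteq> j" and mi: "lo i < xs ! (i - l)" and mj: "xs ! (j - l) < up j" for i j
  proof -
    have 1: "marg_dn K (q i) (p i) (xs ! (i - l)) \<le> lam" "lam \<le> marg_up K (q j) (p j) (xs ! (j - l))"
      using resp_marg(1)[OF q_nonneg _ B(1)[OF ij(1)] B(2)[OF ij(1)] mi]
        resp_marg(2)[OF q_nonneg _ B(1)[OF ij(2)] B(2)[OF ij(2)] mj] bd ij by auto
    have "i < j" if eq: "marg_dn K (q i) (p i) (xs ! (i - l)) = marg_up K (q j) (p j) (xs ! (j - l))"
      and t: "ties K (q i)" "ties K (q j)"
    proof (rule ccontr)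
      assume "\<not> i < j"
      \<comment> \<open>The receiver \<open>j\<close> is the earlier position: it already has its
        largest response, or the giver \<open>i\<close> only its smallest. Either way one comparison
        with \<open>lam\<close> is strict.\<close>
      then have "xs ! (j - l) = resp_hi K lam (q j) (p j) (lo j) (up j) \<or> xs ! (i - l) = resp_lo K lam (q i) (p i) (lo i) (up i)"
        using C[of j i] ij by auto
      then show False
      proof
        assume h: "xs ! (j - l) = resp_hi K lam (q j) (p j) (lo j) (up j)"
        have "lam < marg_up K (q j) (p j) (xs ! (j - l))"
          unfolding h using resp_marg_strict(2)[OF q_nonneg _ t(2)] bd ij mj h by auto
        then show False using 1 eq by linarith
      next
        assume h: "xs ! (i - l) = resp_lo K lam (q i) (p i) (lo i) (up i)"
        have "marg_dn K (q i) (p i) (xs ! (i - l)) < lam"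
          unfolding h using resp_marg_strict(1)[OF q_nonneg _ t(1)] bd ij mi h by auto
        then show False using 1 eq by linarith
      qed
    qed
    then show ?thesis using 1 unfolding no_gain_def by auto
  qed
  show "canonical {} a b lo up l r L (L + Z) (\<lambda>i. xs ! (i - l))"
    using pt ng unfolding canonical_def by auto
qed

end

subsection \<open>Searching the multiplier\<close>

text \<open>An event \<open>(t, j, s)\<close> lets a piecewise linear function jump by \<open>j\<close> at \<open>t\<close> and changes its
  slope by \<open>s\<close>.\<close>

type_synonym event = "real \<times> real \<times> real"

text \<open>An event passed at \<open>t\<close> adds \<open>j + s * (v - t)\<close> to the value at
  \<open>v\<close>. This is the constant \<open>j - s * t\<close> plus slope \<open>s\<close>, so
  passed events can be summed up in two numbers.\<close>

definition jump_sum :: "event list \<Rightarrow> real" where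
  "jump_sum es = (\<Sum>(t, j, s)\<leftarrow>es. j - s * t)"

definition slope_sum :: "event list \<Rightarrow> real" where
  "slope_sum es = (\<Sum>(t, j, s)\<leftarrow>es. s)"

definition evs_lt :: "real \<Rightarrow> event list \<Rightarrow> event list" where "evs_lt v es = filter (\<lambda>e. fst e < v) es"
definition evs_le :: "real \<Rightarrow> event list \<Rightarrow> event list" where "evs_le v es = filter (\<lambda>e. fst e \<le> v) es"
definition evs_gt :: "real \<Rightarrow> event list \<Rightarrow> event list" where "evs_gt v es = filter (\<lambda>e. v < fst e) es"

definition pl_left :: "event list \<Rightarrow> real \<Rightarrow> real \<Rightarrow> real \<Rightarrow> real" where
  "pl_left es A S v = (A + jump_sum (evs_lt v es)) + (S + slope_sum (evs_lt v es)) * v"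

definition pl_right :: "event list \<Rightarrow> real \<Rightarrow> real \<Rightarrow> real \<Rightarrow> real" where
  "pl_right es A S v = (A + jump_sum (evs_le v es)) + (S + slope_sum (evs_le v es)) * v"

text \<open>The function is nondecreasing: it jumps upwards only and no piece has a negative slope.
  Single events may well have negative \<open>s\<close>, as a piece must also be able to
  end.\<close>

definition pl_ok :: "event list \<Rightarrow> real \<Rightarrow> bool" where
  "pl_ok es S \<longleftrightarrow> (\<forall>(t, j, s)\<in>set es. 0 \<le> j) \<and>
     (\<forall>v. 0 \<le> S + slope_sum (evs_lt v es)) \<and> (\<forall>v. 0 \<le> S + slope_sum (evs_le v es))"

text \<open>\<open>pl_left\<close> and \<open>pl_right\<close> are the one-sided limits, so a jump
  across \<open>Z\<close> counts as a crossing too.\<close>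

definition crossing :: "event list \<Rightarrow> real \<Rightarrow> real \<Rightarrow> real \<Rightarrow> real \<Rightarrow> bool" where
  "crossing es A S Z v \<longleftrightarrow> pl_left es A S v \<le> Z \<and> Z \<le> pl_right es A S v"

definition search_pre :: "event list \<Rightarrow> real \<Rightarrow> real \<Rightarrow> real \<Rightarrow> bool" where
  "search_pre es A S Z \<longleftrightarrow> pl_ok es S \<and> (\<exists>v. pl_left es A S v \<le> Z) \<and> (\<exists>v. Z \<le> pl_right es A S v)"

lemma sums_Nil [simp]: "jump_sum [] = 0" "slope_sum [] = 0" "evs_lt v [] = []" "evs_le v [] = []" "evs_gt v [] = []"
  by (auto simp: jump_sum_def slope_sum_def evs_lt_def evs_le_def evs_gt_def)

lemma sums_Cons [simp]: "jump_sum ((t, j, s) # es) = j - s * t + jump_sum es"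
  "slope_sum ((t, j, s) # es) = s + slope_sum es"
  by (auto simp: jump_sum_def slope_sum_def)

lemma sums_append [simp]: "jump_sum (es @ fs) = jump_sum es + jump_sum fs"
  "slope_sum (es @ fs) = slope_sum es + slope_sum fs"
  by (auto simp: jump_sum_def slope_sum_def)

lemma evs_Cons [simp]:
  "evs_lt v ((t, j, s) # es) = (if t < v then (t, j, s) # evs_lt v es else evs_lt v es)"
  "evs_le v ((t, j, s) # es) = (if t \<le> v then (t, j, s) # evs_le v es else evs_le v es)"
  "evs_gt v ((t, j, s) # es) = (if v < t then (t, j, s) # evs_gt v es else evs_gt v es)"
  by (auto simp: evs_lt_def evs_le_def evs_gt_def)

lemma evs_append [simp]: "evs_lt v (es @ fs) = evs_lt v es @ evs_lt v fs"
  "evs_le v (es @ fs) = evs_le v es @ evs_le v fs"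
  by (auto simp: evs_lt_def evs_le_def)

lemma pl_jump: "pl_right es A S v = pl_left es A S v + (\<Sum>(t, j, s)\<leftarrow>es. if t = v then j else 0)"
proof -
  have "jump_sum (evs_le v es) + slope_sum (evs_le v es) * v
     = jump_sum (evs_lt v es) + slope_sum (evs_lt v es) * v + (\<Sum>(t, j, s)\<leftarrow>es. if t = v then j else 0)"
  proof (induction es)
    case (Cons e es)
    obtain t j s where e: "e = (t, j, s)" by (cases e)
    show ?case using Cons unfolding e by (cases "t < v"; cases "t = v") (auto simp: algebra_simps)
  qed simp
  then show ?thesis unfolding pl_left_def pl_right_def by (simp add: distrib_right)
qed

lemma pl_left_le_right: "pl_ok es S \<Longrightarrow> pl_left es A S v \<le> pl_right es A S v"
  unfolding pl_jump pl_ok_def by (fastforce intro: sum_list_nonneg)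

text \<open>By induction on the number of events strictly between \<open>v\<close> and
  \<open>w\<close>: any of them splits the interval, and without one the function is affine with
  nonnegative slope.\<close>

lemma pl_right_le_left:
  assumes ok: "pl_ok es S" and vw: "v < w"
  shows "pl_right es A S v \<le> pl_left es A S w"
  using vw
proof (induction "length (filter (\<lambda>e. v < fst e \<and> fst e < w) es)" arbitrary: v w rule: less_induct)
  case less
  show ?case
  proof (cases "\<exists>e\<in>set es. v < fst e \<and> fst e < w")
    case True
    then obtain e where e: "e \<in> set es" "v < fst e" "fst e < w" by auto
    have sub: "length (filter (\<lambda>e'. a < fst e' \<and> fst e' < b) es) < length (filter (\<lambda>e. v < fst e \<and> fst e < w) es)"
      if "a = v \<and> b = fst e \<or> a = fst e \<and> b = w" for a b
    proof -
      have "(v < fst e' \<and> fst e' < w) \<and> (a < fst e' \<and> fst e' < b) \<longleftrightarrow> a < fst e' \<and> fst e' < b" for e' :: event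
        using that e(2,3) by linarith
      then have "filter (\<lambda>e'. a < fst e' \<and> fst e' < b) es
          = filter (\<lambda>e'. a < fst e' \<and> fst e' < b) (filter (\<lambda>e. v < fst e \<and> fst e < w) es)"
        by (simp only: filter_filter)
      moreover
      have "e \<in> set (filter (\<lambda>e. v < fst e \<and> fst e < w) es)" "\<not> (a < fst e \<and> fst e < b)"
        using that e by auto
      then have "length (filter (\<lambda>e'. a < fst e' \<and> fst e' < b) (filter (\<lambda>e. v < fst e \<and> fst e < w) es))
          < length (filter (\<lambda>e. v < fst e \<and> fst e < w) es)"
        by (rule length_filter_less)
      ultimately show ?thesis by (simp only:)
    qed
    have "pl_right es A S v \<le> pl_left es A S (fst e)" using less(1)[OF sub[of v "fst e"]] e by simp
    also have "\<dots> \<le> pl_right es A S (fst e)" using ok by (rule pl_left_le_right)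
    also have "\<dots> \<le> pl_left es A S w" using less(1)[OF sub[of "fst e" w]] e by simp
    finally show ?thesis .
  next
    case False
    then have "fst e < w \<longleftrightarrow> fst e \<le> v" if "e \<in> set es" for e using less(2) that by force
    then have "evs_lt w es = evs_le v es"
      unfolding evs_lt_def evs_le_def by (intro filter_cong refl) simp
    moreover have "(S + slope_sum (evs_le v es)) * v \<le> (S + slope_sum (evs_le v es)) * w"
      using ok less(2) by (auto simp: pl_ok_def intro!: mult_left_mono)
    ultimately show ?thesis by (simp add: pl_left_def pl_right_def)
  qed
qed

lemma pl_mono:
  assumes "pl_ok es S" "v \<le> w"
  shows "pl_left es A S v \<le> pl_left es A S w" "pl_right es A S v \<le> pl_right es A S w"
    "pl_left es A S v \<le> pl_right es A S w"
  using assms pl_right_le_left[of es S v w A] pl_left_le_right[of es S A v] pl_left_le_right[of es S A w]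
  by (cases "v = w"; force)+

lemma evs_lt_lt: "evs_lt v (evs_lt w es) = evs_lt (min v w) es" "evs_le v (evs_lt w es) = (if v < w then evs_le v es else evs_lt w es)"
  unfolding evs_lt_def evs_le_def by (auto intro!: filter_cong)

lemma sums_split_gt:
  "w < v \<Longrightarrow> jump_sum (evs_le w es) + jump_sum (evs_lt v (evs_gt w es)) = jump_sum (evs_lt v es)"
  "w < v \<Longrightarrow> slope_sum (evs_le w es) + slope_sum (evs_lt v (evs_gt w es)) = slope_sum (evs_lt v es)"
  "w \<le> v \<Longrightarrow> jump_sum (evs_le w es) + jump_sum (evs_le v (evs_gt w es)) = jump_sum (evs_le v es)"
  "w \<le> v \<Longrightarrow> slope_sum (evs_le w es) + slope_sum (evs_le v (evs_gt w es)) = slope_sum (evs_le v es)"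
  by (induction es) (auto split: if_splits)

lemma evs_gt_empty: "v \<le> w \<Longrightarrow> evs_lt v (evs_gt w es) = []" "v \<le> w \<Longrightarrow> evs_le v (evs_gt w es) = []"
  by (auto simp: evs_lt_def evs_le_def evs_gt_def filter_empty_conv)

text \<open>Without events the function is affine. If its slope is 0, it is constantly
  \<open>Z\<close>, and 0 serves as an arbitrary crossing.\<close>

lemma search_Nil:
  assumes "search_pre [] A S Z"
  shows "crossing [] A S Z (if S \<le> 0 then 0 else (Z - A) / S)"
  using assms by (auto simp: search_pre_def crossing_def pl_ok_def pl_left_def pl_right_def)

text \<open>All crossings lie left of \<open>w\<close>, and events from \<open>w\<close> on do not
  influence the values there. The value at \<open>w\<close> itself is kept as left limit and
  witnesses that \<open>Z\<close> is still reached.\<close>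

lemma search_left:
  assumes pre: "search_pre es A S Z" and Z: "Z < pl_left es A S w"
  shows "search_pre (evs_lt w es) A S Z" "crossing (evs_lt w es) A S Z v \<Longrightarrow> crossing es A S Z v"
proof -
  have ok: "pl_ok es S" using pre by (simp add: search_pre_def)
  have ok': "pl_ok (evs_lt w es) S"
    unfolding pl_ok_def evs_lt_lt
  proof (intro conjI allI)
    show "\<forall>(t, j, s)\<in>set (evs_lt w es). 0 \<le> j" using ok by (simp add: pl_ok_def evs_lt_def)
  qed (use ok in \<open>simp_all add: pl_ok_def\<close>)
  have left: "pl_left (evs_lt w es) A S v = pl_left es A S v" if "v \<le> w" for v
    using that unfolding pl_left_def evs_lt_lt by (simp add: min_absorb1)
  have right: "pl_right (evs_lt w es) A S v = pl_right es A S v" if "v < w" for v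
    using that unfolding pl_right_def evs_lt_lt by simp
  obtain u where u: "pl_left es A S u \<le> Z" using pre by (auto simp: search_pre_def)
  have uw: "u \<le> w" using pl_mono(1)[OF ok, of w u A] u Z by linarith
  have "Z \<le> pl_right (evs_lt w es) A S w"
    using pl_left_le_right[OF ok', of A w] left[of w] Z by simp
  then show "search_pre (evs_lt w es) A S Z"
    unfolding search_pre_def using ok' u left[OF uw] by metis
  show "crossing es A S Z v" if c: "crossing (evs_lt w es) A S Z v"
  proof -
    have "v < w"
      using pl_mono(1)[OF ok', of w v A] left[of w] c Z unfolding crossing_def by fastforce
    then show ?thesis using c left[of v] right[of v] by (simp add: crossing_def)
  qed
qed

text \<open>All crossings lie right of \<open>w\<close>, where the events up to \<open>w\<close>
  have been passed for good; they are absorbed into the constant \<open>A'\<close> and the slope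
  \<open>S'\<close>.\<close>

lemma search_right:
  assumes pre: "search_pre es A S Z" and Z: "pl_right es A S w < Z"
  defines "A' \<equiv> A + jump_sum (evs_le w es)" and "S' \<equiv> S + slope_sum (evs_le w es)"
  shows "search_pre (evs_gt w es) A' S' Z" "crossing (evs_gt w es) A' S' Z v \<Longrightarrow> crossing es A S Z v"
proof -
  have ok: "pl_ok es S" using pre by (simp add: search_pre_def)
  have s: "S' + slope_sum (evs_lt v (evs_gt w es)) = (if w < v then S + slope_sum (evs_lt v es) else S')"
    "S' + slope_sum (evs_le v (evs_gt w es)) = (if w \<le> v then S + slope_sum (evs_le v es) else S')" for v
    using sums_split_gt(2)[of w v es] sums_split_gt(4)[of w v es] by (auto simp: S'_def evs_gt_empty)
  have ok': "pl_ok (evs_gt w es) S'"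
    unfolding pl_ok_def s using ok by (auto simp: pl_ok_def S'_def evs_gt_def)
  have left: "pl_left (evs_gt w es) A' S' v = pl_left es A S v" if "w < v" for v
    unfolding pl_left_def s A'_def using that sums_split_gt(1)[OF that, of es] by simp
  have right: "pl_right (evs_gt w es) A' S' v = pl_right es A S v" if "w \<le> v" for v
    unfolding pl_right_def s A'_def using that sums_split_gt(3)[OF that, of es] by simp
  obtain u where u: "Z \<le> pl_right es A S u" using pre by (auto simp: search_pre_def)
  have uw: "w \<le> u" using pl_mono(2)[OF ok, of u w A] u Z by linarith
  have "pl_left (evs_gt w es) A' S' w \<le> Z"
    using pl_left_le_right[OF ok', of A' w] right[of w] Z by simp
  then show "search_pre (evs_gt w es) A' S' Z"
    unfolding search_pre_def using ok' u right[OF uw] by metis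
  show "crossing es A S Z v" if c: "crossing (evs_gt w es) A' S' Z v"
  proof -
    have "w < v"
      using pl_mono(2)[OF ok', of v w A'] right[of w] c Z unfolding crossing_def by fastforce
    then show ?thesis using c left[of v] right[of v] by (simp add: crossing_def)
  qed
qed

subsection \<open>Medians of medians\<close>

definition med3 :: "real \<Rightarrow> real \<Rightarrow> real \<Rightarrow> real" where
  "med3 x y z = max (min x y) (min z (max x y))"

text \<open>The maximum of the two minima and the minimum of the two maxima are the two middle
  values of \<open>a\<close>, \<open>b\<close>, \<open>c\<close>, \<open>d\<close>. Together with
  \<open>e\<close> they have the same median as all five.\<close>

definition med5 :: "real \<Rightarrow> real \<Rightarrow> real \<Rightarrow> real \<Rightarrow> real \<Rightarrow> real" where
  "med5 a b c d e = med3 e (max (min a b) (min c d)) (min (max a b) (max c d))"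

text \<open>Medians of groups of five; an incomplete last group is dropped. They are represented as
  unit jumps, so that the function with these events counts them and finding their median is again a
  search for a crossing.\<close>

fun medians :: "event list \<Rightarrow> event list" where
  "medians (a # b # c # d # e # es) = (med5 (fst a) (fst b) (fst c) (fst d) (fst e), 1, 0) # medians es"
| "medians es = []"

lemma length_medians: "length (medians es) = length es div 5"
  by (induction es rule: medians.induct) auto

lemma med5_ge: "v \<le> med5 a b c d e \<Longrightarrow> 3 \<le> length (filter (\<lambda>x. v \<le> x) [a, b, c, d, e])"
  unfolding med5_def med3_def le_max_iff_disj min.bounded_iff
  by (cases "v \<le> a"; cases "v \<le> b"; cases "v \<le> c"; cases "v \<le> d"; cases "v \<le> e"; simp)
lemma med5_le: "med5 a b c d e \<le> v \<Longrightarrow> 3 \<le> length (filter (\<lambda>x. x \<le> v) [a, b, c, d, e])"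
  unfolding med5_def med3_def min_le_iff_disj max.bounded_iff
  by (cases "a \<le> v"; cases "b \<le> v"; cases "c \<le> v"; cases "d \<le> v"; cases "e \<le> v"; simp)

lemma medians_ge:
  "3 * length (filter (\<lambda>m. v \<le> fst m) (medians es)) \<le> length (filter (\<lambda>e. v \<le> fst e) es)"
proof (induction es rule: medians.induct)
  case (1 a b c d e es)
  then show ?case using med5_ge[of v "fst a" "fst b" "fst c" "fst d" "fst e"] by auto
qed auto

lemma medians_le:
  "3 * length (filter (\<lambda>m. fst m \<le> v) (medians es)) \<le> length (filter (\<lambda>e. fst e \<le> v) es)"
proof (induction es rule: medians.induct)
  case (1 a b c d e es)
  then show ?case using med5_le[of "fst a" "fst b" "fst c" "fst d" "fst e" v] by auto
qed auto

definition unit_events :: "event list \<Rightarrow> bool" where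
  "unit_events es \<longleftrightarrow> (\<forall>e\<in>set es. snd e = (1, 0))"

lemma unit_medians: "unit_events (medians es)"
  by (induction es rule: medians.induct) (auto simp: unit_events_def)

lemma unit_sums:
  assumes "unit_events es"
  shows "slope_sum es = 0" "jump_sum es = real (length es)"
proof -
  have "slope_sum es = 0 \<and> jump_sum es = real (length es)" using assms
  proof (induction es)
    case (Cons e es)
    then show ?case by (cases e) (auto simp: unit_events_def)
  qed simp
  then show "slope_sum es = 0" "jump_sum es = real (length es)" by auto
qed

lemma unit_filter: "unit_events es \<Longrightarrow> unit_events (evs_lt v es)" "unit_events es \<Longrightarrow> unit_events (evs_le v es)"
  by (auto simp: unit_events_def evs_lt_def evs_le_def)

lemma unit_pl:
  assumes "unit_events es"
  shows "pl_left es 0 0 v = real (length (evs_lt v es))" "pl_right es 0 0 v = real (length (evs_le v es))"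
  using unit_sums[OF unit_filter(1)[OF assms]] unit_sums[OF unit_filter(2)[OF assms]]
  by (auto simp: pl_left_def pl_right_def)

lemma events_lower: "\<exists>v. \<forall>e\<in>set (es :: event list). v < fst e"
proof (induction es)
  case (Cons e es)
  then obtain v where "\<forall>e\<in>set es. v < fst e" by auto
  then show ?case by (intro exI[of _ "min v (fst e - 1)"]) auto
qed simp

lemma events_upper: "\<exists>v. \<forall>e\<in>set (es :: event list). fst e \<le> v"
proof (induction es)
  case (Cons e es)
  then obtain v where "\<forall>e\<in>set es. fst e \<le> v" by auto
  then show ?case by (intro exI[of _ "max v (fst e)"]) auto
qed simp

lemma pl_left_below: "\<forall>e\<in>set es. v < fst e \<Longrightarrow> pl_left es A S v = A + S * v"
proof -
  assume "\<forall>e\<in>set es. v < fst e"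
  then have "evs_lt v es = []" by (auto simp: evs_lt_def filter_empty_conv)
  then show ?thesis by (simp add: pl_left_def)
qed

lemma pl_right_above: "\<forall>e\<in>set es. fst e \<le> v \<Longrightarrow> pl_right es A S v = (A + jump_sum es) + (S + slope_sum es) * v"
proof -
  assume "\<forall>e\<in>set es. fst e \<le> v"
  then have "evs_le v es = es" by (auto simp: evs_le_def filter_id_conv)
  then show ?thesis by (simp add: pl_right_def)
qed

text \<open>The counting function grows from 0 to the number of events; it crosses half of this
  number at a median.\<close>

lemma search_pre_unit:
  assumes u: "unit_events es"
  shows "search_pre es 0 0 (real (length es) / 2)"
proof -
  obtain v where v: "\<forall>e\<in>set es. v < fst e" using events_lower by blast
  obtain w where w: "\<forall>e\<in>set es. fst e \<le> w" using events_upper by blast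
  have "pl_left es 0 0 v \<le> real (length es) / 2" using v by (simp add: pl_left_below)
  moreover have "real (length es) / 2 \<le> pl_right es 0 0 w"
    using w unit_sums[OF u] by (simp add: pl_right_above)
  moreover have "pl_ok es 0"
    using unit_sums[OF unit_filter(1)[OF u]] unit_sums[OF unit_filter(2)[OF u]] u
    by (force simp: pl_ok_def unit_events_def)
  ultimately show ?thesis unfolding search_pre_def by blast
qed

text \<open>At least half of the group medians are not below the pivot \<open>v\<close>, and each of
  them brings three events of its group along. So whichever side is kept, at least three halves of
  \<open>length es div 5\<close> events are discarded. Multiplication by 2 avoids halves.\<close>

lemma pivot_prunes:
  assumes c: "crossing (medians es) 0 0 (real (length es div 5) / 2) v"
  shows "2 * length (evs_lt v es) + 3 * (length es div 5) \<le> 2 * length es"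
    "2 * length (evs_gt v es) + 3 * (length es div 5) \<le> 2 * length es"
proof -
  note u = unit_medians[of es]
  have len: "length (filter P xs) + length (filter (\<lambda>x. \<not> P x) xs) = length xs" for P and xs :: "event list"
    by (rule sum_length_filter_compl)
  have a: "2 * length (evs_lt v (medians es)) \<le> length es div 5" "length es div 5 \<le> 2 * length (evs_le v (medians es))"
    using c unfolding crossing_def unit_pl[OF u] by linarith+
  have "length es div 5 \<le> 2 * length (filter (\<lambda>m. v \<le> fst m) (medians es))"
    using a(1) len[of "\<lambda>e. fst e < v" "medians es"] length_medians[of es] by (simp add: evs_lt_def not_less)
  then show "2 * length (evs_lt v es) + 3 * (length es div 5) \<le> 2 * length es"
    using medians_ge[of v es] len[of "\<lambda>e. fst e < v" es] by (simp add: evs_lt_def not_less)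
  show "2 * length (evs_gt v es) + 3 * (length es div 5) \<le> 2 * length es"
    using a(2) medians_le[of v es] len[of "\<lambda>e. v < fst e" es] by (simp add: evs_gt_def evs_le_def not_less)
qed

subsection \<open>Events of an allocation problem\<close>

text \<open>As the multiplier grows, a linear item jumps from \<open>lo\<close> to \<open>up\<close>
  at its price. A quadratic one grows with slope \<open>1 / (2 * q)\<close> from the moment the
  multiplier reaches the marginal cost at \<open>lo\<close> until it reaches the one at
  \<open>up\<close>.\<close>

fun item_events :: "item \<Rightarrow> event list" where
  "item_events (q, p, lo, up) =
     (if q \<le> 0 then [(p, up - lo, 0)]
      else [(q * (2 * lo) + p, 0, 1 / (2 * q)), (q * (2 * up) + p, 0, 0 - 1 / (2 * q))])"

definition cont_events :: "item list \<Rightarrow> event list" where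
  "cont_events its = concat (map item_events its)"

lemma pl_append:
  "pl_left (es @ fs) (A + B) 0 v = pl_left es A 0 v + pl_left fs B 0 v"
  "pl_right (es @ fs) (A + B) 0 v = pl_right es A 0 v + pl_right fs B 0 v"
  by (simp_all add: pl_left_def pl_right_def algebra_simps)

lemma pl_concat:
  assumes "\<And>it. it \<in> set its \<Longrightarrow> pl_left (f it) (g it) 0 v = l it"
  shows "pl_left (concat (map f its)) (\<Sum>it\<leftarrow>its. g it) 0 v = (\<Sum>it\<leftarrow>its. l it)"
  using assms
proof (induction its)
  case (Cons it its)
  have "pl_left (concat (map f (it # its))) (\<Sum>it\<leftarrow>it # its. g it) 0 v
      = pl_left (f it) (g it) 0 v + pl_left (concat (map f its)) (\<Sum>it\<leftarrow>its. g it) 0 v"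
    by (simp add: pl_append)
  then show ?case using Cons by simp
qed (simp add: pl_left_def)

lemma pr_concat:
  assumes "\<And>it. it \<in> set its \<Longrightarrow> pl_right (f it) (g it) 0 v = l it"
  shows "pl_right (concat (map f its)) (\<Sum>it\<leftarrow>its. g it) 0 v = (\<Sum>it\<leftarrow>its. l it)"
  using assms
proof (induction its)
  case (Cons it its)
  have "pl_right (concat (map f (it # its))) (\<Sum>it\<leftarrow>it # its. g it) 0 v
      = pl_right (f it) (g it) 0 v + pl_right (concat (map f its)) (\<Sum>it\<leftarrow>its. g it) 0 v"
    by (simp add: pl_append)
  then show ?case using Cons by simp
qed (simp add: pl_right_def)

lemma pl_ok_append: "pl_ok es 0 \<Longrightarrow> pl_ok fs 0 \<Longrightarrow> pl_ok (es @ fs) 0"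
  unfolding pl_ok_def by auto

lemma pl_ok_concat: "(\<And>it. it \<in> set its \<Longrightarrow> pl_ok (f it) 0) \<Longrightarrow> pl_ok (concat (map f its)) 0"
proof (induction its)
  case Nil
  then show ?case by (simp add: pl_ok_def)
next
  case (Cons it its)
  then show ?case by (simp add: pl_ok_append)
qed

lemma quad_event_iff:
  assumes "0 < (q::real)"
  shows "q * (2 * x) + p < v \<longleftrightarrow> x < (v - p) / (2 * q)" "q * (2 * x) + p \<le> v \<longleftrightarrow> x \<le> (v - p) / (2 * q)"
  using marg_le_iff(1,2)[OF assms, of x 0 p v] by simp_all

lemma quad_event_value:
  assumes "0 < (q::real)"
  shows "1 / (2 * q) * (q * (2 * x) + p) = x + p / (2 * q)"
  using assms by (simp add: field_simps)

lemma item_events_pl: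
  assumes "item_ok K it"
  shows "pl_left (item_events it) (low it) 0 v = item_lo Continuous v it"
    "pl_right (item_events it) (low it) 0 v = item_hi Continuous v it" "pl_ok (item_events it) 0"
    "jump_sum (item_events it) = upp it - low it" "slope_sum (item_events it) = 0"
proof -
  obtain q p lo up where it: "it = (q, p, lo, up)" by (cases it)
  have ok: "0 \<le> q" "lo \<le> up" using assms by (auto simp: it)
  have "pl_left (item_events it) (low it) 0 v = item_lo Continuous v it \<and>
    pl_right (item_events it) (low it) 0 v = item_hi Continuous v it \<and> pl_ok (item_events it) 0 \<and>
    jump_sum (item_events it) = upp it - low it \<and> slope_sum (item_events it) = 0"
  proof (cases "q \<le> 0")
    case True
    then show ?thesis unfolding it using ok
      by (auto simp: pl_left_def pl_right_def pl_ok_def resp_lo_def resp_hi_def)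
  next
    case False
    then have q: "0 < q" by simp
    define t where "t = (v - p) / (2 * q)"
    have v: "1 / (2 * q) * v = t + p / (2 * q)" using q by (simp add: t_def field_simps)
    have v': "v / (2 * q) - p / (2 * q) = t" by (simp add: t_def diff_divide_distrib)
    have ev: "item_events it = [(q * (2 * lo) + p, 0, 1 / (2 * q)), (q * (2 * up) + p, 0, 0 - 1 / (2 * q))]"
      using False by (simp add: it)
    have neg: "(0 - 1 / (2 * q)) * y = - (1 / (2 * q) * y)" for y by simp
    have pos: "0 < 1 / (2 * q)" using q by simp
    have L: "pl_left (item_events it) (low it) 0 v = clip lo up t"
    proof -
      consider "t \<le> lo" | "lo < t" "t \<le> up" | "lo < t" "up < t" by linarith
      then show ?thesis
      proof cases
        case 1
        then show ?thesis unfolding ev pl_left_def evs_Cons quad_event_iff[OF q] t_def[symmetric] using ok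
          by (simp add: it clip_def)
      next
        case 2
        then show ?thesis unfolding ev pl_left_def evs_Cons quad_event_iff[OF q] t_def[symmetric] using ok
          by (simp only: if_True if_False not_less it low.simps sums_Cons sums_Nil quad_event_value[OF q] add_0 add_0_right v neg)
             (auto simp: clip_def v')
      next
        case 3
        then show ?thesis unfolding ev pl_left_def evs_Cons quad_event_iff[OF q] t_def[symmetric] using ok
          by (simp only: if_True if_False not_less it low.simps sums_Cons sums_Nil quad_event_value[OF q] add_0 add_0_right v neg)
             (auto simp: clip_def v')
      qed
    qed
    have "pl_right (item_events it) (low it) 0 v = pl_left (item_events it) (low it) 0 v"
      unfolding pl_jump ev by simp
    moreover have "pl_ok (item_events it) 0"
    proof -
      have *: "q * (2 * up) + p \<le> w \<Longrightarrow> q * (2 * lo) + p \<le> w" "q * (2 * up) + p < w \<Longrightarrow> q * (2 * lo) + p < w" for w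
        unfolding quad_event_iff[OF q] using ok by linarith+
      show ?thesis unfolding pl_ok_def ev using * pos by auto
    qed
    moreover have "jump_sum (item_events it) = upp it - low it"
      unfolding ev sums_Cons neg quad_event_value[OF q] by (simp add: it)
    moreover have "slope_sum (item_events it) = 0" unfolding ev by simp
    ultimately show ?thesis using L False by (simp add: it resp_lo_def resp_hi_def t_def)
  qed
  then show "pl_left (item_events it) (low it) 0 v = item_lo Continuous v it"
    "pl_right (item_events it) (low it) 0 v = item_hi Continuous v it" "pl_ok (item_events it) 0"
    "jump_sum (item_events it) = upp it - low it" "slope_sum (item_events it) = 0" by auto
qed

lemma cont_events_pl:
  assumes "\<forall>it\<in>set its. item_ok K it"
  shows "pl_left (cont_events its) (\<Sum>it\<leftarrow>its. low it) 0 v = (\<Sum>it\<leftarrow>its. item_lo Continuous v it)"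
    "pl_right (cont_events its) (\<Sum>it\<leftarrow>its. low it) 0 v = (\<Sum>it\<leftarrow>its. item_hi Continuous v it)"
    "pl_ok (cont_events its) 0"
  unfolding cont_events_def
  by (rule pl_concat item_events_pl pr_concat pl_ok_concat bspec[OF assms] | assumption)+

lemma cont_events_sums:
  assumes "\<forall>it\<in>set its. item_ok K it"
  shows "jump_sum (cont_events its) = (\<Sum>it\<leftarrow>its. upp it) - (\<Sum>it\<leftarrow>its. low it)" "slope_sum (cont_events its) = 0"
proof -
  have "jump_sum (cont_events its) = (\<Sum>it\<leftarrow>its. upp it) - (\<Sum>it\<leftarrow>its. low it) \<and> slope_sum (cont_events its) = 0"
    using assms
  proof (induction its)
    case (Cons it its)
    then show ?case using item_events_pl(4,5)[of K it] by (simp add: cont_events_def)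
  qed (simp add: cont_events_def)
  then show "jump_sum (cont_events its) = (\<Sum>it\<leftarrow>its. upp it) - (\<Sum>it\<leftarrow>its. low it)" "slope_sum (cont_events its) = 0"
    by simp_all
qed

lemma length_cont_events: "length (cont_events its) \<le> 2 * length its"
proof (induction its)
  case (Cons it its)
  have "length (item_events it) \<le> 2" by (cases it) auto
  then show ?case using Cons by (simp add: cont_events_def)
qed (simp add: cont_events_def)

lemma search_pre_cont:
  assumes ok: "\<forall>it\<in>set its. item_ok K it" and Z: "(\<Sum>it\<leftarrow>its. low it) \<le> Z" "Z \<le> (\<Sum>it\<leftarrow>its. upp it)"
  shows "search_pre (cont_events its) (\<Sum>it\<leftarrow>its. low it) 0 Z"
proof -
  obtain v where v: "\<forall>e\<in>set (cont_events its). v < fst e" using events_lower by blast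
  obtain w where w: "\<forall>e\<in>set (cont_events its). fst e \<le> w" using events_upper by blast
  have "pl_left (cont_events its) (\<Sum>it\<leftarrow>its. low it) 0 v \<le> Z" using pl_left_below[OF v] Z by simp
  moreover have "Z \<le> pl_right (cont_events its) (\<Sum>it\<leftarrow>its. low it) 0 w"
    using pl_right_above[OF w] cont_events_sums[OF ok] Z by simp
  ultimately show ?thesis unfolding search_pre_def using cont_events_pl(3)[OF ok] by blast
qed

section \<open>Integer responses as sequences of unit jumps\<close>

fun unit_list :: "real \<Rightarrow> real \<Rightarrow> real \<Rightarrow> nat \<Rightarrow> event list" where
  "unit_list q p x 0 = []"
| "unit_list q p x (Suc k) = (q * (2 * x + 1) + p, 1, 0) # unit_list q p (x + 1) k"

lemma length_unit_list [simp]: "length (unit_list q p x k) = k"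
  by (induction k arbitrary: x) auto

lemma unit_unit_list: "unit_events (unit_list q p x k)"
  by (induction k arbitrary: x) (auto simp: unit_events_def)

text \<open>The jump from \<open>x\<close> to \<open>x + 1\<close> sits at the multiplier equal to
  the cost of this unit, \<open>q * (2 * x + 1) + p\<close>. Counting the jumps strictly below
  \<open>v\<close> therefore gives the smallest response, and in the next lemma counting those up to
  \<open>v\<close> the largest.\<close>

lemma unit_list_left:
  assumes "0 < q" "x \<in> \<int>"
  shows "x + jump_sum (evs_lt v (unit_list q p x k)) = clip x (x + real k) (0 - of_int \<lfloor>1/2 - (v - p) / (2 * q)\<rfloor>)"
  using assms(2)
proof (induction k arbitrary: x)
  case 0
  then show ?case by (simp add: clip_def)
next
  case (Suc k)
  define N where "N = 0 - \<lfloor>1/2 - (v - p) / (2 * q)\<rfloor>"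
  obtain z where z: "x = of_int z" using Suc.prems by (auto elim: Ints_cases)
  have IH: "x + 1 + jump_sum (evs_lt v (unit_list q p (x + 1) k)) = clip (x + 1) (x + 1 + real k) (of_int N)"
    using Suc.IH[of "x + 1"] Suc.prems by (simp add: N_def)
  have "q * (2 * x + 1) + p < v \<longleftrightarrow> x < (v - p) / (2 * q) - 1 / 2"
    using marg_le_iff(2)[OF assms(1), of x "-1" p v] by simp
  also have "\<dots> \<longleftrightarrow> z < N" unfolding N_def z by linarith
  finally have c: "q * (2 * x + 1) + p < v \<longleftrightarrow> x < of_int N" using z by simp
  have "x + 1 \<le> of_int N" if "x < of_int N" using int_less_ge_one[OF Suc.prems _ that] by simp
  then have "x + jump_sum (evs_lt v (unit_list q p x (Suc k))) = clip x (x + real (Suc k)) (of_int N)"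
    using IH c by (cases "x < of_int N") (auto simp: clip_def max_def min_def split: if_splits)
  then show ?case by (simp add: N_def)
qed

lemma unit_list_right:
  assumes "0 < q" "x \<in> \<int>"
  shows "x + jump_sum (evs_le v (unit_list q p x k)) = clip x (x + real k) (of_int \<lfloor>1/2 + (v - p) / (2 * q)\<rfloor>)"
  using assms(2)
proof (induction k arbitrary: x)
  case 0
  then show ?case by (simp add: clip_def)
next
  case (Suc k)
  define N where "N = \<lfloor>1/2 + (v - p) / (2 * q)\<rfloor>"
  obtain z where z: "x = of_int z" using Suc.prems by (auto elim: Ints_cases)
  have IH: "x + 1 + jump_sum (evs_le v (unit_list q p (x + 1) k)) = clip (x + 1) (x + 1 + real k) (of_int N)"
    using Suc.IH[of "x + 1"] Suc.prems by (simp add: N_def)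
  have "q * (2 * x + 1) + p \<le> v \<longleftrightarrow> x \<le> (v - p) / (2 * q) - 1 / 2"
    using marg_le_iff(1)[OF assms(1), of x "-1" p v] by simp
  also have "\<dots> \<longleftrightarrow> z < N" unfolding N_def z by linarith
  finally have c: "q * (2 * x + 1) + p \<le> v \<longleftrightarrow> x < of_int N" using z by simp
  have "x + 1 \<le> of_int N" if "x < of_int N" using int_less_ge_one[OF Suc.prems _ that] by simp
  then have "x + jump_sum (evs_le v (unit_list q p x (Suc k))) = clip x (x + real (Suc k)) (of_int N)"
    using IH c by (cases "x < of_int N") (auto simp: clip_def max_def min_def split: if_splits)
  then show ?case by (simp add: N_def)
qed

text \<open>A linear item has a single jump of arbitrary height. For a quadratic item only the unit
  jumps between its responses at \<open>l1\<close> and at \<open>l2\<close> are listed, since all of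
  them would be too many.\<close>

fun int_item_events :: "real \<Rightarrow> real \<Rightarrow> item \<Rightarrow> event list" where
  "int_item_events l1 l2 (q, p, lo, up) =
     (if q \<le> 0 then [(p, up - lo, 0)]
      else unit_list q p (resp_lo Integer l1 q p lo up)
        (nat \<lfloor>resp_hi Integer l2 q p lo up - resp_lo Integer l1 q p lo up\<rfloor>))"

text \<open>The event of a linear item contains its whole jump even if this happens before
  \<open>l1\<close>, so such an item starts from \<open>lo\<close>.\<close>

fun int_base :: "real \<Rightarrow> item \<Rightarrow> real" where
  "int_base l1 (q, p, lo, up) = (if q \<le> 0 then lo else resp_lo Integer l1 q p lo up)"

definition int_events :: "real \<Rightarrow> real \<Rightarrow> item list \<Rightarrow> event list" where
  "int_events l1 l2 its = concat (map (int_item_events l1 l2) its)"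

text \<open>The truncated list of unit jumps represents the response correctly for multipliers
  between \<open>l1\<close> and \<open>l2\<close>.\<close>

lemma clip_clip:
  "lo \<le> up \<Longrightarrow> n1 \<le> n \<Longrightarrow> n \<le> n2 \<Longrightarrow> clip (clip lo up n1) (clip lo up n2) n = clip lo up n"
  by (auto simp: clip_def)

lemma unit_pl':
  assumes "unit_events es"
  shows "pl_left es A 0 v = A + jump_sum (evs_lt v es)" "pl_right es A 0 v = A + jump_sum (evs_le v es)"
    "pl_ok es 0"
  using unit_sums[OF unit_filter(1)[OF assms]] unit_sums[OF unit_filter(2)[OF assms]] assms
  unfolding pl_left_def pl_right_def by (force simp: pl_ok_def unit_events_def)+

lemma int_item_events_pl:
  assumes "item_ok Integer it" "l1 \<le> l2"
  shows "l1 \<le> v \<Longrightarrow> v \<le> l2 \<Longrightarrow> pl_left (int_item_events l1 l2 it) (int_base l1 it) 0 v = item_lo Integer v it"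
    "l1 \<le> v \<Longrightarrow> v \<le> l2 \<Longrightarrow> pl_right (int_item_events l1 l2 it) (int_base l1 it) 0 v = item_hi Integer v it"
    "pl_ok (int_item_events l1 l2 it) 0"
    "0 < fst it \<Longrightarrow> real (length (int_item_events l1 l2 it)) = item_hi Integer l2 it - item_lo Integer l1 it"
proof -
  obtain q p lo up where it: "it = (q, p, lo, up)" by (cases it)
  have ok: "0 \<le> q" "lo \<le> up" "lo \<in> \<int>" "up \<in> \<int>" using assms(1) by (auto simp: it)
  have "(l1 \<le> v \<longrightarrow> v \<le> l2 \<longrightarrow> pl_left (int_item_events l1 l2 it) (int_base l1 it) 0 v = item_lo Integer v it \<and>
    pl_right (int_item_events l1 l2 it) (int_base l1 it) 0 v = item_hi Integer v it) \<and>
    pl_ok (int_item_events l1 l2 it) 0 \<and>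
    (0 < fst it \<longrightarrow> real (length (int_item_events l1 l2 it)) = item_hi Integer l2 it - item_lo Integer l1 it)"
  proof (cases "q \<le> 0")
    case True
    then show ?thesis unfolding it using ok
      by (auto simp: pl_left_def pl_right_def pl_ok_def resp_lo_def resp_hi_def)
  next
    case False
    then have q: "0 < q" by simp
    define N where "N v = (0 - of_int \<lfloor>1/2 - (v - p) / (2 * q)\<rfloor> :: real)" for v :: real
    define N' where "N' v = (of_int \<lfloor>1/2 + (v - p) / (2 * q)\<rfloor> :: real)" for v :: real
    have lo: "resp_lo Integer v q p lo up = clip lo up (N v)" for v using False by (simp add: resp_lo_def N_def)
    have hi: "resp_hi Integer v q p lo up = clip lo up (N' v)" for v using False by (simp add: resp_hi_def N'_def)
    define x where "x = resp_lo Integer l1 q p lo up"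
    define k where "k = nat \<lfloor>resp_hi Integer l2 q p lo up - resp_lo Integer l1 q p lo up\<rfloor>"
    have t: "(v - p) / (2 * q) \<le> (w - p) / (2 * q)" if "v \<le> w" for v w using that q by (simp add: divide_right_mono)
    have NN: "N v \<le> N' v" for v unfolding N_def N'_def by (rule neg_floor_le_floor)
    have Nm: "N v \<le> N w" "N' v \<le> N' w" if "v \<le> w" for v w
      using t[OF that] unfolding N_def N'_def by (simp_all add: floor_mono)
    have NN': "N v \<le> N' w" if "v \<le> w" for v w using NN[of v] Nm(2)[OF that] by linarith
    have xI: "x \<in> \<int>" using resp_in_range(1)[of lo Integer up] ok by (simp add: x_def)
    have "resp_hi Integer l2 q p lo up \<in> \<int>" using resp_in_range(2)[of lo Integer up] ok by simp
    then have "resp_hi Integer l2 q p lo up - x \<in> \<int>" using xI by simp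
    moreover have "0 \<le> resp_hi Integer l2 q p lo up - x"
      using clip_mono[OF NN'[OF assms(2)], of lo up] by (simp add: lo hi x_def)
    ultimately have k: "real k = resp_hi Integer l2 q p lo up - x"
      by (auto simp: k_def x_def elim!: Ints_cases)
    have ev: "int_item_events l1 l2 it = unit_list q p x k" "int_base l1 it = x"
      using False by (simp_all add: it x_def k_def)
    have "pl_left (unit_list q p x k) x 0 v = clip (clip lo up (N l1)) (clip lo up (N' l2)) (N v)"
      unfolding unit_pl'[OF unit_unit_list] unit_list_left[OF q xI] using k by (simp add: N_def x_def lo hi)
    moreover have "pl_right (unit_list q p x k) x 0 v = clip (clip lo up (N l1)) (clip lo up (N' l2)) (N' v)"
      unfolding unit_pl'[OF unit_unit_list] unit_list_right[OF q xI] using k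
      by (simp add: N'_def x_def lo hi)
    ultimately have "l1 \<le> v \<longrightarrow> v \<le> l2 \<longrightarrow> pl_left (unit_list q p x k) x 0 v = clip lo up (N v) \<and>
        pl_right (unit_list q p x k) x 0 v = clip lo up (N' v)"
      using clip_clip[OF ok(2)] Nm NN' by simp
    then show ?thesis unfolding ev using unit_pl'(3)[OF unit_unit_list] k
      by (simp add: it lo hi x_def)
  qed
  then show "l1 \<le> v \<Longrightarrow> v \<le> l2 \<Longrightarrow> pl_left (int_item_events l1 l2 it) (int_base l1 it) 0 v = item_lo Integer v it"
    "l1 \<le> v \<Longrightarrow> v \<le> l2 \<Longrightarrow> pl_right (int_item_events l1 l2 it) (int_base l1 it) 0 v = item_hi Integer v it"
    "pl_ok (int_item_events l1 l2 it) 0"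
    "0 < fst it \<Longrightarrow> real (length (int_item_events l1 l2 it)) = item_hi Integer l2 it - item_lo Integer l1 it"
    by auto
qed

text \<open>Rounding moves the stationary point by at most 1/2, and clipping does not increase
  distances. Since the bounds are integral, a continuous response at a bound stays there after
  rounding; the last two claims are needed when \<open>Z - n\<close> or \<open>Z + n\<close> leaves
  the attainable range.\<close>

lemma int_near_cont:
  assumes "item_ok Integer it"
  shows "item_lo Integer v it \<le> item_lo Continuous v it + 1 / 2"
    "item_hi Continuous v it - 1 / 2 \<le> item_hi Integer v it"
    "0 < fst it \<Longrightarrow> item_hi Integer v it \<le> item_lo Continuous v it + 1 / 2"
    "0 < fst it \<Longrightarrow> item_hi Continuous v it - 1 / 2 \<le> item_lo Integer v it"
    "item_lo Continuous v it = low it \<Longrightarrow> item_lo Integer v it = low it"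
    "item_hi Continuous v it = upp it \<Longrightarrow> item_hi Integer v it = upp it"
proof -
  obtain q p lo up where it: "it = (q, p, lo, up)" by (cases it)
  have ok: "0 \<le> q" "lo \<le> up" "lo \<in> \<int>" "up \<in> \<int>" using assms(1) by (auto simp: it)
  have "item_lo Integer v it \<le> item_lo Continuous v it + 1 / 2 \<and>
    item_hi Continuous v it - 1 / 2 \<le> item_hi Integer v it \<and>
    (0 < fst it \<longrightarrow> item_hi Integer v it \<le> item_lo Continuous v it + 1 / 2) \<and>
    (0 < fst it \<longrightarrow> item_hi Continuous v it - 1 / 2 \<le> item_lo Integer v it) \<and>
    (item_lo Continuous v it = low it \<longrightarrow> item_lo Integer v it = low it) \<and>
    (item_hi Continuous v it = upp it \<longrightarrow> item_hi Integer v it = upp it)"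
  proof (cases "q \<le> 0")
    case True
    then show ?thesis unfolding it by (simp add: resp_lo_def resp_hi_def)
  next
    case False
    define t where "t = (v - p) / (2 * q)"
    define N where "N = 0 - \<lfloor>1/2 - t\<rfloor>"
    define N' where "N' = \<lfloor>1/2 + t\<rfloor>"
    have N: "t - 1/2 \<le> of_int N" "of_int N \<le> t + 1/2" "t - 1/2 \<le> of_int N'" "of_int N' \<le> t + 1/2"
      unfolding N_def N'_def by linarith+
    have C: "item_lo Continuous v it = clip lo up t" "item_hi Continuous v it = clip lo up t"
      "item_lo Integer v it = clip lo up (of_int N)" "item_hi Integer v it = clip lo up (of_int N')"
      using False by (simp_all add: it resp_lo_def resp_hi_def t_def N_def N'_def)
    have near: "clip lo up y \<le> clip lo up t + 1/2" "clip lo up t - 1/2 \<le> clip lo up y"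
      if "t - 1/2 \<le> y" "y \<le> t + 1/2" for y
      using that by (auto simp: clip_def max_def min_def)
    obtain a b where ab: "lo = of_int a" "up = of_int b" using ok by (auto elim!: Ints_cases)
    have e1: "clip lo up (of_int N) = lo" if "clip lo up t = lo"
    proof (cases "lo = up")
      case False
      then have "t \<le> lo" using that ok by (auto simp: clip_def max_def min_def split: if_splits)
      then have "N \<le> a" unfolding N_def ab by linarith
      then show ?thesis using ok by (simp add: clip_def ab)
    qed (simp add: clip_def)
    have e2: "clip lo up (of_int N') = up" if "clip lo up t = up"
    proof (cases "lo = up")
      case False
      then have "up \<le> t" using that ok by (auto simp: clip_def max_def min_def split: if_splits)
      then have "b \<le> N'" unfolding N'_def ab by linarith
      then show ?thesis using ok by (simp add: clip_def ab)
    qed (simp add: clip_def)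
    show ?thesis unfolding C using near[OF N(1,2)] near[OF N(3,4)] e1 e2 by (simp add: it)
  qed
  then show "item_lo Integer v it \<le> item_lo Continuous v it + 1 / 2"
    "item_hi Continuous v it - 1 / 2 \<le> item_hi Integer v it"
    "0 < fst it \<Longrightarrow> item_hi Integer v it \<le> item_lo Continuous v it + 1 / 2"
    "0 < fst it \<Longrightarrow> item_hi Continuous v it - 1 / 2 \<le> item_lo Integer v it"
    "item_lo Continuous v it = low it \<Longrightarrow> item_lo Integer v it = low it"
    "item_hi Continuous v it = upp it \<Longrightarrow> item_hi Integer v it = upp it" by auto
qed

lemma sum_list_le_imp_eq:
  assumes "\<And>x. x \<in> set xs \<Longrightarrow> f x \<le> (g x :: real)" "(\<Sum>x\<leftarrow>xs. g x) \<le> (\<Sum>x\<leftarrow>xs. f x)" "x \<in> set xs"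
  shows "f x = g x"
  using assms
proof (induction xs)
  case (Cons y xs)
  have "(\<Sum>x\<leftarrow>xs. f x) \<le> (\<Sum>x\<leftarrow>xs. g x)" using Cons.prems(1) by (intro sum_list_mono) auto
  moreover have "f y \<le> g y" using Cons.prems(1) by simp
  ultimately have "f y = g y" "(\<Sum>x\<leftarrow>xs. g x) \<le> (\<Sum>x\<leftarrow>xs. f x)" using Cons.prems(2) by auto
  then show ?case using Cons by auto
qed simp

lemma sum_list_add_const: "(\<Sum>x\<leftarrow>xs. f x + c) = (\<Sum>x\<leftarrow>xs. f x) + real (length xs) * c"
  by (induction xs) (auto simp: algebra_simps)

text \<open>The multipliers of the continuous problem for the amounts \<open>Z - n\<close> and \<open>Z + n\<close> enclose the one
  of the integer problem, with only linearly many integer breakpoints in between.\<close>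

lemma int_search:
  fixes its :: "item list" and Z l1 l2' :: real
  defines "n \<equiv> real (length its)"
  defines "Z1 \<equiv> max (Z - n) (\<Sum>it\<leftarrow>its. low it)" and "Z2 \<equiv> min (Z + n) (\<Sum>it\<leftarrow>its. upp it)"
  defines "l2 \<equiv> max l1 l2'"
  assumes ok: "\<forall>it\<in>set its. item_ok Integer it" and Z: "(\<Sum>it\<leftarrow>its. low it) \<le> Z" "Z \<le> (\<Sum>it\<leftarrow>its. upp it)"
    and c1: "crossing (cont_events its) (\<Sum>it\<leftarrow>its. low it) 0 Z1 l1"
    and c2: "crossing (cont_events its) (\<Sum>it\<leftarrow>its. low it) 0 Z2 l2'"
  shows "length (int_events l1 l2 its) \<le> 4 * length its"
    "search_pre (int_events l1 l2 its) (\<Sum>it\<leftarrow>its. int_base l1 it) 0 Z"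
    "crossing (int_events l1 l2 its) (\<Sum>it\<leftarrow>its. int_base l1 it) 0 Z l3 \<Longrightarrow>
       (\<Sum>it\<leftarrow>its. item_lo Integer (max l1 (min l3 l2)) it) \<le> Z \<and>
       Z \<le> (\<Sum>it\<leftarrow>its. item_hi Integer (max l1 (min l3 l2)) it)"
proof -
  note okD = bspec[OF ok]
  note pl = cont_events_pl[OF ok]
  have l12: "l1 \<le> l2" by (simp add: l2_def)
  have Z12: "Z1 \<le> Z2" using Z by (auto simp: Z1_def Z2_def n_def)
  \<comment> \<open>If the second search returned a smaller multiplier, monotonicity gives
    \<open>Z2 \<le> Z1\<close>, hence equality, and \<open>l1\<close> is a crossing for both
    amounts.\<close>
  have c2: "crossing (cont_events its) (\<Sum>it\<leftarrow>its. low it) 0 Z2 l2"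
  proof (cases "l1 \<le> l2'")
    case False
    then have "Z2 \<le> Z1"
      using c1 c2 pl_right_le_left[OF pl(3), of l2' l1 "\<Sum>it\<leftarrow>its. low it"] unfolding crossing_def by linarith
    then show ?thesis using c1 Z12 False by (simp add: l2_def)
  qed (use c2 in \<open>simp add: l2_def\<close>)
  have C: "(\<Sum>it\<leftarrow>its. item_lo Continuous l1 it) \<le> Z1" "Z1 \<le> (\<Sum>it\<leftarrow>its. item_hi Continuous l1 it)"
    "(\<Sum>it\<leftarrow>its. item_lo Continuous l2 it) \<le> Z2" "Z2 \<le> (\<Sum>it\<leftarrow>its. item_hi Continuous l2 it)"
    using c1 c2 unfolding crossing_def pl by auto
  \<comment> \<open>\<open>n\<close> roundings by at most 1/2 cannot use up the margin
    \<open>n\<close>. If the margin is cut off by the lower bounds, all items are at their lower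
    bounds and rounding changes nothing.\<close>
  have lo1: "(\<Sum>it\<leftarrow>its. item_lo Integer l1 it) \<le> Z"
  proof (cases "(\<Sum>it\<leftarrow>its. low it) \<le> Z - n")
    case True
    have "(\<Sum>it\<leftarrow>its. item_lo Integer l1 it) \<le> (\<Sum>it\<leftarrow>its. item_lo Continuous l1 it + 1 / 2)"
      by (intro sum_list_mono int_near_cont(1) okD)
    then show ?thesis using C(1) True unfolding sum_list_add_const by (simp add: Z1_def n_def)
  next
    case False
    have "low it = item_lo Continuous l1 it" if "it \<in> set its" for it
    proof (rule sum_list_le_imp_eq[OF _ _ that])
      show "(\<Sum>it\<leftarrow>its. item_lo Continuous l1 it) \<le> (\<Sum>it\<leftarrow>its. low it)" using C(1) False by (simp add: Z1_def)
    qed (rule item_bounds(1)[OF okD])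
    then have "(\<Sum>it\<leftarrow>its. item_lo Integer l1 it) = (\<Sum>it\<leftarrow>its. low it)"
      by (intro arg_cong[of _ _ sum_list] map_cong refl int_near_cont(5) okD) simp_all
    then show ?thesis using Z by simp
  qed
  have hi2: "Z \<le> (\<Sum>it\<leftarrow>its. item_hi Integer l2 it)"
  proof (cases "Z + n \<le> (\<Sum>it\<leftarrow>its. upp it)")
    case True
    have "(\<Sum>it\<leftarrow>its. item_hi Continuous l2 it) \<le> (\<Sum>it\<leftarrow>its. item_hi Integer l2 it + 1 / 2)"
    proof (rule sum_list_mono)
      fix it assume "it \<in> set its"
      then show "item_hi Continuous l2 it \<le> item_hi Integer l2 it + 1 / 2"
        using int_near_cont(2)[OF okD, of it l2] by linarith
    qed
    then show ?thesis using C(4) True unfolding sum_list_add_const by (simp add: Z2_def n_def)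
  next
    case False
    have "item_hi Continuous l2 it = upp it" if "it \<in> set its" for it
    proof (rule sum_list_le_imp_eq[OF _ _ that])
      show "(\<Sum>it\<leftarrow>its. upp it) \<le> (\<Sum>it\<leftarrow>its. item_hi Continuous l2 it)" using C(4) False by (simp add: Z2_def)
    qed (rule item_bounds(3)[OF okD])
    then have "(\<Sum>it\<leftarrow>its. item_hi Integer l2 it) = (\<Sum>it\<leftarrow>its. upp it)"
      by (intro arg_cong[of _ _ sum_list] map_cong refl int_near_cont(6) okD) simp_all
    then show ?thesis using Z by simp
  qed
  have B: "pl_left (int_events l1 l2 its) (\<Sum>it\<leftarrow>its. int_base l1 it) 0 v = (\<Sum>it\<leftarrow>its. item_lo Integer v it)"
    "pl_right (int_events l1 l2 its) (\<Sum>it\<leftarrow>its. int_base l1 it) 0 v = (\<Sum>it\<leftarrow>its. item_hi Integer v it)"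
    if "l1 \<le> v" "v \<le> l2" for v
    unfolding int_events_def
    by (rule pl_concat pr_concat int_item_events_pl(1,2) okD l12 that | assumption)+
  have iok: "pl_ok (int_events l1 l2 its) 0"
    unfolding int_events_def by (rule pl_ok_concat int_item_events_pl(3) okD l12 | assumption)+
  show "search_pre (int_events l1 l2 its) (\<Sum>it\<leftarrow>its. int_base l1 it) 0 Z"
    unfolding search_pre_def using iok lo1 hi2 B(1)[of l1] B(2)[of l2] l12 by (metis order_refl)
  show "(\<Sum>it\<leftarrow>its. item_lo Integer (max l1 (min l3 l2)) it) \<le> Z \<and>
       Z \<le> (\<Sum>it\<leftarrow>its. item_hi Integer (max l1 (min l3 l2)) it)"
    if c: "crossing (int_events l1 l2 its) (\<Sum>it\<leftarrow>its. int_base l1 it) 0 Z l3"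
  proof -
    consider "l3 < l1" | "l1 \<le> l3" "l3 \<le> l2" | "l2 < l3" by linarith
    then show ?thesis
    proof cases
      case 1
      then have "Z \<le> pl_right (int_events l1 l2 its) (\<Sum>it\<leftarrow>its. int_base l1 it) 0 l1"
        using c pl_mono(2)[OF iok, of l3 l1 "\<Sum>it\<leftarrow>its. int_base l1 it"] unfolding crossing_def by linarith
      then show ?thesis using B(2)[of l1] l12 lo1 1 by (simp add: min_absorb1 max_absorb1)
    next
      case 2
      then show ?thesis using c B[of l3] by (simp add: crossing_def)
    next
      case 3
      then have "pl_left (int_events l1 l2 its) (\<Sum>it\<leftarrow>its. int_base l1 it) 0 l2 \<le> Z"
        using c pl_mono(1)[OF iok, of l2 l3 "\<Sum>it\<leftarrow>its. int_base l1 it"] unfolding crossing_def by linarith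
      then show ?thesis using B(1)[of l2] l12 hi2 3 by (simp add: min_absorb2 max_absorb2)
    qed
  qed
  show "length (int_events l1 l2 its) \<le> 4 * length its"
  proof -
    have len: "real (length (int_events l1 l2 its)) = (\<Sum>it\<leftarrow>its. real (length (int_item_events l1 l2 it)))"
      unfolding int_events_def by (induction its) auto
    \<comment> \<open>Rounding at both ends adds at most one jump to the continuous increase from
      \<open>l1\<close> to \<open>l2\<close>. Summed over the items, the increase is at most
      \<open>Z2 - Z1 \<le> 2 * n\<close>, so there are at most \<open>3 * n\<close> events.\<close>
    have quad: "real (length (int_item_events l1 l2 it)) \<le> (item_lo Continuous l2 it - item_hi Continuous l1 it) + 1"
      if "it \<in> set its" "0 < fst it" for it
      using int_item_events_pl(4)[OF okD[OF that(1)] l12 that(2)] int_near_cont(3)[OF okD[OF that(1)] that(2), of l2]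
        int_near_cont(4)[OF okD[OF that(1)] that(2), of l1] by linarith
    have lin: "real (length (int_item_events l1 l2 it)) = 1" if "\<not> 0 < fst it" for it
      using that by (cases it) auto
    have "real (length (int_events l1 l2 its)) \<le> 3 * n"
    \<comment> \<open>For \<open>l1 = l2\<close> a linear item with this price would count its jump
      negatively in the increase. But then each quadratic item has at most one event anyway.\<close>
    proof (cases "l1 < l2")
      case True
      have lin': "item_hi Continuous l1 it \<le> item_lo Continuous l2 it" if "it \<in> set its" "\<not> 0 < fst it" for it
      proof -
        obtain q p lo up where it: "it = (q, p, lo, up)" by (cases it)
        have "q \<le> 0" "lo \<le> up" using okD[OF that(1)] that(2) by (simp_all add: it)
        then show ?thesis using True by (simp add: it resp_lo_def resp_hi_def)
      qed
      have "(\<Sum>it\<leftarrow>its. real (length (int_item_events l1 l2 it)))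
          \<le> (\<Sum>it\<leftarrow>its. (item_lo Continuous l2 it - item_hi Continuous l1 it) + 1)"
      proof (rule sum_list_mono)
        fix it assume it: "it \<in> set its"
        show "real (length (int_item_events l1 l2 it)) \<le> (item_lo Continuous l2 it - item_hi Continuous l1 it) + 1"
          using quad[OF it] lin[of it] lin'[OF it] by (cases "0 < fst it"; simp)
      qed
      also have "\<dots> \<le> (Z2 - Z1) + n"
        unfolding sum_list_add_const sum_list_subtractf using C by (simp add: n_def)
      finally show ?thesis unfolding len by (simp add: Z1_def Z2_def max_def min_def split: if_splits)
    next
      case False
      then have eq: "l2 = l1" using l12 by simp
      have same: "item_hi Continuous l1 it = item_lo Continuous l1 it" if "0 < fst it" for it
        using that by (cases it) (simp add: resp_lo_def resp_hi_def)
      have "(\<Sum>it\<leftarrow>its. real (length (int_item_events l1 l2 it))) \<le> (\<Sum>it\<leftarrow>its. 0 + 1)"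
      proof (rule sum_list_mono)
        fix it assume it: "it \<in> set its"
        show "real (length (int_item_events l1 l2 it)) \<le> 0 + 1"
          using quad[OF it] lin[of it] same[of it] unfolding eq by (cases "0 < fst it"; simp)
      qed
      then show ?thesis unfolding len sum_list_add_const by (simp add: n_def)
    qed
    then show ?thesis unfolding n_def by linarith
  qed
qed

section \<open>The program\<close>

subsection \<open>Code with named variables\<close>

text \<open>Code is turned into an expression when the number of variables in scope is known, so that
  variables can be referred to by their level.  Local variables of the program become bound
  variables of the logic.\<close>

type_synonym code = "nat \<Rightarrow> exp"

definition cvar :: "nat \<Rightarrow> code" where "cvar l = (\<lambda>k. EVar (k - Suc l))"
definition cint :: "int \<Rightarrow> code" where "cint z = (\<lambda>k. EConst z)"
definition cop :: "arith \<Rightarrow> code \<Rightarrow> code \<Rightarrow> code" where "cop f a b = (\<lambda>k. EArith f (a k) (b k))"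
definition cfloor :: "code \<Rightarrow> code" where "cfloor a = (\<lambda>k. EFloor (a k))"
definition cif :: "code \<Rightarrow> code \<Rightarrow> code \<Rightarrow> code \<Rightarrow> code" where
  "cif a b c d = (\<lambda>k. EIfLe (a k) (b k) (c k) (d k))"
definition cnil :: code where "cnil = (\<lambda>k. ENil)"
definition ccell :: "code \<Rightarrow> code \<Rightarrow> code" (infixr "\<rightharpoonup>" 60) where "ccell a b = (\<lambda>k. ECell (a k) (b k))"
text \<open>With \<open>k\<close> variables in scope, the branch has \<open>k + 2\<close> of them:
  the tail is bound at level \<open>k\<close> and the head, which has index 0, at level
  \<open>k + 1\<close>.\<close>

definition ccase :: "code \<Rightarrow> code \<Rightarrow> (code \<Rightarrow> code \<Rightarrow> code) \<Rightarrow> code" where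
  "ccase e n f = (\<lambda>k. ECase (e k) (n k) (f (cvar (Suc k)) (cvar k) (Suc (Suc k))))"
definition clet :: "code \<Rightarrow> (code \<Rightarrow> code) \<Rightarrow> code" where
  "clet e f = (\<lambda>k. ELet (e k) (f (cvar k) (Suc k)))"
definition ccall :: "nat \<Rightarrow> code \<Rightarrow> code" where "ccall g e = (\<lambda>k. ECall g (e k))"

definition cproc :: "(code \<Rightarrow> code) \<Rightarrow> exp" where "cproc f = f (cvar 0) 1"

abbreviation cadd (infixl "\<oplus>" 65) where "cadd \<equiv> cop Plus"
abbreviation csub (infixl "\<ominus>" 65) where "csub \<equiv> cop Minus"
abbreviation cmul (infixl "\<otimes>" 70) where "cmul \<equiv> cop Times"
abbreviation cdiv (infixl "\<oslash>" 70) where "cdiv \<equiv> cop Divide"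
abbreviation csplit :: "code \<Rightarrow> (code \<Rightarrow> code \<Rightarrow> code) \<Rightarrow> code" where "csplit e f \<equiv> ccase e cnil f"

subsection \<open>Weakest preconditions\<close>

definition wp :: "bool \<Rightarrow> program \<Rightarrow> val list \<Rightarrow> code \<Rightarrow> (val \<Rightarrow> nat \<Rightarrow> bool) \<Rightarrow> bool" where
  "wp rnd P \<rho> c Q \<longleftrightarrow> (\<exists>v t. eval rnd P \<rho> (c (length \<rho>)) v t \<and> Q v t)"

definition wp_call :: "bool \<Rightarrow> program \<Rightarrow> nat \<Rightarrow> val \<Rightarrow> (val \<Rightarrow> nat \<Rightarrow> bool) \<Rightarrow> bool" where
  "wp_call rnd P g u Q \<longleftrightarrow> g < length P \<and> (\<exists>v t. eval rnd P [u] (P ! g) v t \<and> Q v t)"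

definition with_num :: "val \<Rightarrow> (real \<Rightarrow> bool) \<Rightarrow> bool" where
  "with_num u F \<longleftrightarrow> (\<exists>x. u = Num x \<and> F x)"

lemma with_num_Num [simp]: "with_num (Num x) F = F x"
  by (simp add: with_num_def)

text \<open>As a congruence rule it keeps the simplifier out of \<open>F\<close> until the value is
  known to be a number.\<close>

lemma with_num_cong [cong]: "u = u' \<Longrightarrow> with_num u F = with_num u' F"
  by simp

text \<open>Determinism turns the existential in \<open>wp\<close> into an equation, so that the
  rules for atomic code can be used as rewrite rules.\<close>

lemma eval_result: "eval rnd P \<rho> e v t \<Longrightarrow> (\<exists>w s. eval rnd P \<rho> e w s \<and> Q w s) = Q v t"
  using eval_deterministic by blast

lemma wp_var [simp]: "l < length \<rho> \<Longrightarrow> wp rnd P \<rho> (cvar l) Q = Q (\<rho> ! (length \<rho> - Suc l)) 1"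
  unfolding wp_def cvar_def by (rule eval_result, rule eval.Var) simp

lemma wp_int [simp]: "wp rnd P \<rho> (cint z) Q = Q (Num (of_int z)) 1"
  unfolding wp_def cint_def by (rule eval_result, rule eval.Const)

lemma wp_op [simp]:
  "wp rnd P \<rho> (cop f a b) Q = wp rnd P \<rho> a (\<lambda>u s. wp rnd P \<rho> b (\<lambda>v t.
     with_num u (\<lambda>x. with_num v (\<lambda>y. (f = Divide \<longrightarrow> y \<noteq> 0) \<and> Q (Num (arith_op f x y)) (s + t + 1)))))"
  (is "?l = ?r")
proof
  assume ?l
  then show ?r unfolding wp_def cop_def with_num_def by (elim exE conjE eval_ArithE) fastforce
next
  assume ?r
  then obtain x s y t where xy: "eval rnd P \<rho> (a (length \<rho>)) (Num x) s" "eval rnd P \<rho> (b (length \<rho>)) (Num y) t"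
    "f = Divide \<longrightarrow> y \<noteq> 0" "Q (Num (arith_op f x y)) (s + t + 1)"
    unfolding wp_def with_num_def by blast
  then show ?l unfolding wp_def cop_def using eval.Arith[OF xy(1,2), of f] by blast
qed

lemma wp_floor [simp]:
  "wp rnd P \<rho> (cfloor a) Q = wp rnd P \<rho> a (\<lambda>u s. with_num u (\<lambda>x. rnd \<and> Q (Num (of_int \<lfloor>x\<rfloor>)) (s + 1)))"
  (is "?l = ?r")
proof
  assume ?l
  then obtain x s where "rnd" "eval rnd P \<rho> (a (length \<rho>)) (Num x) s" "Q (Num (of_int \<lfloor>x\<rfloor>)) (s + 1)"
    unfolding wp_def cfloor_def by (elim exE conjE eval_FloorE) auto
  then show ?r unfolding wp_def with_num_def by auto
next
  assume ?r
  then obtain x s where "rnd" "eval rnd P \<rho> (a (length \<rho>)) (Num x) s" "Q (Num (of_int \<lfloor>x\<rfloor>)) (s + 1)"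
    unfolding wp_def with_num_def by auto
  then show ?l unfolding wp_def cfloor_def using eval.Floor by blast
qed

lemma wp_if [simp]:
  "wp rnd P \<rho> (cif a b c d) Q = wp rnd P \<rho> a (\<lambda>u s. wp rnd P \<rho> b (\<lambda>v t.
     with_num u (\<lambda>x. with_num v (\<lambda>y.
       if x \<le> y then wp rnd P \<rho> c (\<lambda>w r. Q w (s + t + r + 1)) else wp rnd P \<rho> d (\<lambda>w r. Q w (s + t + r + 1))))))"
  (is "?l = ?r")
proof
  assume ?l
  then show ?r unfolding wp_def cif_def with_num_def by (elim exE conjE eval_IfLeE) fastforce+
next
  assume ?r
  then obtain x s y t where xy: "eval rnd P \<rho> (a (length \<rho>)) (Num x) s" "eval rnd P \<rho> (b (length \<rho>)) (Num y) t"
    "if x \<le> y then wp rnd P \<rho> c (\<lambda>w r. Q w (s + t + r + 1)) else wp rnd P \<rho> d (\<lambda>w r. Q w (s + t + r + 1))"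
    unfolding wp_def with_num_def by blast
  show ?l
  proof (cases "x \<le> y")
    case True
    then obtain v r where "eval rnd P \<rho> (c (length \<rho>)) v r" "Q v (s + t + r + 1)" using xy(3) by (auto simp: wp_def)
    then show ?thesis unfolding wp_def cif_def using eval.If_true[OF xy(1,2) True] by blast
  next
    case False
    then obtain v r where "eval rnd P \<rho> (d (length \<rho>)) v r" "Q v (s + t + r + 1)" using xy(3) by (auto simp: wp_def)
    then show ?thesis unfolding wp_def cif_def using eval.If_false[OF xy(1,2) False] by blast
  qed
qed

lemma wp_nil [simp]: "wp rnd P \<rho> cnil Q = Q Nil_cell 1"
  unfolding wp_def cnil_def by (rule eval_result, rule eval.Nil)

lemma wp_cell [simp]:
  "wp rnd P \<rho> (a \<rightharpoonup> b) Q = wp rnd P \<rho> a (\<lambda>u s. wp rnd P \<rho> b (\<lambda>v t. Q (Cell u v) (s + t + 1)))"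
  (is "?l = ?r")
proof
  assume ?l
  then show ?r unfolding wp_def ccell_def by (elim exE conjE eval_CellE) fastforce
next
  assume ?r
  then obtain u s v t where "eval rnd P \<rho> (a (length \<rho>)) u s" "eval rnd P \<rho> (b (length \<rho>)) v t"
    "Q (Cell u v) (s + t + 1)"
    by (auto simp: wp_def)
  then show ?l unfolding wp_def ccell_def using eval.Cell by blast
qed

lemma wp_case [simp]:
  "wp rnd P \<rho> (ccase e n f) Q = wp rnd P \<rho> e (\<lambda>u s. case u of Num x \<Rightarrow> False
      | Nil_cell \<Rightarrow> wp rnd P \<rho> n (\<lambda>v t. Q v (s + t + 1))
      | Cell h w \<Rightarrow> wp rnd P (h # w # \<rho>) (f (cvar (Suc (length \<rho>))) (cvar (length \<rho>))) (\<lambda>v t. Q v (s + t + 1)))"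
  (is "?l = ?r")
proof
  assume ?l
  then show ?r unfolding wp_def ccase_def by (elim exE conjE eval_CaseE) fastforce+
next
  assume ?r
  then obtain u s where u: "eval rnd P \<rho> (e (length \<rho>)) u s" and
    c: "case u of Num x \<Rightarrow> False
      | Nil_cell \<Rightarrow> wp rnd P \<rho> n (\<lambda>v t. Q v (s + t + 1))
      | Cell h w \<Rightarrow> wp rnd P (h # w # \<rho>) (f (cvar (Suc (length \<rho>))) (cvar (length \<rho>))) (\<lambda>v t. Q v (s + t + 1))"
    unfolding wp_def by blast
  show ?l
  proof (cases u)
    case Nil_cell
    then show ?thesis using u c eval.Case_nil unfolding wp_def ccase_def by simp blast
  next
    case (Cell h w)
    then have "eval rnd P \<rho> (e (length \<rho>)) (Cell h w) s" using u by simp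
    moreover obtain v t where "eval rnd P (h # w # \<rho>) (f (cvar (Suc (length \<rho>))) (cvar (length \<rho>)) (Suc (Suc (length \<rho>)))) v t"
      "Q v (s + t + 1)" using c Cell by (auto simp: wp_def)
    ultimately show ?thesis using eval.Case_cell unfolding wp_def ccase_def by blast
  qed (use c in simp)
qed

lemma wp_let [simp]:
  "wp rnd P \<rho> (clet e f) Q = wp rnd P \<rho> e (\<lambda>u s. wp rnd P (u # \<rho>) (f (cvar (length \<rho>))) (\<lambda>v t. Q v (s + t + 1)))"
  (is "?l = ?r")
proof
  assume ?l
  then show ?r unfolding wp_def clet_def by (elim exE conjE eval_LetE) fastforce
next
  assume ?r
  then obtain u s v t where "eval rnd P \<rho> (e (length \<rho>)) u s"
    "eval rnd P (u # \<rho>) (f (cvar (length \<rho>)) (Suc (length \<rho>))) v t" "Q v (s + t + 1)"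
    by (auto simp: wp_def)
  then show ?l unfolding wp_def clet_def using eval.Let by blast
qed

lemma wp_ccall:
  "wp rnd P \<rho> (ccall g e) Q = wp rnd P \<rho> e (\<lambda>u s. wp_call rnd P g u (\<lambda>v t. Q v (s + t + 1)))"
  (is "?l = ?r")
proof
  assume ?l
  then show ?r unfolding wp_def wp_call_def ccall_def by (elim exE conjE eval_CallE) fastforce
next
  assume ?r
  then obtain u s v t where "eval rnd P \<rho> (e (length \<rho>)) u s" "g < length P"
    "eval rnd P [u] (P ! g) v t" "Q v (s + t + 1)"
    by (auto simp: wp_def wp_call_def)
  then show ?l unfolding wp_def ccall_def using eval.Call by blast
qed

lemma wp_call_mono:
  "wp_call rnd P g u R \<Longrightarrow> (\<And>v t. R v t \<Longrightarrow> Q v t) \<Longrightarrow> wp_call rnd P g u Q"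
  unfolding wp_call_def by blast

lemma wp_call_proc:
  "g < length fs \<Longrightarrow> wp_call rnd (map cproc fs) g u Q = wp rnd (map cproc fs) [u] ((fs ! g) (cvar 0)) Q"
  by (simp add: wp_call_def wp_def cproc_def)

section \<open>Lists, events and items as machine values\<close>

fun vlist :: "('a \<Rightarrow> val) \<Rightarrow> 'a list \<Rightarrow> val" where
  "vlist f [] = Nil_cell"
| "vlist f (x # xs) = Cell (f x) (vlist f xs)"

fun ev_val :: "event \<Rightarrow> val" where "ev_val (t, j, s) = Cell (Num t) (Cell (Num j) (Num s))"
fun it_val :: "item \<Rightarrow> val" where "it_val (q, p, lo, up) = Cell (Num q) (Cell (Num p) (Cell (Num lo) (Num up)))"

text \<open>The four values of a variable belong to the four combinations of bounds at the two ends of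
  its block.\<close>

type_synonym quad_item = "real \<times> real \<times> real \<times> real \<times> real \<times> real"

fun qi_val :: "quad_item \<Rightarrow> val" where
  "qi_val (q, p, aa, ab, ba, bb) =
     Cell (Num q) (Cell (Num p) (Cell (Num aa) (Cell (Num ab) (Cell (Num ba) (Num bb)))))"

subsection \<open>The functions of the program\<close>

abbreviation (input) "F_APP \<equiv> 42 :: nat"
abbreviation (input) "F_LEN \<equiv> 2 :: nat"
abbreviation (input) "F_LT \<equiv> 3 :: nat"
abbreviation (input) "F_LE \<equiv> 4 :: nat"
abbreviation (input) "F_GT \<equiv> 5 :: nat"
abbreviation (input) "F_JSUM \<equiv> 6 :: nat"
abbreviation (input) "F_SSUM \<equiv> 7 :: nat"
abbreviation (input) "F_MIN \<equiv> 8 :: nat"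
abbreviation (input) "F_MAX \<equiv> 9 :: nat"
abbreviation (input) "F_MEDS \<equiv> 10 :: nat"
abbreviation (input) "F_SEARCH \<equiv> 11 :: nat"
abbreviation (input) "F_STEP \<equiv> 43 :: nat"
abbreviation (input) "F_CEV \<equiv> 12 :: nat"
abbreviation (input) "F_SLOW \<equiv> 13 :: nat"
abbreviation (input) "F_SUPP \<equiv> 14 :: nat"
abbreviation (input) "F_CLIP \<equiv> 15 :: nat"
abbreviation (input) "F_RLO \<equiv> 16 :: nat"
abbreviation (input) "F_RHI \<equiv> 17 :: nat"
abbreviation (input) "F_SRLO \<equiv> 18 :: nat"
abbreviation (input) "F_FILL \<equiv> 19 :: nat"
abbreviation (input) "F_UNITS \<equiv> 20 :: nat"
abbreviation (input) "F_IEV \<equiv> 21 :: nat"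
abbreviation (input) "F_IBASE \<equiv> 22 :: nat"
abbreviation (input) "F_LAM \<equiv> 23 :: nat"
abbreviation (input) "F_RAP \<equiv> 24 :: nat"
abbreviation (input) "F_PLA \<equiv> 25 :: nat"
abbreviation (input) "F_PLB \<equiv> 26 :: nat"
abbreviation (input) "F_PRA \<equiv> 27 :: nat"
abbreviation (input) "F_PRB \<equiv> 28 :: nat"
abbreviation (input) "F_ZIP \<equiv> 29 :: nat"
abbreviation (input) "F_SOLVE \<equiv> 30 :: nat"
abbreviation (input) "F_MERGE \<equiv> 31 :: nat"
abbreviation (input) "F_PAIR \<equiv> 32 :: nat"
abbreviation (input) "F_PASSES \<equiv> 33 :: nat"
abbreviation (input) "F_TAKE \<equiv> 34 :: nat"
abbreviation (input) "F_DROP \<equiv> 35 :: nat"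
abbreviation (input) "F_SUMABS \<equiv> 36 :: nat"
abbreviation (input) "F_SLOPES \<equiv> 37 :: nat"
abbreviation (input) "F_EXPAND \<equiv> 38 :: nat"
abbreviation (input) "F_BUILD \<equiv> 39 :: nat"
abbreviation (input) "F_OUT \<equiv> 40 :: nat"
abbreviation (input) "F_ZERO \<equiv> 41 :: nat"
abbreviation (input) "F_CORE \<equiv> 1 :: nat"

definition b_app :: "code \<Rightarrow> code" where
  "b_app x = csplit x (\<lambda>xs ys. ccase xs ys (\<lambda>h t. h \<rightharpoonup> ccall F_APP (t \<rightharpoonup> ys)))"
definition b_len :: "code \<Rightarrow> code" where
  "b_len x = ccase x (cint 0) (\<lambda>h t. cint 1 \<oplus> ccall F_LEN t)"
definition b_lt :: "code \<Rightarrow> code" where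
  "b_lt x = csplit x (\<lambda>v es. ccase es cnil (\<lambda>e es.
     clet (ccall F_LT (v \<rightharpoonup> es)) (\<lambda>r. csplit e (\<lambda>t _. cif v t r (e \<rightharpoonup> r)))))"
definition b_le :: "code \<Rightarrow> code" where
  "b_le x = csplit x (\<lambda>v es. ccase es cnil (\<lambda>e es.
     clet (ccall F_LE (v \<rightharpoonup> es)) (\<lambda>r. csplit e (\<lambda>t _. cif t v (e \<rightharpoonup> r) r))))"
definition b_gt :: "code \<Rightarrow> code" where
  "b_gt x = csplit x (\<lambda>v es. ccase es cnil (\<lambda>e es.
     clet (ccall F_GT (v \<rightharpoonup> es)) (\<lambda>r. csplit e (\<lambda>t _. cif t v r (e \<rightharpoonup> r)))))"
definition b_jsum :: "code \<Rightarrow> code" where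
  "b_jsum x = ccase x (cint 0) (\<lambda>e es. csplit e (\<lambda>t js. csplit js (\<lambda>j s.
     (j \<ominus> s \<otimes> t) \<oplus> ccall F_JSUM es)))"
definition b_ssum :: "code \<Rightarrow> code" where
  "b_ssum x = ccase x (cint 0) (\<lambda>e es. csplit e (\<lambda>t js. csplit js (\<lambda>j s. s \<oplus> ccall F_SSUM es)))"
definition b_min :: "code \<Rightarrow> code" where "b_min x = csplit x (\<lambda>a b. cif a b a b)"
definition b_max :: "code \<Rightarrow> code" where "b_max x = csplit x (\<lambda>a b. cif a b b a)"

abbreviation "cmin a b \<equiv> ccall F_MIN (a \<rightharpoonup> b)"
abbreviation "cmax a b \<equiv> ccall F_MAX (a \<rightharpoonup> b)"

definition b_meds :: "code \<Rightarrow> code" where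
  "b_meds x = ccase x cnil (\<lambda>a x. ccase x cnil (\<lambda>b x. ccase x cnil (\<lambda>c x. ccase x cnil (\<lambda>d x. ccase x cnil (\<lambda>e x.
     csplit a (\<lambda>a _. csplit b (\<lambda>b _. csplit c (\<lambda>c _. csplit d (\<lambda>d _. csplit e (\<lambda>e _.
       clet (cmax (cmin a b) (cmin c d)) (\<lambda>y. clet (cmin (cmax a b) (cmax c d)) (\<lambda>z.
         (cmax (cmin e y) (cmin z (cmax e y)) \<rightharpoonup> cint 1 \<rightharpoonup> cint 0) \<rightharpoonup> ccall F_MEDS x))))))))))))"

text \<open>The pivot is the median of the group medians, found by a recursive call that looks for
  half of their number. With fewer than five events there are no groups, and the position of the
  first event is the pivot. \<open>F_STEP\<close> then keeps one side.\<close>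

definition b_search :: "code \<Rightarrow> code" where
  "b_search x = csplit x (\<lambda>es y. csplit y (\<lambda>A y. csplit y (\<lambda>S Z.
     ccase es (cif S (cint 0) (cint 0) ((Z \<ominus> A) \<oslash> S)) (\<lambda>e _.
       clet (ccall F_MEDS es) (\<lambda>ms.
       clet (ccase ms (csplit e (\<lambda>t _. t))
              (\<lambda>_ _. ccall F_SEARCH (ms \<rightharpoonup> cint 0 \<rightharpoonup> cint 0 \<rightharpoonup> ccall F_LEN ms \<oslash> cint 2))) (\<lambda>w.
       ccall F_STEP (w \<rightharpoonup> es \<rightharpoonup> A \<rightharpoonup> S \<rightharpoonup> Z)))))))"
definition b_step :: "code \<Rightarrow> code" where
  "b_step x = csplit x (\<lambda>w y. csplit y (\<lambda>es y. csplit y (\<lambda>A y. csplit y (\<lambda>S Z.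
     clet (ccall F_LT (w \<rightharpoonup> es)) (\<lambda>lt.
     cif ((A \<oplus> ccall F_JSUM lt) \<oplus> (S \<oplus> ccall F_SSUM lt) \<otimes> w) Z
       (clet (ccall F_LE (w \<rightharpoonup> es)) (\<lambda>le.
        clet (A \<oplus> ccall F_JSUM le) (\<lambda>A'. clet (S \<oplus> ccall F_SSUM le) (\<lambda>S'.
        cif Z (A' \<oplus> S' \<otimes> w) w (ccall F_SEARCH (ccall F_GT (w \<rightharpoonup> es) \<rightharpoonup> A' \<rightharpoonup> S' \<rightharpoonup> Z))))))
       (ccall F_SEARCH (lt \<rightharpoonup> A \<rightharpoonup> S \<rightharpoonup> Z)))))))"

definition b_cev :: "code \<Rightarrow> code" where
  "b_cev x = ccase x cnil (\<lambda>i its. clet (ccall F_CEV its) (\<lambda>r.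
     csplit i (\<lambda>q y. csplit y (\<lambda>p y. csplit y (\<lambda>lo up.
       cif q (cint 0) ((p \<rightharpoonup> up \<ominus> lo \<rightharpoonup> cint 0) \<rightharpoonup> r)
         ((q \<otimes> (cint 2 \<otimes> lo) \<oplus> p \<rightharpoonup> cint 0 \<rightharpoonup> cint 1 \<oslash> (cint 2 \<otimes> q)) \<rightharpoonup>
          (q \<otimes> (cint 2 \<otimes> up) \<oplus> p \<rightharpoonup> cint 0 \<rightharpoonup> cint 0 \<ominus> cint 1 \<oslash> (cint 2 \<otimes> q)) \<rightharpoonup> r))))))"
definition b_slow :: "code \<Rightarrow> code" where
  "b_slow x = ccase x (cint 0) (\<lambda>i its. csplit i (\<lambda>q y. csplit y (\<lambda>p y. csplit y (\<lambda>lo up.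
     lo \<oplus> ccall F_SLOW its))))"
definition b_supp :: "code \<Rightarrow> code" where
  "b_supp x = ccase x (cint 0) (\<lambda>i its. csplit i (\<lambda>q y. csplit y (\<lambda>p y. csplit y (\<lambda>lo up.
     up \<oplus> ccall F_SUPP its))))"
definition b_clip :: "code \<Rightarrow> code" where
  "b_clip x = csplit x (\<lambda>lo y. csplit y (\<lambda>up y. cmax lo (cmin up y)))"

definition b_rlo :: "variables \<Rightarrow> code \<Rightarrow> code" where
  "b_rlo K x = csplit x (\<lambda>lam i. csplit i (\<lambda>q y. csplit y (\<lambda>p y. csplit y (\<lambda>lo up.
     cif q (cint 0) (cif lam p lo up)
       (ccall F_CLIP (lo \<rightharpoonup> up \<rightharpoonup>
          (if K = Integer then cint 0 \<ominus> cfloor (cint 1 \<oslash> cint 2 \<ominus> (lam \<ominus> p) \<oslash> (cint 2 \<otimes> q))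
           else (lam \<ominus> p) \<oslash> (cint 2 \<otimes> q))))))))"
definition b_rhi :: "variables \<Rightarrow> code \<Rightarrow> code" where
  "b_rhi K x = csplit x (\<lambda>lam i. csplit i (\<lambda>q y. csplit y (\<lambda>p y. csplit y (\<lambda>lo up.
     cif q (cint 0) (cif p lam up lo)
       (ccall F_CLIP (lo \<rightharpoonup> up \<rightharpoonup>
          (if K = Integer then cfloor (cint 1 \<oslash> cint 2 \<oplus> (lam \<ominus> p) \<oslash> (cint 2 \<otimes> q))
           else (lam \<ominus> p) \<oslash> (cint 2 \<otimes> q))))))))"
definition b_srlo :: "code \<Rightarrow> code" where
  "b_srlo x = csplit x (\<lambda>lam its. ccase its (cint 0) (\<lambda>i its. ccall F_RLO (lam \<rightharpoonup> i) \<oplus> ccall F_SRLO (lam \<rightharpoonup> its)))"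
definition b_fill :: "code \<Rightarrow> code" where
  "b_fill x = csplit x (\<lambda>lam y. csplit y (\<lambda>its s. ccase its cnil (\<lambda>i its.
     clet (ccall F_RLO (lam \<rightharpoonup> i)) (\<lambda>lo. clet (cmin (ccall F_RHI (lam \<rightharpoonup> i) \<ominus> lo) s) (\<lambda>g.
       lo \<oplus> g \<rightharpoonup> ccall F_FILL (lam \<rightharpoonup> its \<rightharpoonup> s \<ominus> g))))))"
text \<open>The argument \<open>z\<close> is the value at which to stop, and \<open>r\<close> the
  list behind the new events, which spares a concatenation.\<close>

definition b_units :: "code \<Rightarrow> code" where
  "b_units x = csplit x (\<lambda>q y. csplit y (\<lambda>p y. csplit y (\<lambda>x y. csplit y (\<lambda>z r.
     cif z x r ((q \<otimes> (cint 2 \<otimes> x \<oplus> cint 1) \<oplus> p \<rightharpoonup> cint 1 \<rightharpoonup> cint 0) \<rightharpoonup>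
       ccall F_UNITS (q \<rightharpoonup> p \<rightharpoonup> x \<oplus> cint 1 \<rightharpoonup> z \<rightharpoonup> r))))))"
definition b_iev :: "code \<Rightarrow> code" where
  "b_iev x = csplit x (\<lambda>l1 y. csplit y (\<lambda>l2 its. ccase its cnil (\<lambda>i its.
     clet (ccall F_IEV (l1 \<rightharpoonup> l2 \<rightharpoonup> its)) (\<lambda>r. csplit i (\<lambda>q y. csplit y (\<lambda>p y. csplit y (\<lambda>lo up.
       cif q (cint 0) ((p \<rightharpoonup> up \<ominus> lo \<rightharpoonup> cint 0) \<rightharpoonup> r)
         (ccall F_UNITS (q \<rightharpoonup> p \<rightharpoonup> ccall F_RLO (l1 \<rightharpoonup> i) \<rightharpoonup> ccall F_RHI (l2 \<rightharpoonup> i) \<rightharpoonup> r)))))))))"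
definition b_ibase :: "code \<Rightarrow> code" where
  "b_ibase x = csplit x (\<lambda>l1 its. ccase its (cint 0) (\<lambda>i its. csplit i (\<lambda>q y. csplit y (\<lambda>p y. csplit y (\<lambda>lo up.
     cif q (cint 0) lo (ccall F_RLO (l1 \<rightharpoonup> i)) \<oplus> ccall F_IBASE (l1 \<rightharpoonup> its))))))"
text \<open>The amounts of the two enclosing searches are clamped to the attainable range, as a
  search without a crossing has no specified result. The final multiplier is clamped between
  \<open>l1\<close> and \<open>l2\<close>, where the truncated integer events represent the
  responses.\<close>

definition b_lam :: "variables \<Rightarrow> code \<Rightarrow> code" where
  "b_lam K x = csplit x (\<lambda>its Z. clet (ccall F_CEV its) (\<lambda>es. clet (ccall F_SLOW its) (\<lambda>A.
     if K = Integer then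
       clet (ccall F_LEN its) (\<lambda>n.
       clet (ccall F_SEARCH (es \<rightharpoonup> A \<rightharpoonup> cint 0 \<rightharpoonup> cmax (Z \<ominus> n) A)) (\<lambda>l1.
       clet (cmax l1 (ccall F_SEARCH (es \<rightharpoonup> A \<rightharpoonup> cint 0 \<rightharpoonup> cmin (Z \<oplus> n) (ccall F_SUPP its)))) (\<lambda>l2.
       cmax l1 (cmin (ccall F_SEARCH (ccall F_IEV (l1 \<rightharpoonup> l2 \<rightharpoonup> its) \<rightharpoonup> ccall F_IBASE (l1 \<rightharpoonup> its) \<rightharpoonup> cint 0 \<rightharpoonup> Z)) l2))))
     else ccall F_SEARCH (es \<rightharpoonup> A \<rightharpoonup> cint 0 \<rightharpoonup> Z))))"
definition b_rap :: "code \<Rightarrow> code" where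
  "b_rap x = csplit x (\<lambda>its Z. clet (ccall F_LAM (its \<rightharpoonup> Z)) (\<lambda>lam.
     ccall F_FILL (lam \<rightharpoonup> its \<rightharpoonup> Z \<ominus> ccall F_SRLO (lam \<rightharpoonup> its))))"

text \<open>The four instances select the bounds of a merged block. In a left part with fixed left
  end, the solutions for the right ends \<open>a\<close> and \<open>b\<close> are lower and upper
  bound. In a right part with fixed right end it is the solution for the left end \<open>b\<close>
  that is the lower bound.\<close>

definition b_proj :: "nat \<Rightarrow> (code \<Rightarrow> code \<Rightarrow> code \<Rightarrow> code \<Rightarrow> code) \<Rightarrow> code \<Rightarrow> code" where
  "b_proj g f x = ccase x cnil (\<lambda>i its. csplit i (\<lambda>q y. csplit y (\<lambda>p y. csplit y (\<lambda>aa y. csplit y (\<lambda>ab y. csplit y (\<lambda>ba bb.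
     (q \<rightharpoonup> p \<rightharpoonup> f aa ab ba bb) \<rightharpoonup> ccall g its))))))"
definition b_zip :: "code \<Rightarrow> code" where
  "b_zip x = csplit x (\<lambda>its y. csplit y (\<lambda>x1 y. csplit y (\<lambda>x2 y. csplit y (\<lambda>x3 x4. ccase its cnil (\<lambda>i its.
     csplit i (\<lambda>q y. csplit y (\<lambda>p _.
       csplit x1 (\<lambda>h1 x1. csplit x2 (\<lambda>h2 x2. csplit x3 (\<lambda>h3 x3. csplit x4 (\<lambda>h4 x4.
         (q \<rightharpoonup> p \<rightharpoonup> h1 \<rightharpoonup> h2 \<rightharpoonup> h3 \<rightharpoonup> h4) \<rightharpoonup> ccall F_ZIP (its \<rightharpoonup> x1 \<rightharpoonup> x2 \<rightharpoonup> x3 \<rightharpoonup> x4))))))))))))"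
definition b_solve :: "code \<Rightarrow> code" where
  "b_solve x = csplit x (\<lambda>La y. csplit y (\<lambda>Lb y. csplit y (\<lambda>Ra y. csplit y (\<lambda>Rb y.
     csplit y (\<lambda>i1 y. csplit y (\<lambda>i2 y. csplit y (\<lambda>i3 i4.
       La \<rightharpoonup> Lb \<rightharpoonup> Ra \<rightharpoonup> Rb \<rightharpoonup> ccall F_ZIP (i1 \<rightharpoonup> ccall F_RAP (i1 \<rightharpoonup> Ra \<ominus> La) \<rightharpoonup> ccall F_RAP (i2 \<rightharpoonup> Rb \<ominus> La) \<rightharpoonup>
         ccall F_RAP (i3 \<rightharpoonup> Ra \<ominus> Lb) \<rightharpoonup> ccall F_RAP (i4 \<rightharpoonup> Rb \<ominus> Lb)))))))))"
definition b_merge :: "code \<Rightarrow> code" where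
  "b_merge x = csplit x (\<lambda>b1 b2.
     csplit b1 (\<lambda>La y. csplit y (\<lambda>Lb y. csplit y (\<lambda>_ y. csplit y (\<lambda>_ x1.
     csplit b2 (\<lambda>_ y. csplit y (\<lambda>_ y. csplit y (\<lambda>Ra y. csplit y (\<lambda>Rb x2.
       ccall F_SOLVE (La \<rightharpoonup> Lb \<rightharpoonup> Ra \<rightharpoonup> Rb \<rightharpoonup>
         ccall F_APP (ccall F_PLA x1 \<rightharpoonup> ccall F_PRA x2) \<rightharpoonup> ccall F_APP (ccall F_PLA x1 \<rightharpoonup> ccall F_PRB x2) \<rightharpoonup>
         ccall F_APP (ccall F_PLB x1 \<rightharpoonup> ccall F_PRA x2) \<rightharpoonup> ccall F_APP (ccall F_PLB x1 \<rightharpoonup> ccall F_PRB x2)))))))))))"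
definition b_pair :: "code \<Rightarrow> code" where
  "b_pair x = ccase x cnil (\<lambda>b1 y. ccase y x (\<lambda>b2 z. ccall F_MERGE (b1 \<rightharpoonup> b2) \<rightharpoonup> ccall F_PAIR z))"
definition b_passes :: "code \<Rightarrow> code" where
  "b_passes x = csplit x (\<lambda>b y. ccase y b (\<lambda>_ _. ccall F_PASSES (ccall F_PAIR x)))"

definition b_take :: "code \<Rightarrow> code" where
  "b_take x = csplit x (\<lambda>k xs. cif k (cint 0) cnil (csplit xs (\<lambda>h t. h \<rightharpoonup> ccall F_TAKE (k \<ominus> cint 1 \<rightharpoonup> t))))"
definition b_drop :: "code \<Rightarrow> code" where
  "b_drop x = csplit x (\<lambda>k xs. cif k (cint 0) xs (csplit xs (\<lambda>_ t. ccall F_DROP (k \<ominus> cint 1 \<rightharpoonup> t))))"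

abbreviation "cabs a \<equiv> cmax a (cint 0 \<ominus> a)"

definition b_sumabs :: "code \<Rightarrow> code" where
  "b_sumabs x = ccase x (cint 0) (\<lambda>h t. cabs h \<oplus> ccall F_SUMABS t)"
definition b_slopes :: "code \<Rightarrow> code" where
  "b_slopes x = csplit x (\<lambda>qs y. csplit y (\<lambda>ps y. csplit y (\<lambda>cs ds. ccase qs (cint 0) (\<lambda>q qs.
     csplit ps (\<lambda>p ps. csplit cs (\<lambda>c cs. csplit ds (\<lambda>d ds.
       (cabs p \<oplus> q \<otimes> (cint 2 \<otimes> cabs c \<oplus> cint 2 \<otimes> cabs d \<oplus> cint 1)) \<oplus>
         ccall F_SLOPES (qs \<rightharpoonup> ps \<rightharpoonup> cs \<rightharpoonup> ds))))))))"
definition b_expand :: "code \<Rightarrow> code" where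
  "b_expand x = csplit x (\<lambda>T y. csplit y (\<lambda>M y. csplit y (\<lambda>qs y. csplit y (\<lambda>ps y. csplit y (\<lambda>cs ds. ccase qs cnil (\<lambda>q qs.
     csplit ps (\<lambda>p ps. csplit cs (\<lambda>c cs. csplit ds (\<lambda>d ds.
       (q \<rightharpoonup> p \<rightharpoonup> c \<rightharpoonup> d) \<rightharpoonup> (cint 0 \<rightharpoonup> M \<rightharpoonup> cint 0 \<rightharpoonup> T) \<rightharpoonup> (cint 0 \<rightharpoonup> cint 0 \<ominus> M \<rightharpoonup> cint 0 \<ominus> T \<rightharpoonup> cint 0) \<rightharpoonup>
         ccall F_EXPAND (T \<rightharpoonup> M \<rightharpoonup> qs \<rightharpoonup> ps \<rightharpoonup> cs \<rightharpoonup> ds))))))))))"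
definition b_build :: "code \<Rightarrow> code" where
  "b_build x = csplit x (\<lambda>sg y. csplit y (\<lambda>as y. csplit y (\<lambda>bs y. csplit y (\<lambda>La y. csplit y (\<lambda>Lb y. csplit y (\<lambda>i its.
     ccase sg cnil (\<lambda>s sg. csplit as (\<lambda>a as. csplit bs (\<lambda>b bs.
       clet (cint 3 \<otimes> (s \<ominus> i)) (\<lambda>k. clet (ccall F_TAKE (k \<rightharpoonup> its)) (\<lambda>seg.
         ccall F_SOLVE (La \<rightharpoonup> Lb \<rightharpoonup> a \<rightharpoonup> b \<rightharpoonup> seg \<rightharpoonup> seg \<rightharpoonup> seg \<rightharpoonup> seg) \<rightharpoonup>
         ccall F_BUILD (sg \<rightharpoonup> as \<rightharpoonup> bs \<rightharpoonup> a \<rightharpoonup> b \<rightharpoonup> s \<rightharpoonup> ccall F_DROP (k \<rightharpoonup> its)))))))))))))"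
text \<open>Of every three positions only the first carries an original variable. For the whole
  problem the two bounds coincide at both ends, so the first of the four solutions can be
  taken.\<close>

definition b_out :: "code \<Rightarrow> code" where
  "b_out x = ccase x cnil (\<lambda>i x. csplit x (\<lambda>_ x. csplit x (\<lambda>_ x.
     csplit i (\<lambda>_ y. csplit y (\<lambda>_ y. csplit y (\<lambda>aa _. aa \<rightharpoonup> ccall F_OUT x))))))"
definition b_zero :: "code \<Rightarrow> code" where
  "b_zero x = ccase x cnil (\<lambda>_ t. cint 0 \<rightharpoonup> ccall F_ZERO t)"
definition b_core :: "code \<Rightarrow> code" where
  "b_core x = csplit x (\<lambda>sg y. csplit y (\<lambda>as y. csplit y (\<lambda>bs y. csplit y (\<lambda>B y. csplit y (\<lambda>cs y.
     csplit y (\<lambda>ds y. csplit y (\<lambda>qs ps.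
       clet (cint 2 \<otimes> (ccall F_SUMABS as \<oplus> ccall F_SUMABS bs \<oplus> cabs B) \<oplus> ccall F_SUMABS cs \<oplus> ccall F_SUMABS ds) (\<lambda>T.
       clet (cint 1 \<oplus> ccall F_SLOPES (qs \<rightharpoonup> ps \<rightharpoonup> cs \<rightharpoonup> ds)) (\<lambda>M.
       clet (B \<rightharpoonup> cnil) (\<lambda>Bs.
       clet (ccall F_PASSES (ccall F_BUILD (sg \<rightharpoonup> ccall F_APP (as \<rightharpoonup> Bs) \<rightharpoonup> ccall F_APP (bs \<rightharpoonup> Bs) \<rightharpoonup> cint 0 \<rightharpoonup> cint 0 \<rightharpoonup> cint 0 \<rightharpoonup>
           ccall F_EXPAND (T \<rightharpoonup> M \<rightharpoonup> qs \<rightharpoonup> ps \<rightharpoonup> cs \<rightharpoonup> ds)))) (\<lambda>r.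
       csplit r (\<lambda>_ r. csplit r (\<lambda>_ r. csplit r (\<lambda>_ r. csplit r (\<lambda>_ r. ccall F_OUT r)))))))))))))))"

text \<open>The coefficient vectors are \<open>q, p, r\<close> in the quadratic and \<open>p, r\<close> in the linear case.\<close>

definition b_main :: "code \<Rightarrow> code" where
  "b_main x = csplit x (\<lambda>_ y. csplit y (\<lambda>_ y. csplit y (\<lambda>sg y. csplit y (\<lambda>as y. csplit y (\<lambda>bs y. csplit y (\<lambda>B y.
     csplit y (\<lambda>cs y. csplit y (\<lambda>ds y. csplit y (\<lambda>v1 y. csplit y (\<lambda>v2 y.
       ccase y (ccall F_CORE (sg \<rightharpoonup> as \<rightharpoonup> bs \<rightharpoonup> B \<rightharpoonup> cs \<rightharpoonup> ds \<rightharpoonup> ccall F_ZERO v1 \<rightharpoonup> v1))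
         (\<lambda>_ _. ccall F_CORE (sg \<rightharpoonup> as \<rightharpoonup> bs \<rightharpoonup> B \<rightharpoonup> cs \<rightharpoonup> ds \<rightharpoonup> v1 \<rightharpoonup> v2))))))))))))"

definition bodies :: "variables \<Rightarrow> (code \<Rightarrow> code) list" where
  "bodies K = [b_main, b_core, b_len, b_lt, b_le, b_gt, b_jsum, b_ssum, b_min, b_max, b_meds, b_search,
     b_cev, b_slow, b_supp, b_clip, b_rlo K, b_rhi K, b_srlo, b_fill, b_units, b_iev, b_ibase, b_lam K, b_rap,
     b_proj F_PLA (\<lambda>aa ab ba bb. aa \<rightharpoonup> ab), b_proj F_PLB (\<lambda>aa ab ba bb. ba \<rightharpoonup> bb),
     b_proj F_PRA (\<lambda>aa ab ba bb. ba \<rightharpoonup> aa), b_proj F_PRB (\<lambda>aa ab ba bb. bb \<rightharpoonup> ab),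
     b_zip, b_solve, b_merge, b_pair, b_passes, b_take, b_drop, b_sumabs, b_slopes, b_expand, b_build, b_out,
     b_zero, b_app, b_step]"

definition rap_program :: "variables \<Rightarrow> program" where "rap_program K = map cproc (bodies K)"

definition rcall :: "variables \<Rightarrow> nat \<Rightarrow> val \<Rightarrow> (val \<Rightarrow> nat \<Rightarrow> bool) \<Rightarrow> bool" where
  "rcall K = wp_call (K = Integer) (rap_program K)"

abbreviation "rwp K \<equiv> wp (K = Integer) (rap_program K)"

text \<open>Continuations are simplified only when they are reached.\<close>

lemma wp_cong [cong]: "wp rnd P \<rho> c Q = wp rnd P \<rho> c Q"
  by (rule refl)

lemma rcall_cong [cong]: "u = u' \<Longrightarrow> rcall K g u Q = rcall K g u' Q"
  by simp

lemma wp_if_code [simp]: "wp rnd P \<rho> (if b then c else d) Q = (if b then wp rnd P \<rho> c Q else wp rnd P \<rho> d Q)"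
  by simp

lemma rwp_ccall [simp]: "rwp K \<rho> (ccall g e) Q = rwp K \<rho> e (\<lambda>u s. rcall K g u (\<lambda>v t. Q v (s + t + 1)))"
  unfolding rcall_def by (rule wp_ccall)

text \<open>Once the kind of variables is fixed, the simplifier evaluates \<open>K = Integer\<close>
  to a truth value and the general call rule no longer matches; this is the rule in evaluated
  form.\<close>

lemma rwp_ccall_known [simp]:
  "wp True (rap_program Integer) \<rho> (ccall g e) Q =
     wp True (rap_program Integer) \<rho> e (\<lambda>u s. rcall Integer g u (\<lambda>v t. Q v (s + t + 1)))"
  "wp False (rap_program Continuous) \<rho> (ccall g e) Q =
     wp False (rap_program Continuous) \<rho> e (\<lambda>u s. rcall Continuous g u (\<lambda>v t. Q v (s + t + 1)))"
proof -
  have e: "(Integer = Integer) = True" "(Continuous = Integer) = False" by simp_all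
  show "wp True (rap_program Integer) \<rho> (ccall g e) Q =
     wp True (rap_program Integer) \<rho> e (\<lambda>u s. rcall Integer g u (\<lambda>v t. Q v (s + t + 1)))"
    by (rule rwp_ccall[of Integer, unfolded e])
  show "wp False (rap_program Continuous) \<rho> (ccall g e) Q =
     wp False (rap_program Continuous) \<rho> e (\<lambda>u s. rcall Continuous g u (\<lambda>v t. Q v (s + t + 1)))"
    by (rule rwp_ccall[of Continuous, unfolded e])
qed

lemma rcall_unfold: "g < 44 \<Longrightarrow> rcall K g u Q = rwp K [u] ((bodies K ! g) (cvar 0)) Q"
  unfolding rcall_def rap_program_def by (rule wp_call_proc) (simp add: bodies_def)

lemma bodies_nth [simp]:
  "bodies K ! 0 = b_main" "bodies K ! Suc 0 = b_core" "bodies K ! F_LEN = b_len" "bodies K ! F_LT = b_lt" "bodies K ! F_LE = b_le"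
  "bodies K ! F_GT = b_gt" "bodies K ! F_JSUM = b_jsum" "bodies K ! F_SSUM = b_ssum" "bodies K ! F_MIN = b_min"
  "bodies K ! F_MAX = b_max" "bodies K ! F_MEDS = b_meds" "bodies K ! F_SEARCH = b_search" "bodies K ! F_CEV = b_cev"
  "bodies K ! F_SLOW = b_slow" "bodies K ! F_SUPP = b_supp" "bodies K ! F_CLIP = b_clip" "bodies K ! F_RLO = b_rlo K"
  "bodies K ! F_RHI = b_rhi K" "bodies K ! F_SRLO = b_srlo" "bodies K ! F_FILL = b_fill" "bodies K ! F_UNITS = b_units"
  "bodies K ! F_IEV = b_iev" "bodies K ! F_IBASE = b_ibase" "bodies K ! F_LAM = b_lam K" "bodies K ! F_RAP = b_rap"
  "bodies K ! F_PLA = b_proj F_PLA (\<lambda>aa ab ba bb. aa \<rightharpoonup> ab)" "bodies K ! F_PLB = b_proj F_PLB (\<lambda>aa ab ba bb. ba \<rightharpoonup> bb)"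
  "bodies K ! F_PRA = b_proj F_PRA (\<lambda>aa ab ba bb. ba \<rightharpoonup> aa)" "bodies K ! F_PRB = b_proj F_PRB (\<lambda>aa ab ba bb. bb \<rightharpoonup> ab)"
  "bodies K ! F_ZIP = b_zip" "bodies K ! F_SOLVE = b_solve" "bodies K ! F_MERGE = b_merge" "bodies K ! F_PAIR = b_pair"
  "bodies K ! F_PASSES = b_passes" "bodies K ! F_TAKE = b_take" "bodies K ! F_DROP = b_drop" "bodies K ! F_SUMABS = b_sumabs"
  "bodies K ! F_SLOPES = b_slopes" "bodies K ! F_EXPAND = b_expand" "bodies K ! F_BUILD = b_build" "bodies K ! F_OUT = b_out"
  "bodies K ! F_ZERO = b_zero" "bodies K ! F_APP = b_app" "bodies K ! F_STEP = b_step"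
  by (simp_all add: bodies_def)

lemma rcall_mono: "rcall K g u R \<Longrightarrow> (\<And>v t. R v t \<Longrightarrow> Q v t) \<Longrightarrow> rcall K g u Q"
  unfolding rcall_def by (rule wp_call_mono)

definition gives :: "variables \<Rightarrow> nat \<Rightarrow> val \<Rightarrow> val \<Rightarrow> nat \<Rightarrow> bool" where
  "gives K g u v T \<longleftrightarrow> rcall K g u (\<lambda>w t. w = v \<and> t \<le> T)"

lemma gives_call: "gives K g u v T \<Longrightarrow> (\<And>t. t \<le> T \<Longrightarrow> Q v t) \<Longrightarrow> rcall K g u Q"
  unfolding gives_def by (erule rcall_mono) simp

lemma gives_mono: "gives K g u v T \<Longrightarrow> v = v' \<Longrightarrow> T \<le> T' \<Longrightarrow> gives K g u v' T'"
  unfolding gives_def by (erule rcall_mono) simp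

lemma rcall_body:
  "bodies K ! g = b \<Longrightarrow> g < 44 \<Longrightarrow> rwp K [u] (b (cvar 0)) Q \<Longrightarrow> rcall K g u Q"
  by (subst rcall_unfold) (simp_all only:)

lemma gives_body:
  "bodies K ! g = b \<Longrightarrow> g < 44 \<Longrightarrow> rwp K [u] (b (cvar 0)) (\<lambda>w t. w = v \<and> t \<le> T) \<Longrightarrow> gives K g u v T"
  unfolding gives_def by (rule rcall_body)

subsection \<open>List functions\<close>

text \<open>Here and below the coefficients of the time bounds are round numbers above the actual
  operation counts; only linearity matters later.\<close>

lemma app_gives: "gives K F_APP (Cell (vlist f xs) (vlist f ys)) (vlist f (xs @ ys)) (20 * length xs + 20)"
proof (induction xs)
  case Nil
  show ?case by (rule gives_body, rule bodies_nth, simp, unfold b_app_def, auto)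
next
  case (Cons x xs)
  show ?case by (rule gives_body, rule bodies_nth, simp, unfold b_app_def, auto intro!: gives_call[OF Cons])
qed

lemma len_gives: "gives K F_LEN (vlist f xs) (Num (real (length xs))) (20 * length xs + 20)"
proof (induction xs)
  case Nil
  show ?case by (rule gives_body, rule bodies_nth, simp, unfold b_len_def, auto)
next
  case (Cons x xs)
  show ?case by (rule gives_body, rule bodies_nth, simp, unfold b_len_def, auto intro!: gives_call[OF Cons])
qed

lemma lt_gives: "gives K F_LT (Cell (Num v) (vlist ev_val es)) (vlist ev_val (evs_lt v es)) (30 * length es + 30)"
proof (induction es)
  case Nil
  show ?case by (rule gives_body, rule bodies_nth, simp, unfold b_lt_def, auto)
next
  case (Cons e es)
  obtain t j s where e: "e = (t, j, s)" by (cases e)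
  show ?case by (rule gives_body, rule bodies_nth, simp, unfold b_lt_def, auto simp: e intro!: gives_call[OF Cons])
qed

lemma le_gives: "gives K F_LE (Cell (Num v) (vlist ev_val es)) (vlist ev_val (evs_le v es)) (30 * length es + 30)"
proof (induction es)
  case Nil
  show ?case by (rule gives_body, rule bodies_nth, simp, unfold b_le_def, auto)
next
  case (Cons e es)
  obtain t j s where e: "e = (t, j, s)" by (cases e)
  show ?case by (rule gives_body, rule bodies_nth, simp, unfold b_le_def, auto simp: e intro!: gives_call[OF Cons])
qed

lemma gt_gives: "gives K F_GT (Cell (Num v) (vlist ev_val es)) (vlist ev_val (evs_gt v es)) (30 * length es + 30)"
proof (induction es)
  case Nil
  show ?case by (rule gives_body, rule bodies_nth, simp, unfold b_gt_def, auto)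
next
  case (Cons e es)
  obtain t j s where e: "e = (t, j, s)" by (cases e)
  show ?case by (rule gives_body, rule bodies_nth, simp, unfold b_gt_def, auto simp: e intro!: gives_call[OF Cons])
qed

lemma jsum_gives: "gives K F_JSUM (vlist ev_val es) (Num (jump_sum es)) (30 * length es + 30)"
proof (induction es)
  case Nil
  show ?case by (rule gives_body, rule bodies_nth, simp, unfold b_jsum_def, auto)
next
  case (Cons e es)
  obtain t j s where e: "e = (t, j, s)" by (cases e)
  show ?case by (rule gives_body, rule bodies_nth, simp, unfold b_jsum_def, auto simp: e intro!: gives_call[OF Cons])
qed

lemma ssum_gives: "gives K F_SSUM (vlist ev_val es) (Num (slope_sum es)) (30 * length es + 30)"
proof (induction es)
  case Nil
  show ?case by (rule gives_body, rule bodies_nth, simp, unfold b_ssum_def, auto)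
next
  case (Cons e es)
  obtain t j s where e: "e = (t, j, s)" by (cases e)
  show ?case by (rule gives_body, rule bodies_nth, simp, unfold b_ssum_def, auto simp: e intro!: gives_call[OF Cons])
qed

lemma min_gives: "gives K F_MIN (Cell (Num x) (Num y)) (Num (min x y)) 10"
  by (rule gives_body, rule bodies_nth, simp, unfold b_min_def, auto simp: min_def)

lemma max_gives: "gives K F_MAX (Cell (Num x) (Num y)) (Num (max x y)) 10"
  by (rule gives_body, rule bodies_nth, simp, unfold b_max_def, auto simp: max_def)

lemmas min_call = gives_call[OF min_gives] and max_call = gives_call[OF max_gives]

lemma meds_gives: "gives K F_MEDS (vlist ev_val es) (vlist ev_val (medians es)) (100 * length es + 30)"
proof (induction es rule: medians.induct)
  case (1 a b c d e es)
  obtain a' a1 a2 where a: "a = (a', a1, a2)" by (cases a)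
  obtain b' b1 b2 where b: "b = (b', b1, b2)" by (cases b)
  obtain c' c1 c2 where c: "c = (c', c1, c2)" by (cases c)
  obtain d' d1 d2 where d: "d = (d', d1, d2)" by (cases d)
  obtain e' e1 e2 where e: "e = (e', e1, e2)" by (cases e)
  show ?case
    by (rule gives_body, rule bodies_nth, simp, unfold b_meds_def, auto simp: a b c d e med5_def med3_def
      intro!: min_call max_call gives_call[OF 1])
qed (rule gives_body, rule bodies_nth, simp, unfold b_meds_def, auto)+

lemma slow_gives: "gives K F_SLOW (vlist it_val its) (Num (\<Sum>it\<leftarrow>its. low it)) (30 * length its + 30)"
proof (induction its)
  case (Cons it its)
  obtain q p lo up where it: "it = (q, p, lo, up)" by (cases it)
  show ?case by (rule gives_body, rule bodies_nth, simp, unfold b_slow_def, auto simp: it intro!: gives_call[OF Cons])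
qed (rule gives_body, rule bodies_nth, simp, unfold b_slow_def, auto)

lemma supp_gives: "gives K F_SUPP (vlist it_val its) (Num (\<Sum>it\<leftarrow>its. upp it)) (30 * length its + 30)"
proof (induction its)
  case (Cons it its)
  obtain q p lo up where it: "it = (q, p, lo, up)" by (cases it)
  show ?case by (rule gives_body, rule bodies_nth, simp, unfold b_supp_def, auto simp: it intro!: gives_call[OF Cons])
qed (rule gives_body, rule bodies_nth, simp, unfold b_supp_def, auto)

lemma cev_gives: "gives K F_CEV (vlist it_val its) (vlist ev_val (cont_events its)) (100 * length its + 30)"
proof (induction its)
  case (Cons it its)
  obtain q p lo up where it: "it = (q, p, lo, up)" by (cases it)
  show ?case by (rule gives_body, rule bodies_nth, simp, unfold b_cev_def, auto simp: it cont_events_def intro!: gives_call[OF Cons[unfolded cont_events_def]])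
qed (rule gives_body, rule bodies_nth, simp, unfold b_cev_def, auto simp: cont_events_def)

lemma clip_gives: "gives K F_CLIP (Cell (Num lo) (Cell (Num up) (Num y))) (Num (clip lo up y)) 50"
  by (rule gives_body, rule bodies_nth, simp, unfold b_clip_def, auto simp: clip_def intro!: min_call max_call)

lemma rlo_gives: "gives K F_RLO (Cell (Num lam) (it_val it)) (Num (item_lo K lam it)) 120"
proof -
  obtain q p lo up where it: "it = (q, p, lo, up)" by (cases it)
  show ?thesis
    by (rule gives_body, rule bodies_nth, simp, unfold b_rlo_def, auto simp: it resp_lo_def intro!: gives_call[OF clip_gives])
qed

lemma rhi_gives: "gives K F_RHI (Cell (Num lam) (it_val it)) (Num (item_hi K lam it)) 120"
proof -
  obtain q p lo up where it: "it = (q, p, lo, up)" by (cases it)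
  show ?thesis
    by (rule gives_body, rule bodies_nth, simp, unfold b_rhi_def, auto simp: it resp_hi_def intro!: gives_call[OF clip_gives])
qed

lemmas rlo_call = gives_call[OF rlo_gives] and rhi_call = gives_call[OF rhi_gives]

lemma srlo_gives:
  "gives K F_SRLO (Cell (Num lam) (vlist it_val its)) (Num (\<Sum>it\<leftarrow>its. item_lo K lam it)) (200 * length its + 30)"
proof (induction its)
  case (Cons it its)
  show ?case by (rule gives_body, rule bodies_nth, simp, unfold b_srlo_def, auto intro!: rlo_call gives_call[OF Cons])
qed (rule gives_body, rule bodies_nth, simp, unfold b_srlo_def, auto)

lemma fill_gives:
  "gives K F_FILL (Cell (Num lam) (Cell (vlist it_val its) (Num s))) (vlist Num (fill K lam its s)) (400 * length its + 30)"
proof (induction its arbitrary: s)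
  case (Cons it its)
  show ?case by (rule gives_body, rule bodies_nth, simp, unfold b_fill_def, auto simp: Let_def intro!: rlo_call rhi_call min_call gives_call[OF Cons])
qed (rule gives_body, rule bodies_nth, simp, unfold b_fill_def, auto)

lemma units_gives:
  "gives K F_UNITS (Cell (Num q) (Cell (Num p) (Cell (Num x) (Cell (Num (x + real k)) (vlist ev_val es)))))
     (vlist ev_val (unit_list q p x k @ es)) (60 * k + 60)"
proof (induction k arbitrary: x)
  case 0
  show ?case by (rule gives_body, rule bodies_nth, simp, unfold b_units_def, auto)
next
  case (Suc k)
  have "x + 1 + real k = x + real (Suc k)" by simp
  note IH = Suc[of "x + 1", unfolded this]
  show ?case
    by (rule gives_body, rule bodies_nth, simp, unfold b_units_def, auto simp: simp del: of_nat_Suc intro!: gives_call[OF IH])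
qed

lemma iev_gives:
  assumes "\<forall>it\<in>set its. item_ok Integer it" "l1 \<le> l2"
  shows "gives Integer F_IEV (Cell (Num l1) (Cell (Num l2) (vlist it_val its))) (vlist ev_val (int_events l1 l2 its))
     (400 * length its + 60 * length (int_events l1 l2 its) + 30)"
  using assms(1)
proof (induction its)
  case (Cons it its)
  obtain q p lo up where it: "it = (q, p, lo, up)" by (cases it)
  have "\<forall>it\<in>set its. item_ok Integer it" using Cons.prems by simp
  note IH = Cons.IH[OF this, unfolded int_events_def]
  have ok: "item_ok Integer it" using Cons.prems by simp
  have len: "item_hi Integer l2 it = item_lo Integer l1 it + real (length (int_item_events l1 l2 it))" if "\<not> q \<le> 0"
    using int_item_events_pl(4)[OF ok assms(2)] that by (simp add: it)
  have u: "gives Integer F_UNITS (Cell (Num q) (Cell (Num p) (Cell (Num (item_lo Integer l1 it)) (Cell (Num (item_hi Integer l2 it))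
       (vlist ev_val (int_events l1 l2 its))))))
     (vlist ev_val (int_item_events l1 l2 it @ int_events l1 l2 its)) (60 * length (int_item_events l1 l2 it) + 60)" if "\<not> q \<le> 0"
    unfolding len[OF that] using units_gives[of Integer q p "item_lo Integer l1 it" "length (int_item_events l1 l2 it)"] that
    by (simp add: it)
  show ?case
    by (rule gives_body, rule bodies_nth, simp, unfold b_iev_def, cases "q \<le> 0", auto simp: int_events_def it intro!: gives_call[OF IH] rlo_call[where it = "(q, p, lo, up)", simplified]
        rhi_call[where it = "(q, p, lo, up)", simplified] gives_call[OF u[unfolded it int_events_def, simplified]])
qed (rule gives_body, rule bodies_nth, simp, unfold b_iev_def, auto simp: int_events_def)

lemma ibase_gives:
  "gives Integer F_IBASE (Cell (Num l1) (vlist it_val its)) (Num (\<Sum>it\<leftarrow>its. int_base l1 it)) (200 * length its + 30)"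
proof (induction its)
  case (Cons it its)
  obtain q p lo up where it: "it = (q, p, lo, up)" by (cases it)
  show ?case by (rule gives_body, rule bodies_nth, simp, unfold b_ibase_def, auto simp: it intro!: gives_call[OF Cons] rlo_call[where it = "(q, p, lo, up)", simplified])
qed (rule gives_body, rule bodies_nth, simp, unfold b_ibase_def, auto)

subsection \<open>Linear-time search\<close>

lemma Suc_le_pow3: "Suc n \<le> 3 ^ n"
  by (induction n) auto

text \<open>Solves the recurrence of the median-of-medians search. The pruning leaves about seven
  tenths of the events, and together with the fifth for the pivot this is about nine tenths, so a
  linear function suffices for large \<open>n\<close>. Small \<open>n\<close>, where the integer
  parts spoil this estimate, get an exponential bound that costs only a constant.\<close>

lemma search_time:
  obtains W :: "nat \<Rightarrow> nat" and C :: nat where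
    "\<And>n n'. n' < n \<Longrightarrow> 2 * n' + 3 * (n div 5) \<le> 2 * n \<Longrightarrow> W (n div 5) + W n' + (500 * n + 500) \<le> W n"
    "500 \<le> W 0" "\<And>n. W n \<le> C * n + C"
proof
  define D where "D = 1000 * (3::nat) ^ 48"
  define W where "W n = (if n < 48 then 1000 * (3::nat) ^ n else 10 * D * n)" for n
  have D: "1000 \<le> D" by (simp add: D_def)
  have small: "W n \<le> 10 * D * n + D" for n
  proof (cases "n < 48")
    case True
    then have "(3::nat) ^ n \<le> 3 ^ 48" by (intro power_increasing) auto
    then show ?thesis using True by (simp add: W_def D_def)
  qed (simp add: W_def)
  show "500 \<le> W 0" by (simp add: W_def)
  show "W n \<le> (10 * D) * n + 10 * D" for n using small[of n] by simp
  show "W (n div 5) + W n' + (500 * n + 500) \<le> W n" if n': "n' < n" "2 * n' + 3 * (n div 5) \<le> 2 * n" for n n'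
  proof (cases "n < 48")
    case True
    obtain m where m: "n = Suc m" using n' by (cases n) auto
    \<comment> \<open>Both calls concern at most \<open>n - 1\<close> events. Of the factor 3, two
      parts pay for them and the third one for the local work.\<close>
    have "W k \<le> 1000 * 3 ^ m" if "k \<le> m" for k
      using that True m by (simp add: W_def power_increasing)
    then have "W (n div 5) \<le> 1000 * 3 ^ m" "W n' \<le> 1000 * 3 ^ m" using n' m by auto
    moreover have "500 * n + 500 \<le> 1000 * 3 ^ m" using Suc_le_pow3[of m] m by simp
    ultimately show ?thesis using True m by (simp add: W_def)
  next
    case False
    \<comment> \<open>From \<open>n' \<le> n - 3 * g / 2\<close> and
      \<open>g \<ge> (n - 4) / 5\<close>, scaled to integers.\<close>
    have "n = 5 * g + r \<Longrightarrow> r < 5 \<Longrightarrow> 2 * n' + 3 * g \<le> 2 * n \<Longrightarrow> 10 * (g + n') \<le> 9 * n + 4" for g r :: nat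
      by presburger
    from this[of "n div 5" "n mod 5"] have "10 * (n div 5 + n') \<le> 9 * n + 4" using n'(2) by simp
    then have "10 * (n div 5 + n') * D \<le> (9 * n + 4) * D" by (rule mult_le_mono1)
    moreover have "W (n div 5) + W n' \<le> 10 * (n div 5 + n') * D + 2 * D"
      using small[of "n div 5"] small[of n'] by (simp add: algebra_simps)
    moreover have "500 * n + 500 \<le> (n - 6) * D"
    proof -
      have "500 * n + 500 \<le> (n - 6) * 1000" using False by simp
      also have "\<dots> \<le> (n - 6) * D" using D by (rule mult_le_mono2)
      finally show ?thesis .
    qed
    \<comment> \<open>The account is exact: two calls including their constants \<open>D\<close>,
      and \<open>(n - 6) * D\<close> left for the local work.\<close>
    moreover have "(9 * n + 4) * D + 2 * D + (n - 6) * D = 10 * D * n"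
      using False by (simp add: algebra_simps flip: add_mult_distrib)
    moreover have "W n = 10 * D * n" using False by (simp add: W_def)
    ultimately show ?thesis by linarith
  qed
qed

lemma evs_lt_shorter: "fst e = w \<Longrightarrow> length (evs_lt w (e # es)) < length (e # es)"
  by (cases e) (auto simp: evs_lt_def le_imp_less_Suc)

lemma evs_gt_shorter: "fst e = w \<Longrightarrow> length (evs_gt w (e # es)) < length (e # es)"
  by (cases e) (auto simp: evs_gt_def le_imp_less_Suc)

lemma length_evs_le: "length (evs_lt w es) \<le> length es" "length (evs_le w es) \<le> length es" "length (evs_gt w es) \<le> length es"
  by (simp_all add: evs_lt_def evs_le_def evs_gt_def)

abbreviation search_arg :: "event list \<Rightarrow> real \<Rightarrow> real \<Rightarrow> real \<Rightarrow> val" where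
  "search_arg es A S Z \<equiv> Cell (vlist ev_val es) (Cell (Num A) (Cell (Num S) (Num Z)))"

text \<open>The recursive calls enter as a hypothesis with a common time bound \<open>T\<close>, so
  that only the linear passes around the pivot are counted here.\<close>

lemma step_gives:
  assumes IH: "\<And>es' A S. length es' \<le> n \<Longrightarrow> es' = evs_lt w es \<or> es' = evs_gt w es \<Longrightarrow> search_pre es' A S Z \<Longrightarrow>
      rcall K F_SEARCH (search_arg es' A S Z) (\<lambda>v t. \<exists>w. v = Num w \<and> crossing es' A S Z w \<and> t \<le> T)"
    and n: "length (evs_lt w es) \<le> n" "length (evs_gt w es) \<le> n" and pre: "search_pre es A S Z"
  shows "rcall K F_STEP (Cell (Num w) (search_arg es A S Z))
    (\<lambda>v t. \<exists>w. v = Num w \<and> crossing es A S Z w \<and> t \<le> T + (300 * length es + 300))"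
proof -
  note len = length_evs_le[of w es]
  show ?thesis
  proof (cases "pl_left es A S w \<le> Z")
    case False
    note sl = search_left[OF pre, of w]
    show ?thesis
      apply (rule rcall_body, rule bodies_nth, simp, unfold b_step_def, simp)
      apply (rule gives_call[OF lt_gives], simp)
      apply (rule gives_call[OF jsum_gives], simp)
      apply (rule gives_call[OF ssum_gives], simp)
      using False sl n len
      apply (simp add: pl_left_def)
      apply (rule rcall_mono[OF IH])
      apply auto
      done
  next
    case True
    show ?thesis
    proof (cases "Z \<le> pl_right es A S w")
      case True': True
      show ?thesis
        apply (rule rcall_body, rule bodies_nth, simp, unfold b_step_def, simp)
        apply (rule gives_call[OF lt_gives], simp)
        apply (rule gives_call[OF jsum_gives], simp)
        apply (rule gives_call[OF ssum_gives], simp)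
        using True True' len
        apply (simp add: pl_left_def)
        apply (rule gives_call[OF le_gives], simp)
        apply (rule gives_call[OF jsum_gives], simp)
        apply (rule gives_call[OF ssum_gives], simp)
        apply (simp add: pl_right_def crossing_def pl_left_def)
        done
    next
      case False
      note sr = search_right[OF pre, of w]
      show ?thesis
        apply (rule rcall_body, rule bodies_nth, simp, unfold b_step_def, simp)
        apply (rule gives_call[OF lt_gives], simp)
        apply (rule gives_call[OF jsum_gives], simp)
        apply (rule gives_call[OF ssum_gives], simp)
        using True False len n sr
        apply (simp add: pl_left_def)
        apply (rule gives_call[OF le_gives], simp)
        apply (rule gives_call[OF jsum_gives], simp)
        apply (rule gives_call[OF ssum_gives], simp)
        apply (simp add: pl_right_def)
        apply (rule gives_call[OF gt_gives], simp)
        apply (rule rcall_mono[OF IH])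
        apply auto
        done
    qed
  qed
qed

definition search_ok :: "variables \<Rightarrow> nat \<Rightarrow> bool" where
  "search_ok K C \<longleftrightarrow> (\<forall>es A S Z. search_pre es A S Z \<longrightarrow>
     rcall K F_SEARCH (search_arg es A S Z) (\<lambda>v t. \<exists>w. v = Num w \<and> crossing es A S Z w \<and> t \<le> C * length es + C))"

lemma search_linear: "\<exists>C. search_ok K C"
proof -
  obtain W :: "nat \<Rightarrow> nat" and C :: nat where
    W: "\<And>n n'. n' < n \<Longrightarrow> 2 * n' + 3 * (n div 5) \<le> 2 * n \<Longrightarrow> W (n div 5) + W n' + (500 * n + 500) \<le> W n"
    and W0: "500 \<le> W 0" and WC: "\<And>n. W n \<le> C * n + C"
    using search_time by blast
  have main: "rcall K F_SEARCH (search_arg es A S Z) (\<lambda>v t. \<exists>w. v = Num w \<and> crossing es A S Z w \<and> t \<le> W (length es))"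
    if "search_pre es A S Z" for es A S Z
    using that
  proof (induction "length es" arbitrary: es A S Z rule: less_induct)
    case less
    show ?case
    proof (cases es)
      case Nil
      then show ?thesis using search_Nil[of A S Z] less.prems W0
        by (intro rcall_body[OF bodies_nth(12)]) (simp, unfold b_search_def, auto)
    next
      case (Cons e es')
      obtain t j s where e: "e = (t, j, s)" by (cases e)
      define n where "n = length es"
      have npos: "0 < n" using Cons by (simp add: n_def)
      \<comment> \<open>What remains of \<open>W n\<close>, namely
        \<open>W (n div 5) + 200 * n + 200\<close>, pays for finding the pivot.\<close>
      have step: "rcall K F_STEP (Cell (Num w) (search_arg es A S Z))
          (\<lambda>v t. \<exists>w. v = Num w \<and> crossing es A S Z w \<and> t + W (n div 5) + 200 * n + 200 \<le> W n)"
        if w: "length (evs_lt w es) < n" "length (evs_gt w es) < n"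
          "2 * length (evs_lt w es) + 3 * (n div 5) \<le> 2 * n" "2 * length (evs_gt w es) + 3 * (n div 5) \<le> 2 * n" for w
      proof -
        define m where "m = max (length (evs_lt w es)) (length (evs_gt w es))"
        define T where "T = max (W (length (evs_lt w es))) (W (length (evs_gt w es)))"
        have T: "T + W (n div 5) + (500 * n + 500) \<le> W n"
          using W[OF w(1,3)] W[OF w(2,4)] by (auto simp: T_def max_def)
        have "rcall K F_STEP (Cell (Num w) (search_arg es A S Z))
          (\<lambda>v t. \<exists>w. v = Num w \<and> crossing es A S Z w \<and> t \<le> T + (300 * length es + 300))"
        proof (rule step_gives[OF _ _ _ less.prems, where n = m])
          fix es' A S assume es': "es' = evs_lt w es \<or> es' = evs_gt w es" and pre: "search_pre es' A S Z"
          have "length es' < length es" using es' w by (auto simp: n_def)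
          from less.hyps[OF this pre]
          show "rcall K F_SEARCH (search_arg es' A S Z) (\<lambda>v t. \<exists>w. v = Num w \<and> crossing es' A S Z w \<and> t \<le> T)"
            using es' by (elim rcall_mono) (auto simp: T_def)
        qed (auto simp: m_def)
        then show ?thesis using T by (elim rcall_mono) (auto simp: n_def)
      qed
      show ?thesis
      proof (cases "medians es")
        case Nil
        \<comment> \<open>Without groups the pruning inequality is trivial; progress comes from the
          pivot being the position of an event, which both strict filters remove.\<close>
        then have n5: "n div 5 = 0" using length_medians[of es] by (simp add: n_def)
        have l: "length (evs_lt t es) < n" "length (evs_gt t es) < n"
          using evs_lt_shorter[of e t es'] evs_gt_shorter[of e t es'] unfolding Cons n_def by (auto simp: e)
        have "rcall K F_STEP (Cell (Num t) (search_arg es A S Z))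
          (\<lambda>v t. \<exists>w. v = Num w \<and> crossing es A S Z w \<and> t + W (n div 5) + 200 * n + 200 \<le> W n)"
          using l n5 by (intro step) auto
        note st = this[unfolded Cons e]
        note ms = meds_gives[of K es, unfolded Cons e] Nil[unfolded Cons e]
        show ?thesis
          unfolding Cons e
          apply (rule rcall_body, rule bodies_nth, simp, unfold b_search_def, simp)
          apply (rule gives_call[OF ms(1)[unfolded vlist.simps ev_val.simps]], simp add: ms(2))
          apply (rule rcall_mono[OF st[unfolded vlist.simps ev_val.simps]])
          apply (auto simp: n_def Cons)
          done
      next
        case (Cons m ms)
        have lenm: "length (medians es) = n div 5" using length_medians[of es] by (simp add: n_def)
        have n5: "0 < n div 5" using lenm Cons by simp
        have "length (medians es) < length es" using npos unfolding lenm by (simp add: n_def)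
        \<comment> \<open>The same induction hypothesis serves for the pivot, because the list of
          medians is shorter and is itself an input of the search.\<close>
        note piv = less.hyps[OF this search_pre_unit[OF unit_medians[of es]], unfolded lenm]
        have st: "rcall K F_STEP (Cell (Num w) (search_arg es A S Z))
          (\<lambda>v t. \<exists>w. v = Num w \<and> crossing es A S Z w \<and> t + W (n div 5) + 200 * n + 200 \<le> W n)"
          if "crossing (medians es) 0 0 (real (n div 5) / 2) w" for w
        proof -
          note pp = pivot_prunes[of es w, folded n_def, OF that]
          have "x < n" if "2 * x + 3 * (n div 5) \<le> 2 * n" for x
          proof -
            have "0 < g \<Longrightarrow> 2 * x + 3 * g \<le> 2 * n \<Longrightarrow> x < n" for g :: nat by simp
            then show ?thesis using n5 that by blast
          qed
          then show ?thesis using pp by (intro step)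
        qed
        have lenm': "length (medians es) \<le> n" using lenm by simp
        have M: "vlist ev_val (medians es) = Cell (ev_val m) (vlist ev_val ms)" using Cons by simp
        have E: "vlist ev_val es = Cell (ev_val e) (vlist ev_val es')" using \<open>es = e # es'\<close> by simp
        show ?thesis
          apply (rule rcall_body, rule bodies_nth, simp, unfold b_search_def)
          apply (simp add: E)
          apply (rule gives_call[OF meds_gives[of K es, unfolded E M]])
          apply simp
          apply (rule gives_call[OF len_gives[of K ev_val "medians es", unfolded M lenm]])
          apply simp
          apply (rule rcall_mono[OF piv[unfolded M]])
          apply (elim exE conjE)
          apply simp
          apply (rule rcall_mono[OF st[unfolded E]], assumption)
          using lenm' apply (auto simp: n_def)
          done
      qed
    qed
  qed
  have "rcall K F_SEARCH (search_arg es A S Z) (\<lambda>v t. \<exists>w. v = Num w \<and> crossing es A S Z w \<and> t \<le> C * length es + C)"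
    if "search_pre es A S Z" for es A S Z
    by (rule rcall_mono[OF main[OF that]]) (use WC[of "length es"] in auto)
  then have "search_ok K C" unfolding search_ok_def by simp
  then show ?thesis ..
qed

section \<open>Linear time for problems with a single constraint\<close>

lemma search_okD:
  assumes "search_ok K C" "search_pre es A S Z" "length es \<le> N"
  shows "rcall K F_SEARCH (search_arg es A S Z) (\<lambda>v t. \<exists>w. v = Num w \<and> crossing es A S Z w \<and> t \<le> C * N + C)"
proof -
  have "C * length es \<le> C * N" using assms(3) by (rule mult_le_mono2)
  moreover have "rcall K F_SEARCH (search_arg es A S Z) (\<lambda>v t. \<exists>w. v = Num w \<and> crossing es A S Z w \<and> t \<le> C * length es + C)"
    using assms unfolding search_ok_def by blast
  ultimately show ?thesis by (elim rcall_mono) (use add_le_mono1 order_trans in blast)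
qed

text \<open>Integer variables need three searches, two continuous and one integer, each on at most
  \<open>4 * n\<close> events. The same bound is used for the single search of the continuous
  case.\<close>

definition lam_time :: "nat \<Rightarrow> nat \<Rightarrow> nat" where
  "lam_time C n = 3 * (C * (4 * n) + C) + 1500 * n + 800"

lemma lam_linear:
  assumes s: "search_ok K C" and ok: "\<forall>it\<in>set its. item_ok K it"
    and Z: "(\<Sum>it\<leftarrow>its. low it) \<le> Z" "Z \<le> (\<Sum>it\<leftarrow>its. upp it)"
  shows "rcall K F_LAM (Cell (vlist it_val its) (Num Z))
    (\<lambda>v t. \<exists>lam. v = Num lam \<and> (\<Sum>it\<leftarrow>its. item_lo K lam it) \<le> Z \<and> Z \<le> (\<Sum>it\<leftarrow>its. item_hi K lam it) \<and>
       t \<le> lam_time C (length its))"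
proof (cases K)
  case Continuous
  note S = search_okD[OF s search_pre_cont[OF ok Z], of "4 * length its", unfolded Continuous]
  note pl = cont_events_pl[OF ok]
  show ?thesis unfolding Continuous
    apply (rule rcall_body, rule bodies_nth, simp, unfold b_lam_def, simp)
    apply (rule gives_call[OF cev_gives], simp)
    apply (rule gives_call[OF slow_gives], simp)
    apply (rule rcall_mono[OF S])
    using length_cont_events[of its] apply simp
    apply (auto simp: crossing_def pl lam_time_def)
    done
next
  case Integer
  note ok = ok[unfolded Integer] and s = s[unfolded Integer]
  define n where "n = length its"
  define D where "D = C * (4 * n) + C"
  define A where "A = (\<Sum>it\<leftarrow>its. low it)"
  define B where "B = (\<Sum>it\<leftarrow>its. upp it)"
  define base where "base l1 = (\<Sum>it\<leftarrow>its. int_base l1 it)" for l1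
  have Z': "A \<le> Z" "Z \<le> B" using Z by (auto simp: A_def B_def)
  have S: "rcall Integer F_SEARCH (search_arg (cont_events its) A 0 z)
     (\<lambda>v t. \<exists>w. v = Num w \<and> crossing (cont_events its) A 0 z w \<and> t \<le> D)" if "A \<le> z" "z \<le> B" for z
    unfolding A_def D_def
    by (rule search_okD[OF s search_pre_cont[OF ok]]) (use that length_cont_events[of its] in \<open>auto simp: A_def B_def n_def\<close>)
  have z12: "A \<le> max (Z - real n) A" "max (Z - real n) A \<le> B" "A \<le> min (Z + real n) B" "min (Z + real n) B \<le> B"
    using Z' by auto
  note I = int_search[OF ok Z, folded A_def B_def n_def, folded base_def]
  have ie: "gives Integer F_IEV (Cell (Num l1) (Cell (Num l2) (vlist it_val its))) (vlist ev_val (int_events l1 l2 its)) (700 * n + 30)"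
    if "l1 \<le> l2" "length (int_events l1 l2 its) \<le> 4 * n" for l1 l2
    by (rule gives_mono[OF iev_gives[OF ok that(1)]]) (use that(2) in \<open>simp_all add: n_def\<close>)
  have S2: "rcall Integer F_SEARCH (search_arg (int_events l1 l2 its) (base l1) 0 Z)
     (\<lambda>v t. \<exists>w. v = Num w \<and> crossing (int_events l1 l2 its) (base l1) 0 Z w \<and> t \<le> D)"
    if "search_pre (int_events l1 l2 its) (base l1) 0 Z" "length (int_events l1 l2 its) \<le> 4 * n" for l1 l2
    unfolding D_def using search_okD[OF s that] .
  have goal: "rcall Integer F_LAM (Cell (vlist it_val its) (Num Z))
    (\<lambda>v t. \<exists>lam. v = Num lam \<and> (\<Sum>it\<leftarrow>its. item_lo Integer lam it) \<le> Z \<and> Z \<le> (\<Sum>it\<leftarrow>its. item_hi Integer lam it) \<and>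
       t \<le> 3 * D + 1500 * n + 800)"
    apply (rule rcall_body, rule bodies_nth, simp, unfold b_lam_def, simp)
    apply (rule gives_call[OF cev_gives], simp)
    apply (rule gives_call[OF slow_gives[where its = its, folded A_def]], simp)
    apply (rule gives_call[OF len_gives[of _ it_val its, folded n_def]], simp)
    apply (rule max_call, simp)
    apply (rule rcall_mono[OF S[OF z12(1,2)]])
    apply (elim exE conjE, simp)
    subgoal for t1 t2 t3 t4 v5 t5 l1
    apply (rule gives_call[OF supp_gives[where its = its, folded B_def]], simp)
    apply (rule min_call, simp)
    apply (rule rcall_mono[OF S[OF z12(3,4)]])
    apply (elim exE conjE, simp)
    subgoal for t6 t7 v8 t8 l2
    apply (rule max_call, simp)
    apply (rule gives_call[OF ie[OF _ I(1)]], simp, assumption, assumption, simp)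
    apply (rule gives_call[OF ibase_gives[where its = its, folded base_def]], simp)
    apply (rule rcall_mono[OF S2[OF I(2) I(1)]], assumption, assumption, assumption, assumption)
    apply (elim exE conjE, simp)
    apply (rule min_call, simp)
    apply (rule max_call, simp)
    subgoal for t9 t10 t11 v12 t12 l3 t13 t14
      using I(3)[of l1 l2 l3] by (simp add: n_def)
    done
    done
    done
  show ?thesis using goal unfolding Integer lam_time_def D_def n_def .
qed

lemma rap_gives:
  fixes a b :: "nat \<Rightarrow> real"
  assumes s: "search_ok K C" and q: "quad_costs q"
    and bd: "\<And>i. i \<in> {l..<r} \<Longrightarrow> lo i \<le> up i \<and> lo i \<in> range_of K \<and> up i \<in> range_of K"
    and Z: "sum lo {l..<r} \<le> Z" "Z \<le> sum up {l..<r}" "Z \<in> range_of K" and lr: "l \<le> r"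
  shows "rcall K F_RAP (Cell (vlist it_val (quad_costs.items q p lo up l r)) (Num Z))
    (\<lambda>v t. \<exists>x. v = vlist Num (map x [l..<r]) \<and> quad_costs.canonical K q p {} a b lo up l r L (L + Z) x \<and>
       t \<le> lam_time C (r - l) + 700 * (r - l) + 200)"
proof -
  interpret quad_costs K q p by (rule q)
  define its where "its = items lo up l r"
  have len: "length its = r - l" by (simp add: items_def its_def)
  have ok: "\<forall>it\<in>set its. item_ok K it" using bd q_nonneg by (auto simp: items_def its_def)
  have "(\<Sum>it\<leftarrow>its. low it) = sum lo {l..<r}" "(\<Sum>it\<leftarrow>its. upp it) = sum up {l..<r}"
    by (simp_all add: its_def items_def comp_def sum_list_interval)
  note L = lam_linear[OF s ok, unfolded this len, OF Z(1,2)]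
  note F = fill_canonical[of l r lo up, OF _ _ _ Z(3) lr, folded its_def]
  show ?thesis unfolding its_def[symmetric]
    apply (rule rcall_body, rule bodies_nth, simp, unfold b_rap_def, simp)
    apply (rule rcall_mono[OF L])
    apply (elim exE conjE, simp)
    apply (rule gives_call[OF srlo_gives], simp)
    apply (rule gives_call[OF fill_gives], simp add: len)
    subgoal for v t lam t2 t3
      apply (rule exI[of _ "\<lambda>i. fill K lam its (Z - (\<Sum>it\<leftarrow>its. item_lo K lam it)) ! (i - l)"])
      using F[where lam = lam] bd by simp
    done
qed

subsection \<open>Blocks\<close>

lemma zip_gives:
  "gives K F_ZIP (Cell (vlist it_val (map (\<lambda>i. (q i, p i, lo i, up i)) js)) (Cell (vlist Num (map x1 js)) (Cell (vlist Num (map x2 js))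
      (Cell (vlist Num (map x3 js)) (vlist Num (map x4 js))))))
     (vlist qi_val (map (\<lambda>i. (q i, p i, x1 i, x2 i, x3 i, x4 i)) js)) (100 * length js + 30)"
proof (induction js)
  case (Cons i js)
  show ?case by (rule gives_body, rule bodies_nth, simp, unfold b_zip_def, auto intro!: gives_call[OF Cons])
qed (rule gives_body, rule bodies_nth, simp, unfold b_zip_def, auto)

lemma proj_gives:
  "gives K F_PLA (vlist qi_val (map (\<lambda>i. (q i, p i, x1 i, x2 i, x3 i, x4 i)) js))
     (vlist it_val (map (\<lambda>i. (q i, p i, x1 i, x2 i)) js)) (100 * length js + 30)"
  "gives K F_PLB (vlist qi_val (map (\<lambda>i. (q i, p i, x1 i, x2 i, x3 i, x4 i)) js))
     (vlist it_val (map (\<lambda>i. (q i, p i, x3 i, x4 i)) js)) (100 * length js + 30)"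
  "gives K F_PRA (vlist qi_val (map (\<lambda>i. (q i, p i, x1 i, x2 i, x3 i, x4 i)) js))
     (vlist it_val (map (\<lambda>i. (q i, p i, x3 i, x1 i)) js)) (100 * length js + 30)"
  "gives K F_PRB (vlist qi_val (map (\<lambda>i. (q i, p i, x1 i, x2 i, x3 i, x4 i)) js))
     (vlist it_val (map (\<lambda>i. (q i, p i, x4 i, x2 i)) js)) (100 * length js + 30)"
proof -
  show "gives K F_PLA (vlist qi_val (map (\<lambda>i. (q i, p i, x1 i, x2 i, x3 i, x4 i)) js))
     (vlist it_val (map (\<lambda>i. (q i, p i, x1 i, x2 i)) js)) (100 * length js + 30)"
  proof (induction js)
    case (Cons i js)
    show ?case by (rule gives_body, rule bodies_nth, simp, unfold b_proj_def, auto intro!: gives_call[OF Cons])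
  qed (rule gives_body, rule bodies_nth, simp, unfold b_proj_def, auto)
  show "gives K F_PLB (vlist qi_val (map (\<lambda>i. (q i, p i, x1 i, x2 i, x3 i, x4 i)) js))
     (vlist it_val (map (\<lambda>i. (q i, p i, x3 i, x4 i)) js)) (100 * length js + 30)"
  proof (induction js)
    case (Cons i js)
    show ?case by (rule gives_body, rule bodies_nth, simp, unfold b_proj_def, auto intro!: gives_call[OF Cons])
  qed (rule gives_body, rule bodies_nth, simp, unfold b_proj_def, auto)
  show "gives K F_PRA (vlist qi_val (map (\<lambda>i. (q i, p i, x1 i, x2 i, x3 i, x4 i)) js))
     (vlist it_val (map (\<lambda>i. (q i, p i, x3 i, x1 i)) js)) (100 * length js + 30)"
  proof (induction js)
    case (Cons i js)
    show ?case by (rule gives_body, rule bodies_nth, simp, unfold b_proj_def, auto intro!: gives_call[OF Cons])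
  qed (rule gives_body, rule bodies_nth, simp, unfold b_proj_def, auto)
  show "gives K F_PRB (vlist qi_val (map (\<lambda>i. (q i, p i, x1 i, x2 i, x3 i, x4 i)) js))
     (vlist it_val (map (\<lambda>i. (q i, p i, x4 i, x2 i)) js)) (100 * length js + 30)"
  proof (induction js)
    case (Cons i js)
    show ?case by (rule gives_body, rule bodies_nth, simp, unfold b_proj_def, auto intro!: gives_call[OF Cons])
  qed (rule gives_body, rule bodies_nth, simp, unfold b_proj_def, auto)
qed

locale nested_blocks = quad_costs K q p for K q p +
  fixes E :: "nat set" and a b c d :: "nat \<Rightarrow> real" and C :: nat
  assumes search: "search_ok K C"
    and nest_le: "k \<in> E \<Longrightarrow> a k \<le> b k"
    and nest_range: "k \<in> E \<Longrightarrow> a k \<in> range_of K \<and> b k \<in> range_of K"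
    and box_range: "c i \<in> range_of K" "d i \<in> range_of K"
begin

text \<open>The box problem with bounds \<open>lo\<close> and \<open>up\<close> may replace the
  nested problem: it is attainable for the amount \<open>R - L\<close>, and solving it solves the
  nested one.\<close>

definition reduces_to :: "nat \<Rightarrow> nat \<Rightarrow> real \<Rightarrow> real \<Rightarrow> (nat \<Rightarrow> real) \<Rightarrow> (nat \<Rightarrow> real) \<Rightarrow> bool" where
  "reduces_to l r L R lo up \<longleftrightarrow>
     (\<forall>i\<in>{l..<r}. lo i \<le> up i \<and> lo i \<in> range_of K \<and> up i \<in> range_of K) \<and>
     sum lo {l..<r} \<le> R - L \<and> R - L \<le> sum up {l..<r} \<and>
     (\<forall>x. canonical {} a b lo up l r L R x \<longrightarrow> canonical E a b c d l r L R x)"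

definition solved :: "nat \<Rightarrow> nat \<Rightarrow> (nat \<Rightarrow> real) \<Rightarrow> (nat \<Rightarrow> real) \<Rightarrow> (nat \<Rightarrow> real) \<Rightarrow> (nat \<Rightarrow> real) \<Rightarrow> bool" where
  "solved l r x1 x2 x3 x4 \<longleftrightarrow>
     canonical E a b c d l r (a l) (a r) x1 \<and> canonical E a b c d l r (a l) (b r) x2 \<and>
     canonical E a b c d l r (b l) (a r) x3 \<and> canonical E a b c d l r (b l) (b r) x4"

definition block_val :: "nat \<Rightarrow> nat \<Rightarrow> (nat \<Rightarrow> real) \<Rightarrow> (nat \<Rightarrow> real) \<Rightarrow> (nat \<Rightarrow> real) \<Rightarrow> (nat \<Rightarrow> real) \<Rightarrow> val" where
  "block_val l r x1 x2 x3 x4 = Cell (Num (a l)) (Cell (Num (b l)) (Cell (Num (a r)) (Cell (Num (b r))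
     (vlist qi_val (map (\<lambda>i. (q i, p i, x1 i, x2 i, x3 i, x4 i)) [l..<r])))))"

definition is_block :: "nat \<Rightarrow> nat \<Rightarrow> val \<Rightarrow> bool" where
  "is_block l r v \<longleftrightarrow> (\<exists>x1 x2 x3 x4. solved l r x1 x2 x3 x4 \<and> v = block_val l r x1 x2 x3 x4)"

text \<open>The sum of all coefficients of \<open>lam_time C n + 700 * n + 200\<close>; since blocks
  are nonempty, the constant terms are absorbed into the linear ones.\<close>

definition rap_rate :: nat where "rap_rate = 15 * C + 3200"

lemma rap_reduces:
  assumes red: "reduces_to l r L R lo up" and lr: "l < r" and LR: "L \<in> range_of K" "R \<in> range_of K"
  shows "rcall K F_RAP (Cell (vlist it_val (map (\<lambda>i. (q i, p i, lo i, up i)) [l..<r])) (Num (R - L)))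
    (\<lambda>v t. \<exists>x. v = vlist Num (map x [l..<r]) \<and> canonical E a b c d l r L R x \<and> t \<le> rap_rate * (r - l))"
proof -
  obtain k where k: "r - l = Suc k" using lr by (metis Suc_pred zero_less_diff)
  have t: "lam_time C (r - l) + 700 * (r - l) + 200 \<le> rap_rate * (r - l)"
    unfolding k lam_time_def rap_rate_def by (simp add: algebra_simps)
  have "rcall K F_RAP (Cell (vlist it_val (items lo up l r)) (Num (R - L)))
    (\<lambda>v t. \<exists>x. v = vlist Num (map x [l..<r]) \<and> canonical {} a b lo up l r L (L + (R - L)) x \<and>
       t \<le> lam_time C (r - l) + 700 * (r - l) + 200)"
    using red LR lr unfolding reduces_to_def
    by (intro rap_gives[OF search quad_costs_axioms]) (auto intro: range_of_closed)
  then show ?thesis unfolding items_def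
  proof (rule rcall_mono)
    fix v t assume "\<exists>x. v = vlist Num (map x [l..<r]) \<and> canonical {} a b lo up l r L (L + (R - L)) x \<and>
       t \<le> lam_time C (r - l) + 700 * (r - l) + 200"
    then obtain x where x: "v = vlist Num (map x [l..<r])" "canonical {} a b lo up l r L R x"
      "t \<le> lam_time C (r - l) + 700 * (r - l) + 200" by auto
    have "canonical E a b c d l r L R x" using red x(2) unfolding reduces_to_def by blast
    then show "\<exists>x. v = vlist Num (map x [l..<r]) \<and> canonical E a b c d l r L R x \<and> t \<le> rap_rate * (r - l)"
      using x t by (intro exI[of _ x]) simp
  qed
qed

definition solve_rate :: nat where "solve_rate = 4 * rap_rate + 400"

abbreviation its_val :: "nat \<Rightarrow> nat \<Rightarrow> (nat \<Rightarrow> real) \<Rightarrow> (nat \<Rightarrow> real) \<Rightarrow> val" where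
  "its_val l r lo up \<equiv> vlist it_val (map (\<lambda>i. (q i, p i, lo i, up i)) [l..<r])"

lemma solve_block:
  assumes lr: "l < r" "l \<in> E" "r \<in> E"
    and 1: "reduces_to l r (a l) (a r) lo1 up1" and 2: "reduces_to l r (a l) (b r) lo2 up2"
    and 3: "reduces_to l r (b l) (a r) lo3 up3" and 4: "reduces_to l r (b l) (b r) lo4 up4"
  shows "rcall K F_SOLVE (Cell (Num (a l)) (Cell (Num (b l)) (Cell (Num (a r)) (Cell (Num (b r))
      (Cell (its_val l r lo1 up1) (Cell (its_val l r lo2 up2) (Cell (its_val l r lo3 up3) (its_val l r lo4 up4))))))))
    (\<lambda>v t. is_block l r v \<and> t \<le> solve_rate * (r - l))"
proof -
  have R: "a l \<in> range_of K" "b l \<in> range_of K" "a r \<in> range_of K" "b r \<in> range_of K"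
    using nest_range lr by auto
  note z = zip_gives[where js = "[l..<r]"]
  define w where "w = rap_rate * (r - l)"
  have w: "solve_rate * (r - l) = 4 * w + 400 * (r - l)" by (simp add: solve_rate_def w_def add_mult_distrib)
  show ?thesis
    apply (rule rcall_body, rule bodies_nth, simp, unfold b_solve_def, simp)
    apply (rule rcall_mono[OF rap_reduces[OF 1 lr(1) R(1,3), folded w_def]], elim exE conjE, simp)
    apply (rule rcall_mono[OF rap_reduces[OF 2 lr(1) R(1,4), folded w_def]], elim exE conjE, simp)
    apply (rule rcall_mono[OF rap_reduces[OF 3 lr(1) R(2,3), folded w_def]], elim exE conjE, simp)
    apply (rule rcall_mono[OF rap_reduces[OF 4 lr(1) R(2,4), folded w_def]], elim exE conjE, simp)
    apply (rule gives_call[OF z], simp)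
    subgoal for v1 t1 x1 v2 t2 x2 v3 t3 x3 v4 t4 x4 t
      unfolding is_block_def solved_def block_val_def w
      using lr(1) by (intro conjI exI[of _ x1] exI[of _ x2] exI[of _ x3] exI[of _ x4]) auto
    done
qed

lemma reduces_merge:
  assumes lur: "l < u" "u < r" "u \<in> E" and L: "L \<in> range_of K"
    and xa: "canonical E a b c d l u L (a u) xa" and xb: "canonical E a b c d l u L (b u) xb"
    and za: "canonical E a b c d u r (a u) R za" and zb: "canonical E a b c d u r (b u) R zb"
  shows "reduces_to l r L R (\<lambda>i. if i < u then xa i else zb i) (\<lambda>i. if i < u then xb i else za i)"
proof -
  note m = canonical_merge_boxes[OF lur(1,2,3) nest_le xa xb za zb box_range nest_range L refl refl]
  have "xa i \<in> range_of K" "xb i \<in> range_of K" if "i \<in> {l..<u}" for i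
    using xa xb that by (auto simp: canonical_def block_point_def)
  moreover have "za i \<in> range_of K" "zb i \<in> range_of K" if "i \<in> {u..<r}" for i
    using za zb that by (auto simp: canonical_def block_point_def)
  ultimately show ?thesis unfolding reduces_to_def using m by auto
qed

lemma its_val_append:
  assumes "l \<le> u" "u \<le> r"
  shows "its_val l r (\<lambda>i. if i < u then lo i else lo' i) (\<lambda>i. if i < u then up i else up' i)
    = vlist it_val (map (\<lambda>i. (q i, p i, lo i, up i)) [l..<u] @ map (\<lambda>i. (q i, p i, lo' i, up' i)) [u..<r])"
proof -
  have "[l..<r] = [l..<u] @ [u..<r]" using assms by (metis le_iff_add upt_add_eq_append)
  moreover have "map (\<lambda>i. (q i, p i, if i < u then lo i else lo' i, if i < u then up i else up' i)) [l..<u]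
      = map (\<lambda>i. (q i, p i, lo i, up i)) [l..<u]" by (intro map_cong) auto
  moreover have "map (\<lambda>i. (q i, p i, if i < u then lo i else lo' i, if i < u then up i else up' i)) [u..<r]
      = map (\<lambda>i. (q i, p i, lo' i, up' i)) [u..<r]" by (intro map_cong) auto
  ultimately show ?thesis by (simp only: map_append)
qed

definition merge_rate :: nat where "merge_rate = solve_rate + 1400"

lemma merge_block:
  assumes v: "is_block l u v" and w: "is_block u r w" and lur: "l < u" "u < r" and E: "l \<in> E" "u \<in> E" "r \<in> E"
  shows "rcall K F_MERGE (Cell v w) (\<lambda>z t. is_block l r z \<and> t \<le> merge_rate * (r - l))"
proof -
  obtain x1 x2 x3 x4 where x: "canonical E a b c d l u (a l) (a u) x1" "canonical E a b c d l u (a l) (b u) x2"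
     "canonical E a b c d l u (b l) (a u) x3" "canonical E a b c d l u (b l) (b u) x4" and v: "v = block_val l u x1 x2 x3 x4"
    using v unfolding is_block_def solved_def by blast
  obtain z1 z2 z3 z4 where z: "canonical E a b c d u r (a u) (a r) z1" "canonical E a b c d u r (a u) (b r) z2"
     "canonical E a b c d u r (b u) (a r) z3" "canonical E a b c d u r (b u) (b r) z4" and w: "w = block_val u r z1 z2 z3 z4"
    using w unfolding is_block_def solved_def by blast
  note ab = nest_range[OF E(1)]
  note red = reduces_merge[OF lur E(2) conjunct1[OF ab]] reduces_merge[OF lur E(2) conjunct2[OF ab]]
  note S = solve_block[OF less_trans[OF lur] E(1,3) red(1)[OF x(1,2) z(1,3)] red(1)[OF x(1,2) z(2,4)]
      red(2)[OF x(3,4) z(1,3)] red(2)[OF x(3,4) z(2,4)],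
      unfolded its_val_append[OF less_imp_le[OF lur(1)] less_imp_le[OF lur(2)]]]
  define n where "n = solve_rate * (r - l)"
  define m1 m2 where "m1 = u - l" and "m2 = r - u"
  have m: "r - l = m1 + m2" "0 < m1" using lur by (auto simp: m1_def m2_def)
  have n: "merge_rate * (r - l) = n + 1400 * (r - l)" by (simp add: merge_rate_def n_def add_mult_distrib)
  show ?thesis unfolding v w block_val_def n
    apply (rule rcall_body, rule bodies_nth, simp, unfold b_merge_def, simp)
    apply (rule gives_call[OF proj_gives(1)], simp)
    apply (rule gives_call[OF proj_gives(3)], simp)
    apply (rule gives_call[OF app_gives], simp)
    apply (rule gives_call[OF proj_gives(1)], simp)
    apply (rule gives_call[OF proj_gives(4)], simp)
    apply (rule gives_call[OF app_gives], simp)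
    apply (rule gives_call[OF proj_gives(2)], simp)
    apply (rule gives_call[OF proj_gives(3)], simp)
    apply (rule gives_call[OF app_gives], simp)
    apply (rule gives_call[OF proj_gives(2)], simp)
    apply (rule gives_call[OF proj_gives(4)], simp)
    apply (rule gives_call[OF app_gives], simp)
    apply (rule rcall_mono[OF S[folded n_def]])
    using m(2) unfolding m(1) m1_def[symmetric] m2_def[symmetric] apply auto
    done
qed

section \<open>Passes over the list of blocks\<close>

fun blocks :: "nat list \<Rightarrow> val list \<Rightarrow> bool" where
  "blocks (k # l # ks) (v # vs) \<longleftrightarrow> k < l \<and> k \<in> E \<and> l \<in> E \<and> is_block k l v \<and> blocks (l # ks) vs"
| "blocks [k] [] \<longleftrightarrow> True"
| "blocks _ _ \<longleftrightarrow> False"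

lemma blocks_le: "blocks ks vs \<Longrightarrow> hd ks \<le> last ks"
  by (induction ks vs rule: blocks.induct) auto

lemma blocks_ConsE:
  assumes "blocks ks (v # vs)"
  obtains k l ks' where "ks = k # l # ks'" "k < l" "k \<in> E" "l \<in> E" "is_block k l v" "blocks (l # ks') vs"
  using assms by (cases "(ks, v # vs)" rule: blocks.cases) auto

lemma blocks_NilE:
  assumes "blocks ks []" obtains k where "ks = [k]"
  using assms by (cases "(ks, [] :: val list)" rule: blocks.cases) auto

definition pass_rate :: nat where "pass_rate = merge_rate + 100"

text \<open>The time for a merge is proportional to the length of the merged block and these lengths
  add up, so a pass is linear in the total length. The 100 by which \<open>pass_rate\<close> exceeds
  \<open>merge_rate\<close> covers the list handling, as each merged pair is nonempty.\<close>

lemma pair_blocks: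
  assumes "blocks ks vs"
  shows "rcall K F_PAIR (vlist (\<lambda>x. x) vs) (\<lambda>v t. \<exists>ks' vs'. v = vlist (\<lambda>x. x) vs' \<and> blocks ks' vs' \<and> hd ks' = hd ks \<and>
    last ks' = last ks \<and> length vs' = (length vs + 1) div 2 \<and> t \<le> pass_rate * (last ks - hd ks) + 30)"
  using assms
proof (induction vs arbitrary: ks rule: induct_list012)
  case 1
  then show ?case
    apply (intro rcall_body[OF bodies_nth(33)])
     apply simp
    apply (unfold b_pair_def, simp)
    apply (intro exI[of _ ks] conjI exI[of _ "[]"], simp_all)
    done
next
  case (2 v)
  then show ?case
    by (intro rcall_body[OF bodies_nth(33)]) (simp, unfold b_pair_def, auto intro!: exI[of _ ks] exI[of _ "[v]"])
next
  case (3 v w vs)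
  obtain k l ks1 where 1: "ks = k # l # ks1" "k < l" "k \<in> E" "l \<in> E" "is_block k l v" "blocks (l # ks1) (w # vs)"
    using 3(3) by (rule blocks_ConsE)
  obtain m ks2 where 2: "ks1 = m # ks2" "l < m" "m \<in> E" "is_block l m w" "blocks (m # ks2) vs"
    using 1(6) by (rule blocks_ConsE) simp
  note ks = 1(1)[unfolded 2(1)]
  have "hd (m # ks2) \<le> last (m # ks2)" using 2(5) by (rule blocks_le)
  then have le: "m \<le> last ks" by (simp add: ks)
  define A where "A = merge_rate * (m - k)"
  define B where "B = pass_rate * (last ks - m)"
  note M = merge_block[OF 1(5) 2(4) 1(2) 2(2) 1(3,4) 2(3), folded A_def]
  have hl: "hd (m # ks2) = m" "last (m # ks2) = last ks" by (simp_all add: ks)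
  have "rcall K F_PAIR (vlist (\<lambda>x. x) vs) (\<lambda>v t. \<exists>ks' vs'. v = vlist (\<lambda>x. x) vs' \<and> blocks ks' vs' \<and> hd ks' = m \<and>
    last ks' = last ks \<and> length vs' = (length vs + 1) div 2 \<and> t \<le> B + 30)"
    using 3(1)[OF 2(5)] unfolding hl B_def .
  note IH = this
  have "last ks - hd ks = (m - k) + (last ks - m)" "1 \<le> m - k" using 1(2) 2(2) le by (simp_all add: ks)
  note ld = this
  have "merge_rate * x + pass_rate * y + 100 \<le> pass_rate * (x + y)" if "1 \<le> x" for x y
    using that by (simp add: pass_rate_def add_mult_distrib2 add_mult_distrib)
  from this[OF ld(2)] have T: "A + B + 100 \<le> pass_rate * (last ks - hd ks)"
    unfolding A_def B_def ld(1) .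
  have bl: "blocks (k # ks') (z # vs')" "last (k # ks') = last ks"
    if "is_block k m z" "blocks ks' vs'" "hd ks' = m" "last ks' = last ks" for z ks' vs'
    using that 1 2 by (cases "(ks', vs')" rule: blocks.cases; auto)+
  show ?case
    apply (rule rcall_body[OF bodies_nth(33)], simp, unfold b_pair_def, simp)
    apply (rule rcall_mono[OF M], elim exE conjE)
    apply simp
    apply (rule rcall_mono[OF IH], elim exE conjE)
    subgoal for z t1 u t2 ks' vs'
      using bl[of z ks' vs'] T
      by (intro exI[of _ "k # ks'"] exI[of _ "z # vs'"]) (auto simp: ks)
    done
qed

text \<open>A pass halves the number of blocks, rounded up, which preserves a bound by powers of
  two; so \<open>e\<close> passes are enough.\<close>

lemma passes_blocks:
  assumes "blocks ks vs" "vs \<noteq> []" "length vs \<le> 2 ^ e"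
  shows "rcall K F_PASSES (vlist (\<lambda>x. x) vs)
    (\<lambda>v t. is_block (hd ks) (last ks) v \<and> t \<le> (pass_rate * (last ks - hd ks) + 60) * e + 20)"
  using assms
proof (induction e arbitrary: ks vs)
  case 0
  then obtain v where v: "vs = [v]" by (cases vs) auto
  have "is_block (hd ks) (last ks) v" using 0(1) unfolding v by (auto elim!: blocks_ConsE blocks_NilE)
  then show ?case unfolding v
    by (intro rcall_body[OF bodies_nth(34)]) (simp, unfold b_passes_def, auto)
next
  case (Suc e)
  show ?case
  proof (cases "length vs = 1")
    case True
    then obtain v where v: "vs = [v]" by (cases vs) auto
    have "is_block (hd ks) (last ks) v" using Suc.prems(1) unfolding v by (auto elim!: blocks_ConsE blocks_NilE)
    then show ?thesis unfolding v
      by (intro rcall_body[OF bodies_nth(34)]) (simp, unfold b_passes_def, auto)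
  next
    case False
    then obtain v w ws where v: "vs = v # w # ws" using Suc.prems(2) by (cases vs; cases "tl vs") auto
    define A where "A = pass_rate * (last ks - hd ks)"
    have len: "(length vs + 1) div 2 \<le> 2 ^ e" "(length vs + 1) div 2 \<noteq> 0" using Suc.prems(3) v by auto
    have IH: "rcall K F_PASSES (vlist (\<lambda>x. x) vs') (\<lambda>v t. is_block (hd ks) (last ks) v \<and> t \<le> (A + 60) * e + 20)"
      if "blocks ks' vs'" "hd ks' = hd ks" "last ks' = last ks" "length vs' = (length vs + 1) div 2" for ks' vs'
    proof -
      have "vs' \<noteq> []" "length vs' \<le> 2 ^ e" using that(4) len by auto
      then show ?thesis using Suc.IH[OF that(1)] unfolding that(2,3) A_def by blast
    qed
    note P = pair_blocks[OF Suc.prems(1), folded A_def, unfolded v vlist.simps]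
    show ?thesis unfolding A_def[symmetric] v vlist.simps
      apply (rule rcall_body[OF bodies_nth(34)], simp, unfold b_passes_def, simp)
      apply (rule rcall_mono[OF P], elim exE conjE, simp)
      apply (rule rcall_mono[OF IH], assumption, assumption, assumption)
       apply (simp add: v)
      apply simp
      done
  qed
qed

end

subsection \<open>Reading the input\<close>

lemma take_gives:
  "k \<le> length xs \<Longrightarrow> gives K F_TAKE (Cell (Num (real k)) (vlist f xs)) (vlist f (take k xs)) (40 * k + 30)"
proof (induction k arbitrary: xs)
  case 0
  show ?case by (rule gives_body, rule bodies_nth, simp, unfold b_take_def, auto)
next
  case (Suc k)
  obtain x ys where xs: "xs = x # ys" "k \<le> length ys" using Suc.prems by (cases xs) auto
  show ?case unfolding xs(1) by (rule gives_body, rule bodies_nth, simp, unfold b_take_def, auto intro!: gives_call[OF Suc.IH[OF xs(2)]])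
qed

lemma drop_gives:
  "k \<le> length xs \<Longrightarrow> gives K F_DROP (Cell (Num (real k)) (vlist f xs)) (vlist f (drop k xs)) (40 * k + 30)"
proof (induction k arbitrary: xs)
  case 0
  show ?case by (rule gives_body, rule bodies_nth, simp, unfold b_drop_def, auto)
next
  case (Suc k)
  obtain x ys where xs: "xs = x # ys" "k \<le> length ys" using Suc.prems by (cases xs) auto
  show ?case unfolding xs(1) by (rule gives_body, rule bodies_nth, simp, unfold b_drop_def, auto intro!: gives_call[OF Suc.IH[OF xs(2)]])
qed

lemma max_minus: "max x (- x) = \<bar>x :: real\<bar>"
  by linarith

lemma sumabs_gives: "gives K F_SUMABS (vlist Num xs) (Num (\<Sum>x\<leftarrow>xs. \<bar>x\<bar>)) (50 * length xs + 30)"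
proof (induction xs)
  case (Cons x xs)
  show ?case by (rule gives_body, rule bodies_nth, simp, unfold b_sumabs_def, auto simp: max_minus intro!: max_call gives_call[OF Cons])
qed (rule gives_body, rule bodies_nth, simp, unfold b_sumabs_def, auto)

lemma slopes_gives:
  "gives K F_SLOPES (Cell (vlist Num (map q js)) (Cell (vlist Num (map p js)) (Cell (vlist Num (map c js)) (vlist Num (map d js)))))
     (Num (\<Sum>i\<leftarrow>js. \<bar>p i\<bar> + q i * (2 * \<bar>c i\<bar> + 2 * \<bar>d i\<bar> + 1))) (200 * length js + 30)"
proof (induction js)
  case (Cons i js)
  show ?case by (rule gives_body, rule bodies_nth, simp, unfold b_slopes_def, auto simp: max_minus intro!: max_call gives_call[OF Cons])
qed (rule gives_body, rule bodies_nth, simp, unfold b_slopes_def, auto)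

definition with_slack :: "real \<Rightarrow> real \<Rightarrow> (nat \<Rightarrow> item) \<Rightarrow> nat \<Rightarrow> item list" where
  "with_slack T M f i = [f i, (0, M, 0, T), (0, - M, - T, 0)]"

lemma expand_gives:
  "gives K F_EXPAND (Cell (Num T) (Cell (Num M) (Cell (vlist Num (map q js)) (Cell (vlist Num (map p js))
      (Cell (vlist Num (map c js)) (vlist Num (map d js)))))))
     (vlist it_val (concat (map (with_slack T M (\<lambda>i. (q i, p i, c i, d i))) js))) (200 * length js + 30)"
proof (induction js)
  case (Cons i js)
  show ?case by (rule gives_body, rule bodies_nth, simp, unfold b_expand_def with_slack_def[abs_def], auto intro!: gives_call[OF Cons[unfolded with_slack_def[abs_def]]])
qed (rule gives_body, rule bodies_nth, simp, unfold b_expand_def, auto)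

lemma zero_gives: "gives K F_ZERO (vlist f xs) (vlist Num (map (\<lambda>_. 0) xs)) (30 * length xs + 30)"
proof (induction xs)
  case (Cons x xs)
  show ?case by (rule gives_body, rule bodies_nth, simp, unfold b_zero_def, auto intro!: gives_call[OF Cons])
qed (rule gives_body, rule bodies_nth, simp, unfold b_zero_def, auto)

lemma upt_3: "i \<le> n \<Longrightarrow> [3 * i..<3 * Suc n] = [3 * i..<3 * n] @ [3 * n, 3 * n + 1, 3 * n + 2]"
  by (simp add: numeral_eq_Suc)

lemma concat_with_slack:
  "concat (map (with_slack T M f) [i..<n]) =
     map (\<lambda>k. if k mod 3 = 0 then f (k div 3) else if k mod 3 = 1 then (0, M, 0, T) else (0, - M, - T, 0)) [3 * i..<3 * n]"
proof (cases "i \<le> n")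
  case True
  then show ?thesis
  proof (induction n rule: dec_induct)
    case (step n)
    have "(3 * n + 1) mod 3 = 1" "(3 * n + 2) mod 3 = 2" by presburger+
    then show ?case using step unfolding upt_3[OF step(1)] by (simp add: with_slack_def)
  qed simp
qed simp

context nested_blocks
begin

text \<open>A segment between neighbouring constraints. The two conditions on sums cover the extreme
  demands \<open>a r - b l\<close> and \<open>b r - a l\<close>, so that all four combinations of
  end amounts are attainable.\<close>

definition leaf :: "nat \<Rightarrow> nat \<Rightarrow> bool" where
  "leaf l r \<longleftrightarrow> l < r \<and> l \<in> E \<and> r \<in> E \<and> E \<inter> {l<..<r} = {} \<and> (\<forall>i\<in>{l..<r}. c i \<le> d i) \<and>
     sum c {l..<r} \<le> a r - b l \<and> b r - a l \<le> sum d {l..<r}"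

lemma leaf_reduces:
  assumes "leaf l r" "L = a l \<or> L = b l" "R = a r \<or> R = b r"
  shows "reduces_to l r L R c d"
proof -
  have lr: "l \<in> E" "r \<in> E" "E \<inter> {l<..<r} = {}" using assms(1) by (auto simp: leaf_def)
  have "a l \<le> b l" "a r \<le> b r" using lr nest_le by auto
  then have s: "sum c {l..<r} \<le> R - L" "R - L \<le> sum d {l..<r}"
    using assms unfolding leaf_def by auto
  have "movable {} a b l L x i j" for x i j by (simp add: movable_def)
  then have "canonical E a b c d l r L R x" if "canonical {} a b c d l r L R x" for x
    using that lr(3) unfolding canonical_def block_point_def by auto
  then show ?thesis unfolding reduces_to_def
    using s box_range assms(1) by (auto simp: leaf_def)
qed

fun leaves :: "nat \<Rightarrow> nat list \<Rightarrow> bool" where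
  "leaves i [] \<longleftrightarrow> True"
| "leaves i (s # sg) \<longleftrightarrow> leaf (3 * i) (3 * s) \<and> leaves s sg"

lemma leaves_le: "leaves i sg \<Longrightarrow> i \<le> last (i # sg)"
proof (induction sg arbitrary: i)
  case (Cons s sg)
  then have "i < s" "s \<le> last (s # sg)" by (auto simp: leaf_def simp del: last.simps)
  then show ?case by (simp only: last_ConsR[OF list.distinct(2)])
qed simp

definition build_rate :: nat where "build_rate = solve_rate + 300"

lemma build_blocks:
  assumes "leaves i sg" "last (i # sg) = n"
  shows "rcall K F_BUILD (Cell (vlist Num (map real sg)) (Cell (vlist Num (map (\<lambda>s. a (3 * s)) sg)) (Cell (vlist Num (map (\<lambda>s. b (3 * s)) sg))
      (Cell (Num (a (3 * i))) (Cell (Num (b (3 * i))) (Cell (Num (real i)) (its_val (3 * i) (3 * n) c d)))))))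
    (\<lambda>v t. \<exists>vs. v = vlist (\<lambda>x. x) vs \<and> blocks (map ((*) 3) (i # sg)) vs \<and> length vs = length sg \<and>
       t \<le> build_rate * (3 * n - 3 * i) + 30)"
  using assms
proof (induction sg arbitrary: i)
  case Nil
  show ?case
    apply (rule rcall_body[OF bodies_nth(40)], simp, unfold b_build_def, simp)
    done
next
  case (Cons s sg)
  have lf: "leaf (3 * i) (3 * s)" and ls: "leaves s sg" "last (s # sg) = n" using Cons.prems by auto
  have E: "3 * i < 3 * s" "3 * i \<in> E" "3 * s \<in> E" using lf by (auto simp: leaf_def)
  have sn: "s \<le> n" using leaves_le[OF ls(1)] ls(2) by simp
  define k where "k = 3 * s - 3 * i"
  have k: "3 * real s - 3 * real i = real k" "k \<le> 3 * n - 3 * i" "0 < k" "3 * i + k = 3 * s" using E sn by (auto simp: k_def of_nat_diff)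
  define f where "f = (\<lambda>i. (q i, p i, c i, d i))"
  have len: "k \<le> length (map f [3 * i..<3 * n])" using k by simp
  have td: "take k (map f [3 * i..<3 * n]) = map f [3 * i..<3 * s]" "drop k (map f [3 * i..<3 * n]) = map f [3 * s..<3 * n]"
    using k E sn by (auto simp: take_map drop_map)
  note td' = take_gives[OF len, of K it_val, unfolded td] drop_gives[OF len, of K it_val, unfolded td]
  define A where "A = solve_rate * k"
  define B where "B = build_rate * (3 * n - 3 * s)"
  have nk: "3 * n - 3 * i = k + (3 * n - 3 * s)" using E sn by (simp add: k_def)
  have T: "build_rate * (3 * n - 3 * i) = A + 300 * k + B"
    unfolding nk A_def B_def build_rate_def by (simp add: add_mult_distrib2 add_mult_distrib)
  have red: "reduces_to (3 * i) (3 * s) L R c d" if "L = a (3 * i) \<or> L = b (3 * i)" "R = a (3 * s) \<or> R = b (3 * s)" for L R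
    using leaf_reduces[OF lf that] .
  have S: "rcall K F_SOLVE (Cell (Num (a (3 * i))) (Cell (Num (b (3 * i))) (Cell (Num (a (3 * s))) (Cell (Num (b (3 * s)))
      (Cell (vlist it_val (map f [3 * i..<3 * s])) (Cell (vlist it_val (map f [3 * i..<3 * s])) (Cell (vlist it_val (map f [3 * i..<3 * s])) (vlist it_val (map f [3 * i..<3 * s])))))))))
    (\<lambda>v t. is_block (3 * i) (3 * s) v \<and> t \<le> A)"
    unfolding A_def k_def f_def
    using solve_block[OF E red red red red] by simp
  note IH = Cons.IH[OF ls, folded B_def f_def]
  show ?case
    unfolding T f_def[symmetric]
    apply (rule rcall_body[OF bodies_nth(40)], simp, unfold b_build_def, simp add: k(1))
    apply (rule gives_call[OF td'(1)], simp)
    apply (rule rcall_mono[OF S], elim conjE, simp add: k(1))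
    apply (rule gives_call[OF td'(2)], simp)
    apply (rule rcall_mono[OF IH], elim exE conjE, simp)
    subgoal for t1 w t2 t3 v t4 vs
      using E k(3) by (intro exI[of _ "w # vs"]) simp
    done
qed

end

lemma concat_triples: "concat (map (\<lambda>i. [3 * i, 3 * i + 1, 3 * i + 2]) [i..<n]) = [3 * i..<3 * n]"
proof (cases "i \<le> n")
  case True
  then show ?thesis
  proof (induction n rule: dec_induct)
    case (step n)
    then show ?case unfolding upt_3[OF step(1)] by simp
  qed simp
qed simp

lemma out_gives:
  "gives K F_OUT (vlist qi_val (map (\<lambda>i. (q i, p i, x1 i, x2 i, x3 i, x4 i)) [0..<3 * n]))
     (vlist Num (map (\<lambda>i. x1 (3 * i)) [0..<n])) (60 * n + 30)"
proof -
  have "gives K F_OUT (vlist qi_val (map (\<lambda>i. (q i, p i, x1 i, x2 i, x3 i, x4 i)) (concat (map (\<lambda>i. [3 * i, 3 * i + 1, 3 * i + 2]) js))))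
     (vlist Num (map (\<lambda>i. x1 (3 * i)) js)) (60 * length js + 30)" for js
  proof (induction js)
    case (Cons i js)
    show ?case by (rule gives_body, rule bodies_nth, simp, unfold b_out_def, auto intro!: gives_call[OF Cons[simplified]])
  qed (rule gives_body, rule bodies_nth, simp, unfold b_out_def, auto)
  from this[of "[0..<n]"] show ?thesis using concat_triples[of 0 n] by simp
qed

section \<open>Slack variables\<close>

text \<open>Every variable gets two slack variables, for raising and for lowering its value at a
  prohibitive price, so that all blocks are feasible.  The position of the variable \<open>i\<close> becomes \<open>3 i\<close>.\<close>

definition triple :: "(nat \<Rightarrow> 'a) \<Rightarrow> 'a \<Rightarrow> 'a \<Rightarrow> nat \<Rightarrow> 'a" where
  "triple f u v k = (if k mod 3 = 0 then f (k div 3) else if k mod 3 = 1 then u else v)"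

lemma triple_simps [simp]:
  "triple f u v (3 * i) = f i" "triple f u v (Suc (3 * i)) = u" "triple f u v (Suc (Suc (3 * i))) = v"
proof -
  have "Suc (3 * i) mod 3 = 1" "Suc (Suc (3 * i)) mod 3 = 2" by presburger+
  then show "triple f u v (3 * i) = f i" "triple f u v (Suc (3 * i)) = u" "triple f u v (Suc (Suc (3 * i))) = v"
    by (simp_all add: triple_def)
qed

lemma triple_cases:
  fixes k :: nat
  obtains i where "k = 3 * i" | i where "k = Suc (3 * i)" | i where "k = Suc (Suc (3 * i))"
proof -
  have "k = 3 * (k div 3) \<or> k = Suc (3 * (k div 3)) \<or> k = Suc (Suc (3 * (k div 3)))" by presburger
  then show ?thesis using that by blast
qed

lemma sum_triple:
  assumes "i \<le> n"
  shows "sum (triple f u v) {3 * i..<3 * n} = sum f {i..<n} + real (n - i) * (u + v)"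
  using assms
proof (induction n rule: dec_induct)
  case (step n)
  have "3 * Suc n = Suc (Suc (Suc (3 * n)))" by simp
  then have "sum (triple f u v) {3 * i..<3 * Suc n} = sum (triple f u v) {3 * i..<3 * n} + f n + u + v"
    using step by (simp del: mult_Suc_right)
  moreover have "Suc n - i = Suc (n - i)" using step by simp
  ultimately show ?case using step by (simp add: algebra_simps)
qed simp

text \<open>Extended by zero slacks, \<open>x0\<close> is canonical for the extended problem, so
  uniqueness gives the claim. A raising slack at 0 can only receive, at the price \<open>M\<close>,
  and a lowering one can only give, which saves \<open>- M\<close>. As \<open>M\<close> exceeds the
  absolute values of all marginals, such exchanges lose strictly and no tie arises.\<close>

theorem slack_unused:
  assumes q: "quad_costs q0"
    and x0: "quad_costs.canonical K q0 p0 E0 a0 b0 c0 d0 0 n 0 R x0"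
    and x: "quad_costs.canonical K (triple q0 0 0) (triple p0 M (- M)) ((*) 3 ` E0) (\<lambda>k. a0 (k div 3)) (\<lambda>k. b0 (k div 3))
      (triple c0 0 (- T)) (triple d0 T 0) 0 (3 * n) 0 R x"
    and T: "0 \<le> T" and M: "\<And>i. i < n \<Longrightarrow> \<bar>p0 i\<bar> + q0 i * (2 * \<bar>c0 i\<bar> + 2 * \<bar>d0 i\<bar> + 1) < M" "0 < M"
    and i: "i < n"
  shows "x (3 * i) = x0 i"
proof -
  interpret quad_costs K q0 p0 by (rule q)
  have q': "quad_costs (triple q0 0 0)"
  proof
    show "0 \<le> triple q0 0 0 k" for k using q_nonneg by (simp add: triple_def)
  qed
  interpret s: quad_costs K "triple q0 0 0" "triple p0 M (- M)" by (rule q')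
  define y where "y = triple x0 0 0"
  have pt: "block_point E0 a0 b0 c0 d0 0 n 0 R x0" using x0 by (simp add: canonical_def)
  have ys: "sum y {0..<3 * k} = sum x0 {0..<k}" for k
    using sum_triple[of 0 k x0 0 0] by (simp add: y_def)
  have zK: "0 \<in> range_of K" by (cases K) auto
  have pty: "s.block_point ((*) 3 ` E0) (\<lambda>k. a0 (k div 3)) (\<lambda>k. b0 (k div 3)) (triple c0 0 (- T)) (triple d0 T 0) 0 (3 * n) 0 R y"
    unfolding s.block_point_def
  proof (intro conjI ballI)
    fix k assume k: "k \<in> {0..<3 * n}"
    show "y k \<in> range_of K" "triple c0 0 (- T) k \<le> y k" "y k \<le> triple d0 T 0 k"
      using k pt T zK unfolding y_def block_point_def by (cases k rule: triple_cases; auto)+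
  next
    fix k assume "k \<in> (*) 3 ` E0 \<inter> {0<..<3 * n}"
    then obtain e where e: "k = 3 * e" "e \<in> E0 \<inter> {0<..<n}" by auto
    show "a0 (k div 3) \<le> 0 + sum y {0..<k}" "0 + sum y {0..<k} \<le> b0 (k div 3)"
      using pt e(2) unfolding e(1) ys block_point_def by auto
  next
    show "0 + sum y {0..<3 * n} = R" using pt unfolding ys block_point_def by simp
  qed
  \<comment> \<open>The values of \<open>x0\<close> lie between \<open>c0\<close> and
    \<open>d0\<close>, so their marginals are bounded in terms of the data; the summand 1 covers the
    unit steps of the integer case.\<close>
  have up: "marg_up K (q0 i) (p0 i) (x0 i) < M" "- M < marg_up K (q0 i) (p0 i) (x0 i)"
    "marg_dn K (q0 i) (p0 i) (x0 i) < M" if "i < n" for i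
  proof -
    have "c0 i \<le> x0 i" "x0 i \<le> d0 i" using pt that by (auto simp: block_point_def)
    then have b: "\<bar>2 * x0 i + h\<bar> \<le> 2 * \<bar>c0 i\<bar> + 2 * \<bar>d0 i\<bar> + 1" if "\<bar>h\<bar> \<le> 1" for h using that by linarith
    have m: "\<bar>q0 i * (2 * x0 i + h) + p0 i\<bar> < M" if "\<bar>h\<bar> \<le> 1" for h
    proof -
      have "\<bar>q0 i * (2 * x0 i + h)\<bar> \<le> q0 i * (2 * \<bar>c0 i\<bar> + 2 * \<bar>d0 i\<bar> + 1)"
        using mult_left_mono[OF b[OF that] q_nonneg[of i]] q_nonneg[of i] by (simp add: abs_mult)
      then show ?thesis using M(1)[OF \<open>i < n\<close>] by linarith
    qed
    have "\<bar>marg_up K (q0 i) (p0 i) (x0 i)\<bar> < M"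
      unfolding marg_up_def by (intro m) auto
    moreover have "\<bar>marg_dn K (q0 i) (p0 i) (x0 i)\<bar> < M"
      using m[of "- (if K = Integer then 1 else 0)"] unfolding marg_dn_def by simp
    ultimately show "marg_up K (q0 i) (p0 i) (x0 i) < M" "- M < marg_up K (q0 i) (p0 i) (x0 i)"
      "marg_dn K (q0 i) (p0 i) (x0 i) < M" by linarith+
  qed
  have ng: "s.no_gain y k l"
    if kl: "k < 3 * n" "l < 3 * n" "k \<noteq> l" "triple c0 0 (- T) k < y k" "y l < triple d0 T 0 l"
      and mv: "s.movable ((*) 3 ` E0) (\<lambda>k. a0 (k div 3)) (\<lambda>k. b0 (k div 3)) 0 0 y k l" for k l
  proof (cases k rule: triple_cases)
    case (1 i)
    show ?thesis
    proof (cases l rule: triple_cases)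
      case l: (1 j)
      have "movable E0 a0 b0 0 0 x0 i j"
        unfolding movable_def
      proof (intro ballI conjI impI)
        fix e assume e: "e \<in> E0"
        then have m: "3 * e \<in> (*) 3 ` E0" by simp
        show "a0 e < 0 + sum x0 {0..<e}" if "i < e \<and> e \<le> j"
          using mv that m unfolding s.movable_def 1 l ys[symmetric] by fastforce
        show "0 + sum x0 {0..<e} < b0 e" if "j < e \<and> e \<le> i"
          using mv that m unfolding s.movable_def 1 l ys[symmetric] by fastforce
      qed
      then have "no_gain x0 i j" using x0 kl unfolding canonical_def 1 l y_def by auto
      then show ?thesis unfolding no_gain_def s.no_gain_def 1 l y_def by simp
    next
      case l: (2 j)
      then show ?thesis using up(3)[of i] kl unfolding s.no_gain_def 1 l y_def
        by (simp add: marg_up_def)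
    next
      case l: (3 j)
      then show ?thesis using kl unfolding y_def by simp
    qed
  next
    case (2 i)
    then show ?thesis using kl unfolding y_def by simp
  next
    case (3 i)
    show ?thesis
    proof (cases l rule: triple_cases)
      case l: (1 j)
      then show ?thesis using up(2)[of j] kl unfolding s.no_gain_def 3 l y_def by (simp add: marg_dn_def)
    next
      case l: (2 j)
      then show ?thesis using M(2) unfolding s.no_gain_def 3 l y_def
        by (simp add: marg_dn_def marg_up_def)
    next
      case l: (3 j)
      then show ?thesis using kl unfolding y_def by simp
    qed
  qed
  have "s.canonical ((*) 3 ` E0) (\<lambda>k. a0 (k div 3)) (\<lambda>k. b0 (k div 3)) (triple c0 0 (- T)) (triple d0 T 0) 0 (3 * n) 0 R y"
    unfolding s.canonical_def using pty ng by auto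
  from s.canonical_unique[OF x this, of "3 * i"] show ?thesis using i by (simp add: y_def)
qed

subsection \<open>The whole program\<close>

lemma sum_list_abs_ge: "x \<in> set xs \<Longrightarrow> \<bar>f x\<bar> \<le> (\<Sum>x\<leftarrow>xs. \<bar>f x\<bar> :: real)"
  by (rule member_le_sum_list) auto

lemma sum_segment_abs:
  assumes "s \<le> n"
  shows "\<bar>sum f {i..<s}\<bar> \<le> (\<Sum>i\<leftarrow>[0..<n]. \<bar>f i\<bar> :: real)"
proof -
  have "\<bar>sum f {i..<s}\<bar> \<le> (\<Sum>i\<in>{i..<s}. \<bar>f i\<bar>)" by (rule sum_abs)
  also have "\<dots> \<le> (\<Sum>i\<in>{0..<n}. \<bar>f i\<bar>)" using assms by (intro sum_mono2) auto
  finally show ?thesis by (simp add: interv_sum_list_conv_sum_set_nat)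
qed

lemma abs_in_range: "x \<in> range_of K \<Longrightarrow> \<bar>x\<bar> \<in> range_of K"
  by (cases K) auto

lemma expanded_items:
  "concat (map (with_slack T M (\<lambda>i. (q0 i, p0 i, c0 i, d0 i))) [0..<n]) =
     map (\<lambda>k. (triple q0 0 0 k, triple p0 M (- M) k, triple c0 0 (- T) k, triple d0 T 0 k)) [3 * 0..<3 * n]"
  unfolding concat_with_slack by (intro map_cong refl) (simp add: triple_def)

definition core_time :: "nat \<Rightarrow> nat \<Rightarrow> nat \<Rightarrow> nat" where
  "core_time C n e = nested_blocks.build_rate C * (3 * n) + 1500 * n + 700 + (nested_blocks.pass_rate C * (3 * n) + 60) * e"

abbreviation core_arg :: "val \<Rightarrow> val \<Rightarrow> val \<Rightarrow> real \<Rightarrow> val \<Rightarrow> val \<Rightarrow> val \<Rightarrow> val \<Rightarrow> val" where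
  "core_arg sg as bs R cs ds qs ps \<equiv>
     Cell sg (Cell as (Cell bs (Cell (Num R) (Cell cs (Cell ds (Cell qs ps))))))"

theorem core_solves:
  fixes q0 p0 a0 b0 c0 d0 x0 :: "nat \<Rightarrow> real" and sg :: "nat list"
  assumes search: "search_ok K C" and q: "quad_costs q0"
    and sorted: "sorted_wrt (<) (0 # sg)" and ne: "sg \<noteq> []" and last: "last sg = n"
    and ends: "a0 0 = 0" "b0 0 = 0" "a0 n = R" "b0 n = R"
    and ab: "\<And>k. k \<in> set sg \<Longrightarrow> a0 k \<le> b0 k" "\<And>k. a0 k \<in> range_of K" "\<And>k. b0 k \<in> range_of K"
    and cd: "\<And>i. c0 i \<in> range_of K" "\<And>i. d0 i \<in> range_of K"
    and x0: "quad_costs.canonical K q0 p0 (set (0 # sg)) a0 b0 c0 d0 0 n 0 R x0"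
    and e: "length sg \<le> 2 ^ e"
  shows "rcall K F_CORE (core_arg (vlist Num (map real sg)) (vlist Num (map a0 (butlast sg))) (vlist Num (map b0 (butlast sg))) R
      (vlist Num (map c0 [0..<n])) (vlist Num (map d0 [0..<n])) (vlist Num (map q0 [0..<n])) (vlist Num (map p0 [0..<n])))
    (\<lambda>v t. v = vlist Num (map x0 [0..<n]) \<and> t \<le> core_time C n e)"
proof -
  define W where "W = (\<Sum>x\<leftarrow>map a0 (butlast sg). \<bar>x\<bar>) + (\<Sum>x\<leftarrow>map b0 (butlast sg). \<bar>x\<bar>) + \<bar>R\<bar>"
  define Sc where "Sc = (\<Sum>x\<leftarrow>map c0 [0..<n]. \<bar>x\<bar>)"
  define Sd where "Sd = (\<Sum>x\<leftarrow>map d0 [0..<n]. \<bar>x\<bar>)"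
  \<comment> \<open>\<open>2 * W\<close> bounds the difference of any two end amounts, and
    \<open>Sc\<close>, \<open>Sd\<close> bound the sums of the variable bounds over any segment. A
    single slack of size \<open>T\<close> thus compensates every possible deficit of its
    segment.\<close>
  define T where "T = 2 * W + Sc + Sd"
  define Sl where "Sl = (\<Sum>i\<leftarrow>[0..<n]. \<bar>p0 i\<bar> + q0 i * (2 * \<bar>c0 i\<bar> + 2 * \<bar>d0 i\<bar> + 1))"
  define M where "M = 1 + Sl"
  define a b where "a = (\<lambda>k. a0 (k div 3))" and "b = (\<lambda>k. b0 (k div 3))"
  define c d where "c = triple c0 0 (- T)" and "d = triple d0 T 0"
  define E where "E = (*) 3 ` set (0 # sg)"
  have q_nonneg: "0 \<le> q0 i" for i using q by (simp add: quad_costs_def)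
  have R: "R \<in> range_of K" using ab(2)[of n] ends(3) by simp
  have "W \<in> range_of K" unfolding W_def map_map comp_def
    by (intro range_of_closed sum_list_in_range abs_in_range ab R)
  moreover have "Sc \<in> range_of K" "Sd \<in> range_of K" unfolding Sc_def Sd_def map_map comp_def
    by (intro sum_list_in_range abs_in_range cd)+
  moreover have "T = W + W + Sc + Sd" by (simp add: T_def)
  ultimately have TK: "T \<in> range_of K" by (simp only: range_of_closed)
  have zK: "0 \<in> range_of K" by (cases K) auto
  have tK: "f k \<in> range_of K" if "f = triple g u v" "\<And>i. g i \<in> range_of K" "u \<in> range_of K" "v \<in> range_of K" for f g k u v
    using that by (simp add: triple_def)
  have mT: "- T \<in> range_of K" using range_of_closed(2)[OF zK TK] by simp
  have q': "quad_costs (triple q0 0 0)"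
    using q_nonneg by unfold_locales (simp add: triple_def)
  interpret nb: nested_blocks K "triple q0 0 0" "triple p0 M (- M)" E a b c d C
  proof (rule nested_blocks.intro[OF q'], unfold_locales)
    show "search_ok K C" by (rule search)
    show "a k \<le> b k" if "k \<in> E" for k using that ab(1) ends by (auto simp: E_def a_def b_def)
    show "a k \<in> range_of K \<and> b k \<in> range_of K" if "k \<in> E" for k using ab by (simp add: a_def b_def)
    show "c i \<in> range_of K" "d i \<in> range_of K" for i
      using tK[OF c_def cd(1) zK mT] tK[OF d_def cd(2) TK zK] by auto
  qed
  have pos: "0 \<le> W" "0 \<le> Sc" "0 \<le> Sd"
    unfolding W_def Sc_def Sd_def by (auto intro!: add_nonneg_nonneg sum_list_nonneg)
  then have T: "0 \<le> T" by (simp add: T_def)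
  have Sl: "\<bar>p0 i\<bar> + q0 i * (2 * \<bar>c0 i\<bar> + 2 * \<bar>d0 i\<bar> + 1) \<le> Sl" if "i < n" for i
    unfolding Sl_def using that q_nonneg
    by (intro member_le_sum_list) (auto intro!: add_nonneg_nonneg mult_nonneg_nonneg)
  have "0 \<le> Sl" unfolding Sl_def using q_nonneg
    by (auto intro!: sum_list_nonneg add_nonneg_nonneg mult_nonneg_nonneg)
  then have M: "\<bar>p0 i\<bar> + q0 i * (2 * \<bar>c0 i\<bar> + 2 * \<bar>d0 i\<bar> + 1) < M" "0 < M" if "i < n" for i
    using Sl[OF that] by (auto simp: M_def)
  have sgn: "k = 0 \<or> k = n \<or> k \<in> set (butlast sg)" if "k \<in> set (0 # sg)" for k
    using that last ne by (metis append_butlast_last_id insert_iff list.set(2) rotate1.simps(2) set_rotate1)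
  have W: "\<bar>a0 k\<bar> \<le> W" "\<bar>b0 k\<bar> \<le> W" if k: "k \<in> set (0 # sg)" for k
  proof -
    have n1: "0 \<le> (\<Sum>x\<leftarrow>map a0 (butlast sg). \<bar>x\<bar>)" "0 \<le> (\<Sum>x\<leftarrow>map b0 (butlast sg). \<bar>x\<bar>)"
      by (auto intro!: sum_list_nonneg)
    consider "k = 0" | "k = n" | "k \<in> set (butlast sg)" using sgn[OF k] by blast
    then show "\<bar>a0 k\<bar> \<le> W" "\<bar>b0 k\<bar> \<le> W"
    proof (atomize (full), cases)
      case 1 then show "\<bar>a0 k\<bar> \<le> W \<and> \<bar>b0 k\<bar> \<le> W" using ends pos by simp
    next
      case 2 then show "\<bar>a0 k\<bar> \<le> W \<and> \<bar>b0 k\<bar> \<le> W" using ends n1 by (simp add: W_def)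
    next
      case 3 then show "\<bar>a0 k\<bar> \<le> W \<and> \<bar>b0 k\<bar> \<le> W"
        using n1 sum_list_abs_ge[of k "butlast sg" a0] sum_list_abs_ge[of k "butlast sg" b0] abs_ge_zero[of R]
        unfolding W_def map_map comp_def by (intro conjI) linarith+
    qed
  qed
  have le_n: "k \<le> n" if "k \<in> set (0 # sg)" for k
  proof -
    have "sorted_wrt (<) ((0 # butlast sg) @ [n])" using sorted append_butlast_last_id[OF ne] last by simp
    then have "j < n" if "j \<in> set (0 # butlast sg)" for j using that unfolding sorted_wrt_append by auto
    then show ?thesis using sgn[OF that] by fastforce
  qed
  have cd0: "c0 i \<le> d0 i" if "i < n" for i
    using x0 that order_trans[of "c0 i" "x0 i" "d0 i"]
    unfolding quad_costs.canonical_def[OF q] quad_costs.block_point_def[OF q] by auto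
  have leaf: "nb.leaf (3 * i) (3 * s)" if split: "0 # sg = pre @ i # s # ss" for pre i s ss
  proof -
    have srt: "i < s" "\<And>k. k \<in> set pre \<Longrightarrow> k < i" "\<And>k. k \<in> set ss \<Longrightarrow> s < k"
      using sorted unfolding split by (auto simp: sorted_wrt_append)
    have mem: "i \<in> set (0 # sg)" "s \<in> set (0 # sg)" unfolding split by auto
    have sn: "s \<le> n" using le_n[OF mem(2)] .
    have s1: "1 \<le> real (s - i)" using srt(1) by simp
    \<comment> \<open>A segment contains at least one variable and hence at least one slack of each
      kind.\<close>
    have Ts: "T \<le> real (s - i) * T" using mult_right_mono[OF s1 T] by simp
    have sc: "sum c {3 * i..<3 * s} = sum c0 {i..<s} - real (s - i) * T"
      "sum d {3 * i..<3 * s} = sum d0 {i..<s} + real (s - i) * T"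
      unfolding c_def d_def using sum_triple[of i s] srt(1) by simp_all
    have "\<bar>sum c0 {i..<s}\<bar> \<le> Sc" "\<bar>sum d0 {i..<s}\<bar> \<le> Sd"
      using sum_segment_abs[OF sn] by (simp_all add: Sc_def Sd_def comp_def)
    then have "sum c {3 * i..<3 * s} \<le> a0 s - b0 i" "b0 s - a0 i \<le> sum d {3 * i..<3 * s}"
      unfolding sc using Ts W[OF mem(1)] W[OF mem(2)] pos unfolding T_def by linarith+
    moreover have "E \<inter> {3 * i<..<3 * s} = {}"
      unfolding E_def split using srt by fastforce
    moreover have "c k \<le> d k" if "k < 3 * s" for k
    proof -
      have "k div 3 < n" using that sn by linarith
      then show ?thesis using cd0 T by (simp add: c_def d_def triple_def)
    qed
    moreover have "3 * i \<in> E" "3 * s \<in> E" unfolding E_def using mem by blast+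
    ultimately show ?thesis unfolding nb.leaf_def using srt(1) by (simp add: a_def b_def)
  qed
  have leaves: "nb.leaves i ss" if "0 # sg = pre @ i # ss" for pre i ss
    using that
  proof (induction ss arbitrary: pre i)
    case (Cons s ss)
    then show ?case using leaf[OF Cons.prems] Cons.IH[of "pre @ [i]" s] by simp
  qed simp
  have "length sg \<le> n"
  proof -
    have "distinct sg" using sorted by (simp add: strict_sorted_iff)
    moreover have "set sg \<subseteq> {1..n}" using sorted le_n by force
    ultimately show ?thesis using card_mono[of "{1..n}" "set sg"] by (simp add: distinct_card)
  qed
  note m = this
  have asn: "map f (butlast sg) @ [f n] = map f sg" for f :: "nat \<Rightarrow> real"
    using append_butlast_last_id[OF ne] last by (metis list.simps(8,9) map_append)
  have app: "gives K F_APP (Cell (vlist Num (map f (butlast sg))) (Cell (Num R) Nil_cell)) (vlist Num (map f sg)) (20 * n + 20)"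
    if "f n = R" for f
    using gives_mono[OF app_gives[of K Num "map f (butlast sg)" "[R]"]] asn[of f] m that by simp
  define A1 where "A1 = (\<Sum>x\<leftarrow>map a0 (butlast sg). \<bar>x\<bar>)"
  define B1 where "B1 = (\<Sum>x\<leftarrow>map b0 (butlast sg). \<bar>x\<bar>)"
  have sa: "gives K F_SUMABS (vlist Num (map a0 (butlast sg))) (Num A1) (50 * n + 30)"
    and sb: "gives K F_SUMABS (vlist Num (map b0 (butlast sg))) (Num B1) (50 * n + 30)"
    by (rule gives_mono[OF sumabs_gives]; use m in \<open>simp add: A1_def B1_def\<close>)+
  have TM: "2 * A1 + 2 * B1 + 2 * \<bar>R\<bar> + Sc + Sd = T" "1 + Sl = M"
    by (simp_all add: T_def W_def A1_def B1_def M_def)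
  have sl: "gives K F_SLOPES (Cell (vlist Num (map q0 [0..<n])) (Cell (vlist Num (map p0 [0..<n])) (Cell (vlist Num (map c0 [0..<n])) (vlist Num (map d0 [0..<n])))))
     (Num Sl) (200 * n + 30)"
    using slopes_gives[where js = "[0..<n]", of K q0 p0 c0 d0] by (simp add: Sl_def)
  have sc: "gives K F_SUMABS (vlist Num (map c0 [0..<n])) (Num Sc) (50 * n + 30)"
    and sd: "gives K F_SUMABS (vlist Num (map d0 [0..<n])) (Num Sd) (50 * n + 30)"
    using sumabs_gives[of K "map c0 [0..<n]"] sumabs_gives[of K "map d0 [0..<n]"] by (simp_all add: Sc_def Sd_def)
  have ex: "gives K F_EXPAND (Cell (Num T) (Cell (Num M) (Cell (vlist Num (map q0 [0..<n])) (Cell (vlist Num (map p0 [0..<n]))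
      (Cell (vlist Num (map c0 [0..<n])) (vlist Num (map d0 [0..<n])))))))
     (nb.its_val (3 * 0) (3 * n) c d) (200 * n + 30)"
    using expand_gives[where js = "[0..<n]", of K T M q0 p0 c0 d0] unfolding expanded_items c_def d_def by simp
  have ends': "a (3 * 0) = 0" "b (3 * 0) = 0" by (simp_all add: a_def b_def ends)
  define Bt where "Bt = nb.build_rate * (3 * n)"
  define Pt where "Pt = (nb.pass_rate * (3 * n) + 60) * e"
  have bd: "rcall K F_BUILD (Cell (vlist Num (map real sg)) (Cell (vlist Num (map a0 sg)) (Cell (vlist Num (map b0 sg))
      (Cell (Num 0) (Cell (Num 0) (Cell (Num 0) (nb.its_val (3 * 0) (3 * n) c d)))))))
    (\<lambda>v t. \<exists>vs. v = vlist (\<lambda>x. x) vs \<and> nb.blocks (map ((*) 3) (0 # sg)) vs \<and> length vs = length sg \<and> t \<le> Bt + 30)"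
  proof -
    have "map (\<lambda>s. a (3 * s)) sg = map a0 sg" "map (\<lambda>s. b (3 * s)) sg = map b0 sg" "3 * n - 3 * 0 = 3 * n"
      by (simp_all add: a_def b_def)
    note eqs = this ends' of_nat_0
    have "nb.leaves 0 sg" "last (0 # sg) = n" using leaves[of "[]" 0 sg] ne last by simp_all
    from nb.build_blocks[OF this] show ?thesis unfolding eqs Bt_def .
  qed
  have ps: "rcall K F_PASSES (vlist (\<lambda>x. x) vs) (\<lambda>v t. nb.is_block 0 (3 * n) v \<and> t \<le> Pt + 20)"
    if "nb.blocks (map ((*) 3) (0 # sg)) vs" "length vs = length sg" for vs
  proof -
    have "vs \<noteq> []" "length vs \<le> 2 ^ e" using that(2) ne e by auto
    moreover have hl: "hd (map ((*) 3) (0 # sg)) = 0" "last (map ((*) 3) (0 # sg)) = 3 * n"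
      using ne last by (simp_all add: last_map)
    ultimately show ?thesis using nb.passes_blocks[OF that(1)] unfolding Pt_def hl diff_zero by blast
  qed
  have fin: "vlist Num (map (\<lambda>i. x1 (3 * i)) [0..<n]) = vlist Num (map x0 [0..<n])"
    if "quad_costs.canonical K (triple q0 0 0) (triple p0 M (- M)) E a b c d 0 (3 * n) 0 R x1" for x1
    using slack_unused[OF q x0 that[unfolded E_def a_def b_def c_def d_def] T M]
    by (intro arg_cong[of _ _ "vlist Num"] map_cong) auto
  have bv: "\<exists>x1 x2 x3 x4. v = nb.block_val 0 (3 * n) x1 x2 x3 x4 \<and>
     vlist Num (map (\<lambda>i. x1 (3 * i)) [0..<n]) = vlist Num (map x0 [0..<n])"
    if "nb.is_block 0 (3 * n) v" for v
  proof -
    have "a 0 = 0" "a (3 * n) = R" by (simp_all add: a_def ends)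
    then show ?thesis using that fin unfolding nb.is_block_def nb.solved_def by metis
  qed
  have ct: "core_time C n e = Bt + 1500 * n + 700 + Pt" by (simp add: core_time_def Bt_def Pt_def)
  show ?thesis unfolding ct
    apply (rule rcall_body[where b = b_core], simp, simp, unfold b_core_def, simp)
    apply (rule gives_call[OF sa], simp)
    apply (rule gives_call[OF sb], simp)
    apply (rule max_call, simp add: max_minus)
    apply (rule gives_call[OF sc], simp)
    apply (rule gives_call[OF sd], simp)
    apply (rule gives_call[OF sl], simp)
    apply (subst wp_let, simp)
    apply (rule gives_call[OF app[of a0, OF ends(3)]], simp)
    apply (rule gives_call[OF app[of b0, OF ends(4)]], simp add: TM)
    apply (rule gives_call[OF ex], simp)
    apply (rule rcall_mono[OF bd[simplified]], elim exE conjE, simp)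
    apply (rule rcall_mono[OF ps], simp, assumption)
    apply (elim conjE, drule bv, elim exE conjE, simp add: nb.block_val_def)
    apply (rule gives_call[OF out_gives], simp)
    done
qed

section \<open>Instances\<close>

lemma encode_list_vlist: "encode_list (map f xs) = vlist f xs"
  by (induction xs) (auto simp: encode_list_def)

lemma vlist_map: "vlist f (map g xs) = vlist (\<lambda>x. f (g x)) xs"
  by (induction xs) auto

lemma encode_vector_vlist: "encode_vector k x = vlist Num (map (\<lambda>i. x (Suc i)) [0..<k])"
proof -
  have "[1..<k + 1] = map Suc [0..<k]" by (simp add: map_Suc_upt)
  then show ?thesis unfolding encode_vector_def encode_list_vlist by (simp only: vlist_map)
qed

lemma atLeast_1_image: "{1..k} = Suc ` {0..<k}"
  by (simp add: image_Suc_atLeastLessThan atLeastLessThanSuc_atLeastAtMost)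

text \<open>The bounds are indexed by positions instead of constraints. The two ends become
  constraints with equal bounds: amount 0 at the start and the whole resource at position
  \<open>num_vars I\<close>.\<close>

definition nested_bound :: "rapnc \<Rightarrow> (nat \<Rightarrow> int) \<Rightarrow> nat \<Rightarrow> real" where
  "nested_bound I f k =
     (if k = 0 then 0 else if k = num_vars I then real_of_int (resource I)
      else real_of_int (f (the_inv_into {1..num_cons I} (sigma I) k)))"

locale rapnc_instance =
  fixes I :: rapnc
  assumes rapnc: "is_rapnc I"
begin

abbreviation "n \<equiv> num_vars I"
abbreviation "m \<equiv> num_cons I"

definition segs :: "nat list" where "segs = map (\<lambda>i. sigma I (Suc i)) [0..<m]"

lemma m_pos: "1 \<le> m" and sigma_less: "1 \<le> i \<Longrightarrow> i < j \<Longrightarrow> j \<le> m \<Longrightarrow> sigma I i < sigma I j"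
  and sigma_range: "sigma I ` {1..m} \<subseteq> {1..n}" and sigma_m: "sigma I m = n"
  using rapnc unfolding is_rapnc_def strict_mono_on_def by auto

lemma sigma_pos: "1 \<le> i \<Longrightarrow> i \<le> m \<Longrightarrow> 1 \<le> sigma I i"
  using sigma_range by (auto simp: image_subset_iff)

lemma n_pos: "1 \<le> n"
  using sigma_pos[OF m_pos order_refl] sigma_m by simp

lemma sigma_inj: "inj_on (sigma I) {1..m}"
  using rapnc unfolding is_rapnc_def by (auto intro: strict_mono_on_imp_inj_on)

lemma segs_props: "segs \<noteq> []" "last segs = n" "sorted_wrt (<) (0 # segs)" "length segs = m"
  "set segs = sigma I ` {1..m}"
proof -
  show "segs \<noteq> []" "length segs = m" using m_pos by (auto simp: segs_def)
  have "last [0..<m] = m - 1" using m_pos by (simp add: last_upt)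
  then show "last segs = n" unfolding segs_def using m_pos sigma_m by (subst last_map) auto
  show set: "set segs = sigma I ` {1..m}"
    unfolding segs_def atLeast_1_image by (simp only: set_map set_upt image_image)
  have "sorted_wrt (<) segs"
    unfolding sorted_wrt_iff_nth_less segs_def by (auto intro: sigma_less)
  moreover have "\<forall>s\<in>set segs. 0 < s" unfolding set using sigma_range by fastforce
  ultimately show "sorted_wrt (<) (0 # segs)" by simp
qed

lemma bound_sigma: "1 \<le> i \<Longrightarrow> i < m \<Longrightarrow> nested_bound I f (sigma I i) = real_of_int (f i)"
proof -
  assume i: "1 \<le> i" "i < m"
  have "sigma I i \<noteq> n" "sigma I i \<noteq> 0" using sigma_less[OF i(1) i(2)] sigma_m sigma_pos[of i] i by auto
  then show ?thesis using i the_inv_into_f_f[OF sigma_inj, of i] by (simp add: nested_bound_def)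
qed

lemma bound_ends: "nested_bound I f 0 = 0" "nested_bound I f n = real_of_int (resource I)"
  using n_pos by (simp_all add: nested_bound_def)

lemma butlast_segs: "map (nested_bound I f) (butlast segs) = map (\<lambda>i. real_of_int (f (Suc i))) [0..<m - 1]"
proof -
  obtain k where k: "m = Suc k" using m_pos by (cases m) auto
  have "butlast segs = map (\<lambda>i. sigma I (Suc i)) [0..<k]" by (simp add: segs_def k)
  then show ?thesis using bound_sigma k by simp
qed

lemma point_iff:
  assumes q: "quad_costs q0"
  shows "feasible_point K I x \<longleftrightarrow> quad_costs.block_point K (set (0 # segs))
     (nested_bound I (nest_lo I)) (nested_bound I (nest_up I)) (\<lambda>i. real_of_int (var_lo I (Suc i)))
     (\<lambda>i. real_of_int (var_up I (Suc i))) 0 n 0 (real_of_int (resource I)) (\<lambda>i. x (Suc i))"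
proof -
  have s: "(\<Sum>k=1..s. x k) = (\<Sum>i=0..<s. x (Suc i))" for s
    by (simp add: sum.atLeast1_atMost_eq atLeast0LessThan)
  have all: "(\<forall>i\<in>{1..k}. P i) \<longleftrightarrow> (\<forall>i\<in>{0..<k}. P (Suc i))" for P and k :: nat
    unfolding atLeast_1_image by blast
  have E: "set (0 # segs) \<inter> {0<..<n} = sigma I ` {1..m - 1}"
  proof -
    have "{1..m} = insert m {1..m - 1}" using m_pos by auto
    moreover have "sigma I i < n" if "i \<in> {1..m - 1}" for i using that sigma_less[of i m] sigma_m by auto
    moreover have "0 < sigma I i" if "i \<in> {1..m - 1}" for i
    proof -
      have "1 \<le> i" "i \<le> m" using that by auto
      then show ?thesis using sigma_pos[of i] by simp
    qed
    ultimately show ?thesis using segs_props(5) sigma_m by auto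
  qed
  have b: "nested_bound I f (sigma I i) = real_of_int (f i)" if "i \<in> {1..m - 1}" for f i
    using that by (intro bound_sigma) auto
  have nest: "(\<forall>k\<in>sigma I ` {1..m - 1}. nested_bound I (nest_lo I) k \<le> 0 + sum y {0..<k} \<and>
        0 + sum y {0..<k} \<le> nested_bound I (nest_up I) k) \<longleftrightarrow>
      (\<forall>i\<in>{1..m - 1}. real_of_int (nest_lo I i) \<le> sum y {0..<sigma I i} \<and> sum y {0..<sigma I i} \<le> real_of_int (nest_up I i))" for y
    unfolding ball_simps by (intro ball_cong refl) (simp only: b add_0)
  show ?thesis
    unfolding feasible_point_def quad_costs.block_point_def[OF q] E s all[of n] nest by auto
qed

lemma segs_bounds: "k \<in> set segs \<Longrightarrow> nested_bound I (nest_lo I) k \<le> nested_bound I (nest_up I) k"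
proof -
  assume "k \<in> set segs"
  then obtain i where i: "k = sigma I i" "1 \<le> i" "i \<le> m" using segs_props(5) by auto
  show ?thesis
  proof (cases "i = m")
    case True
    then show ?thesis using i bound_ends sigma_m by simp
  next
    case False
    then have "i < m" using i by simp
    moreover have "nest_lo I i \<le> nest_up I i" using rapnc i \<open>i < m\<close> unfolding is_rapnc_def by auto
    ultimately show ?thesis using i bound_sigma by simp
  qed
qed

abbreviation instance_arg :: "(nat \<Rightarrow> real) \<Rightarrow> (nat \<Rightarrow> real) \<Rightarrow> val" where
  "instance_arg q p \<equiv> core_arg (encode_vector m (\<lambda>i. real (sigma I i)))
     (encode_vector (m - 1) (\<lambda>i. real_of_int (nest_lo I i))) (encode_vector (m - 1) (\<lambda>i. real_of_int (nest_up I i)))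
     (real_of_int (resource I)) (encode_vector n (\<lambda>i. real_of_int (var_lo I i)))
     (encode_vector n (\<lambda>i. real_of_int (var_up I i))) (encode_vector n q) (encode_vector n p)"

lemma core_optimal:
  assumes search: "search_ok K C" and q: "\<forall>i\<in>{1..n}. 0 \<le> q i" and feas: "feasible K I" and e: "m \<le> 2 ^ e"
  shows "\<exists>x. optimal_solution K I (\<lambda>i. quadratic_fun (q i) (p i) (r i)) x \<and>
    rcall K F_CORE (instance_arg q p)
      (\<lambda>v t. v = encode_vector n x \<and> t \<le> core_time C n e)"
proof -
  \<comment> \<open>The cost locale requires nonnegative coefficients at all positions; outside of
    the instance they are set to 0.\<close>
  define q0 where "q0 i = (if i < n then q (Suc i) else 0)" for i
  define p0 where "p0 i = p (Suc i)" for i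
  have q0: "quad_costs q0"
    using q by unfold_locales (auto simp: q0_def)
  interpret quad_costs K q0 p0 by (rule q0)
  let ?E = "set (0 # segs)" and ?a = "nested_bound I (nest_lo I)" and ?b = "nested_bound I (nest_up I)"
  let ?c = "\<lambda>i. real_of_int (var_lo I (Suc i))" and ?d = "\<lambda>i. real_of_int (var_up I (Suc i))"
  let ?R = "real_of_int (resource I)"
  have zK: "0 \<in> range_of K" by (cases K) auto
  have nK: "nested_bound I f k \<in> range_of K" for f k
    unfolding nested_bound_def using zK range_of_closed(4) by simp
  obtain z where "feasible_point K I z" using feas by (auto simp: feasible_def)
  then have "block_point ?E ?a ?b ?c ?d 0 n 0 ?R (\<lambda>i. z (Suc i))" by (simp only: point_iff[OF q0])
  from canonical_exists[OF this range_of_closed(4) range_of_closed(4) conjI[OF nK nK] zK]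
  obtain x0 where x0: "canonical ?E ?a ?b ?c ?d 0 n 0 ?R x0"
    and min: "\<And>y. block_point ?E ?a ?b ?c ?d 0 n 0 ?R y \<Longrightarrow> block_cost 0 n x0 \<le> block_cost 0 n y" by blast
  define x where "x i = x0 (i - 1)" for i
  have xS: "(\<lambda>i. x (Suc i)) = x0" by (simp add: x_def)
  have obj: "objective I (\<lambda>i. quadratic_fun (q i) (p i) (r i)) y = block_cost 0 n (\<lambda>i. y (Suc i)) + (\<Sum>i=1..n. r i)" for y
  proof -
    have "(\<Sum>i=1..n. q i * (y i)\<^sup>2 + p i * y i) = block_cost 0 n (\<lambda>i. y (Suc i))"
      by (simp add: block_cost_def p0_def q0_def sum.atLeast1_atMost_eq atLeast0LessThan)
    then show ?thesis by (simp add: objective_def quadratic_fun_def sum.distrib)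
  qed
  have "optimal_solution K I (\<lambda>i. quadratic_fun (q i) (p i) (r i)) x"
    unfolding optimal_solution_def obj point_iff[OF q0] xS
    using x0 min by (auto simp: canonical_def)
  moreover
  have vec: "vlist Num (map q0 [0..<n]) = encode_vector n q" "vlist Num (map p0 [0..<n]) = encode_vector n p"
    "vlist Num (map x0 [0..<n]) = encode_vector n x" "vlist Num (map real segs) = encode_vector m (\<lambda>i. real (sigma I i))"
    unfolding encode_vector_vlist by (auto simp: p0_def q0_def x_def segs_def comp_def intro!: arg_cong[of _ _ "vlist Num"])
  have vec': "vlist Num (map (nested_bound I f) (butlast segs)) = encode_vector (m - 1) (\<lambda>i. real_of_int (f i))"
    "vlist Num (map (\<lambda>i. real_of_int (f (Suc i))) [0..<n]) = encode_vector n (\<lambda>i. real_of_int (f i))" for f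
    unfolding encode_vector_vlist butlast_segs by auto
  have "length segs \<le> 2 ^ e" using e segs_props(4) by simp
  from core_solves[OF search q0 segs_props(3,1,2) bound_ends(1) bound_ends(1) bound_ends(2) bound_ends(2)
      segs_bounds nK nK range_of_closed(4) range_of_closed(4) x0 this, unfolded vec vec']
  have "rcall K F_CORE (instance_arg q p)
      (\<lambda>v t. v = encode_vector n x \<and> t \<le> core_time C n e)" .
  ultimately show ?thesis by blast
qed

section \<open>Total running time\<close>

lemma exponent: obtains e where "m \<le> 2 ^ e" "real e \<le> 2 * max 1 (log 2 (real m))"
proof
  have l: "0 \<le> log 2 (real m)" using m_pos by simp
  have "real m = 2 powr log 2 (real m)" using m_pos by simp
  also have "\<dots> \<le> 2 powr real (nat \<lceil>log 2 (real m)\<rceil>)" using l by (intro powr_mono) linarith+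
  also have "\<dots> = real (2 ^ nat \<lceil>log 2 (real m)\<rceil>)" by (simp add: powr_realpow)
  finally show "m \<le> 2 ^ nat \<lceil>log 2 (real m)\<rceil>" by (simp only: of_nat_le_iff)
  show "real (nat \<lceil>log 2 (real m)\<rceil>) \<le> 2 * max 1 (log 2 (real m))" using l by linarith
qed

text \<open>It depends on the search constant only, not on the instance. 2430 collects the terms
  \<open>1530 * n + 900\<close> by \<open>n \<ge> 1\<close>. The factor 2 stems from rounding up the
  logarithm to the number of passes.\<close>

definition time_factor :: "nat \<Rightarrow> real" where
  "time_factor C = real (3 * nested_blocks.build_rate C + 2430 + 2 * (3 * nested_blocks.pass_rate C + 60))"

lemma time_bound:
  assumes e: "real e \<le> 2 * max 1 (log 2 (real m))" and t: "t \<le> core_time C n e + 30 * n + 200"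
  shows "real t \<le> time_factor C * n_log_m I"
proof -
  define L where "L = max 1 (log 2 (real m))"
  define B where "B = real (nested_blocks.build_rate C)"
  define P where "P = real (nested_blocks.pass_rate C)"
  have n1: "1 \<le> real n" using n_pos by simp
  have nn: "0 \<le> B" "0 \<le> P" by (simp_all add: B_def P_def)
  have nL: "real n \<le> real n * L" using mult_left_mono[of 1 L "real n"] by (simp add: L_def)
  have "real t \<le> (3 * B + 1530) * real n + 900 + (3 * P * real n + 60) * real e"
    using t by (simp add: core_time_def B_def P_def algebra_simps flip: of_nat_le_iff[where 'a = real])
  also have "\<dots> \<le> (3 * B + 2430) * real n + (3 * P + 60) * (real n * real e)"
    using mult_right_mono[OF n1, of "real e"] n1 by (simp add: algebra_simps)
  also have "\<dots> \<le> (3 * B + 2430) * (real n * L) + (3 * P + 60) * (real n * (2 * L))"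
    using nn nL e by (intro add_mono mult_left_mono) (auto simp: L_def)
  also have "\<dots> = time_factor C * n_log_m I"
    by (simp add: time_factor_def n_log_m_def L_def B_def P_def algebra_simps)
  finally show ?thesis .
qed

end

lemma rcall_runs:
  assumes "rcall K 0 u (\<lambda>v t. v = w \<and> t \<le> T)"
  shows "\<exists>t. runs (K = Integer) (rap_program K) u w t \<and> t \<le> T"
proof -
  have "rap_program K \<noteq> []" by (simp add: rap_program_def bodies_def)
  then show ?thesis using assms unfolding rcall_def wp_call_def runs_def by blast
qed

text \<open>Convexity at the midpoint of -1 and 1 reads \<open>r \<le> q + r\<close>.\<close>

lemma convex_quadratic_nonneg:
  assumes "convex_on UNIV (quadratic_fun q p r)"
  shows "0 \<le> q"
  using convex_onD[OF assms, of "1/2" "- 1" 1] by (simp add: quadratic_fun_def field_simps)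

lemma linear_is_quadratic: "linear_fun p r = quadratic_fun 0 p r"
  by (simp add: fun_eq_iff linear_fun_def quadratic_fun_def)

theorem rap_program_solves:
  assumes search: "search_ok K C" and I: "is_rapnc I" "feasible K I"
  shows "\<forall>i\<in>{1..num_vars I}. 0 \<le> q i \<Longrightarrow>
      solves_within K (rap_program K) I (\<lambda>i. quadratic_fun (q i) (p i) (r i)) [q, p, r] (rapnc_instance.time_factor C * n_log_m I)"
    and "solves_within K (rap_program K) I (\<lambda>i. linear_fun (p i) (r i)) [p, r] (rapnc_instance.time_factor C * n_log_m I)"
proof -
  interpret rapnc_instance I by unfold_locales (rule I(1))
  obtain e where e: "m \<le> 2 ^ e" "real e \<le> 2 * max 1 (log 2 (real m))" by (rule exponent)
  define T where "T = core_time C n e"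
  have fin: "solves_within K (rap_program K) I f cs (time_factor C * n_log_m I)"
    if "optimal_solution K I f x" "rcall K 0 (encode_instance I cs) (\<lambda>v t. v = encode_vector n x \<and> t \<le> T + 30 * n + 200)" for f cs x
    using rcall_runs[OF that(2)] that(1) time_bound[OF e(2), of _ C] unfolding solves_within_def T_def by blast
  show "solves_within K (rap_program K) I (\<lambda>i. quadratic_fun (q i) (p i) (r i)) [q, p, r] (time_factor C * n_log_m I)"
    if q: "\<forall>i\<in>{1..n}. 0 \<le> q i"
  proof -
    obtain x where x: "optimal_solution K I (\<lambda>i. quadratic_fun (q i) (p i) (r i)) x" and
      C: "rcall K F_CORE (instance_arg q p)
      (\<lambda>v t. v = encode_vector n x \<and> t \<le> T)"
      using core_optimal[OF search q I(2) e(1)] unfolding T_def by blast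
    show ?thesis
      apply (rule fin[OF x], unfold encode_instance_def encode_list_def, simp)
      apply (rule rcall_body[OF bodies_nth(1)], simp, unfold b_main_def, simp)
      apply (rule rcall_mono[OF C[simplified]])
      apply simp
      done
  qed
  show "solves_within K (rap_program K) I (\<lambda>i. linear_fun (p i) (r i)) [p, r] (time_factor C * n_log_m I)"
  proof -
    have "\<forall>i\<in>{1..n}. 0 \<le> (0::real)" by simp
    from core_optimal[OF search this I(2) e(1), of p r]
    obtain x where x: "optimal_solution K I (\<lambda>i. linear_fun (p i) (r i)) x" and
      C: "rcall K F_CORE (instance_arg (\<lambda>i. 0) p)
      (\<lambda>v t. v = encode_vector n x \<and> t \<le> T)"
      unfolding linear_is_quadratic T_def by blast
    have z: "gives K F_ZERO (encode_vector n p) (encode_vector n (\<lambda>i. 0)) (30 * n + 30)"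
      using zero_gives[of K Num "map (\<lambda>i. p (Suc i)) [0..<n]"] unfolding encode_vector_vlist by (simp add: comp_def)
    show ?thesis
      apply (rule fin[OF x], unfold encode_instance_def encode_list_def, simp)
      apply (rule rcall_body[OF bodies_nth(1)], simp, unfold b_main_def, simp)
      apply (rule gives_call[OF z], simp)
      apply (rule rcall_mono[OF C[simplified]])
      apply simp
      done
  qed
qed

theorem mainTheorem3:
  fixes K :: variables
  shows
    "(\<exists>(P :: program) (C :: real). \<forall>(I :: rapnc) (q :: nat \<Rightarrow> real) (p :: nat \<Rightarrow> real) (r :: nat \<Rightarrow> real).
        is_rapnc I \<and> feasible K I \<and>
        (\<forall>i\<in>{1..num_vars I}. convex_on UNIV (quadratic_fun (q i) (p i) (r i))) \<longrightarrow>
        solves_within K P I (\<lambda>i. quadratic_fun (q i) (p i) (r i)) [q, p, r] (C * n_log_m I))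
     \<and>
     (\<exists>(P :: program) (C :: real). \<forall>(I :: rapnc) (p :: nat \<Rightarrow> real) (r :: nat \<Rightarrow> real).
        is_rapnc I \<and> feasible K I \<longrightarrow>
        solves_within K P I (\<lambda>i. linear_fun (p i) (r i)) [p, r] (C * n_log_m I))"
proof -
  \<comment> \<open>The constant is fixed before the instance; the same program and the same factor
    serve for both claims.\<close>
  obtain C where search: "search_ok K C" using search_linear by blast
  note solves = rap_program_solves[OF search]
  show ?thesis
    using solves convex_quadratic_nonneg
    by (intro conjI exI[of _ "rap_program K"] exI[of _ "rapnc_instance.time_factor C"]) blast+
qed

end
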